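(* Let $\varphi$ be a linear fractional self-map of the unit disk $D$ that is not a constant. Then $C_\varphi$ is complex symmetric on $H^2(D)$ if and only if at least one of the following conditions holds: (i) the two fixed points of $\varphi$ on $\hat{\mathbb{C}}$ are $0$ and a point outside $\overline{D}$; (ii) the two fixed points of $\varphi$ on $\hat{\mathbb{C}}$ are $\infty$ and a point in $D$; (iii) $\varphi$ is an involutive automorphism.
   Context: $D$ is the open unit disk in $\mathbb{C}$, $\overline{D}$ its closure, and $\hat{\mathbb{C}}=\mathbb{C}\cup\{\infty\}$ the Riemann sphere. A non-constant linear fractional self-map of $D$ is a map $\varphi(z)=\frac{\alpha z+\beta}{\gamma z+\delta}$ with $\alpha\delta-\beta\gamma\neq0$ and $\varphi(D)\subset D$; it is regarded as a biholomorphic map of $\hat{\mathbb{C}}$ onto itself when its fixed points on $\hat{\mathbb{C}}$ are considered. An automorphism of $D$ is a biholomorphic map of $D$ onto itself. An involutive automorphism is an (elliptic) automorphism of order two, where the order is the smallest positive integer $n$ such that the $n$-th iterate of $\varphi$ is the identity on $D$; these are the maps $\varphi_a(z)=\frac{a-z}{1-\overline{a}z}$ with $a\in D$. $H^2(D)$ is the Hardy space of analytic functions $f$ on $D$ with $\|f\|^2=\sup_{0<r<1}\int_0^{2\pi}|f(re^{i\theta})|^2\frac{d\theta}{2\pi}<\infty$, a Hilbert space. For an analytic self-map $\varphi$ of $D$, the composition operator $C_\varphi f=f\circ\varphi$ is bounded on $H^2(D)$. A conjugation on a complex Hilbert space $\mathcal{H}$ is a map $C:\mathcal{H}\to\mathcal{H}$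 that is conjugate-linear, satisfies $\langle Cx,Cy\rangle=\langle y,x\rangle$ for all $x,y\in\mathcal{H}$, and satisfies $C^2=I$. A bounded operator $T$ on $\mathcal{H}$ is complex symmetric if there exists a conjugation $C$ on $\mathcal{H}$ with $T=CT^*C$.
   Formalization: "The two fixed points are p and q" is read as: p and q are fixed points. For every map but the identity this is the same; the identity, whose composition operator is complex symmetric although it does not have exactly two fixed points, thereby falls under (i) and (ii). *)

theory Defs
  imports "HOL-Complex_Analysis.Complex_Analysis"
begin

abbreviation unit_disk :: "complex set" where
  "unit_disk \<equiv> ball 0 1"


section \<open>Operators on Hilbert spaces of complex-valued functions\<close>

text \<open>
  A Hilbert space of functions is given by a carrier \<open>H\<close>, with pointwise vector space operations,
  and an inner product \<open>ip\<close>, linear in the first argument.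
\<close>

definition bounded_operator_on ::
    "('a \<Rightarrow> complex) set \<Rightarrow> (('a \<Rightarrow> complex) \<Rightarrow> ('a \<Rightarrow> complex) \<Rightarrow> complex)
      \<Rightarrow> (('a \<Rightarrow> complex) \<Rightarrow> ('a \<Rightarrow> complex)) \<Rightarrow> bool" where
  "bounded_operator_on H ip T \<longleftrightarrow>
     (\<forall>f\<in>H. T f \<in> H) \<and>
     (\<forall>f\<in>H. \<forall>g\<in>H. \<forall>a b. T (\<lambda>x. a * f x + b * g x) = (\<lambda>x. a * T f x + b * T g x)) \<and>
     (\<exists>K. \<forall>f\<in>H. sqrt (Re (ip (T f) (T f))) \<le> K * sqrt (Re (ip f f)))"

definition adjoint_on ::
    "('a \<Rightarrow> complex) set \<Rightarrow> (('a \<Rightarrow> complex) \<Rightarrow> ('a \<Rightarrow> complex) \<Rightarrow> complex)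
      \<Rightarrow> (('a \<Rightarrow> complex) \<Rightarrow> ('a \<Rightarrow> complex)) \<Rightarrow> (('a \<Rightarrow> complex) \<Rightarrow> ('a \<Rightarrow> complex)) \<Rightarrow> bool" where
  "adjoint_on H ip T S \<longleftrightarrow>
     (\<forall>f\<in>H. S f \<in> H) \<and> (\<forall>f\<in>H. \<forall>g\<in>H. ip (T f) g = ip f (S g))"

definition conjugation_on ::
    "('a \<Rightarrow> complex) set \<Rightarrow> (('a \<Rightarrow> complex) \<Rightarrow> ('a \<Rightarrow> complex) \<Rightarrow> complex)
      \<Rightarrow> (('a \<Rightarrow> complex) \<Rightarrow> ('a \<Rightarrow> complex)) \<Rightarrow> bool" where
  "conjugation_on H ip C \<longleftrightarrow>
     (\<forall>f\<in>H. C f \<in> H) \<and>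
     (\<forall>f\<in>H. \<forall>g\<in>H. \<forall>a b. C (\<lambda>x. a * f x + b * g x) = (\<lambda>x. cnj a * C f x + cnj b * C g x)) \<and>
     (\<forall>f\<in>H. \<forall>g\<in>H. ip (C f) (C g) = ip g f) \<and>
     (\<forall>f\<in>H. C (C f) = f)"

text \<open>
  In \<open>T = C T\<^sup>* C\<close> the adjoint is bound as the operator \<open>Ts\<close> characterised by \<^const>\<open>adjoint_on\<close>;
  on a Hilbert space it exists and is unique for every bounded \<open>T\<close>.
\<close>

definition complex_symmetric_on ::
    "('a \<Rightarrow> complex) set \<Rightarrow> (('a \<Rightarrow> complex) \<Rightarrow> ('a \<Rightarrow> complex) \<Rightarrow> complex)
      \<Rightarrow> (('a \<Rightarrow> complex) \<Rightarrow> ('a \<Rightarrow> complex)) \<Rightarrow> bool" where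
  "complex_symmetric_on H ip T \<longleftrightarrow>
     bounded_operator_on H ip T \<and>
     (\<exists>C Ts. conjugation_on H ip C \<and> adjoint_on H ip T Ts \<and> (\<forall>f\<in>H. T f = C (Ts (C f))))"


section \<open>The Hardy space and composition operators\<close>

definition hardy_mean :: "(complex \<Rightarrow> complex) \<Rightarrow> real \<Rightarrow> real" where
  "hardy_mean f r =
     integral {0..2 * pi} (\<lambda>\<theta>. (cmod (f (complex_of_real r * cis \<theta>)))\<^sup>2) / (2 * pi)"

text \<open>
  Functions on the disk are represented by functions on the plane that vanish outside the disk:
  each function on the disk then has exactly one representative, and pointwise
  linear combinations of representatives are again representatives.
\<close>

definition hardy_space :: "(complex \<Rightarrow> complex) set" where
  "hardy_space =
     {f. f holomorphic_on unit_disk \<and> (\<forall>z. z \<notin> unit_disk \<longrightarrow> f z = 0) \<and>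
         bdd_above (hardy_mean f ` {0<..<1})}"

definition hardy_norm :: "(complex \<Rightarrow> complex) \<Rightarrow> real" where
  "hardy_norm f = sqrt (SUP r\<in>{0<..<1}. hardy_mean f r)"

text \<open>The inner product inducing the norm, recovered from it by polarization.\<close>

definition hardy_inner :: "(complex \<Rightarrow> complex) \<Rightarrow> (complex \<Rightarrow> complex) \<Rightarrow> complex" where
  "hardy_inner f g =
     (\<Sum>k<4. \<i> ^ k * complex_of_real ((hardy_norm (\<lambda>z. f z + \<i> ^ k * g z))\<^sup>2)) / 4"

definition composition_operator ::
    "(complex \<Rightarrow> complex) \<Rightarrow> (complex \<Rightarrow> complex) \<Rightarrow> (complex \<Rightarrow> complex)" where
  "composition_operator \<phi> f = (\<lambda>z. if z \<in> unit_disk then f (\<phi> z) else 0)"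


section \<open>Linear fractional maps\<close>

datatype riemann_sphere = Fin complex | Infty

definition linfrac :: "complex \<Rightarrow> complex \<Rightarrow> complex \<Rightarrow> complex \<Rightarrow> complex \<Rightarrow> complex" where
  "linfrac \<alpha> \<beta> \<gamma> \<delta> z = (\<alpha> * z + \<beta>) / (\<gamma> * z + \<delta>)"

fun linfrac_sphere ::
    "complex \<Rightarrow> complex \<Rightarrow> complex \<Rightarrow> complex \<Rightarrow> riemann_sphere \<Rightarrow> riemann_sphere" where
  "linfrac_sphere \<alpha> \<beta> \<gamma> \<delta> (Fin z) =
     (if \<gamma> * z + \<delta> = 0 then Infty else Fin (linfrac \<alpha> \<beta> \<gamma> \<delta> z))"
| "linfrac_sphere \<alpha> \<beta> \<gamma> \<delta> Infty = (if \<gamma> = 0 then Infty else Fin (\<alpha> / \<gamma>))"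

text \<open>
  The image is taken on the sphere, so that a pole in the disk is not hidden by \<open>x / 0 = 0\<close>.
\<close>

definition linfrac_self_map :: "complex \<Rightarrow> complex \<Rightarrow> complex \<Rightarrow> complex \<Rightarrow> bool" where
  "linfrac_self_map \<alpha> \<beta> \<gamma> \<delta> \<longleftrightarrow>
     \<alpha> * \<delta> - \<beta> * \<gamma> \<noteq> 0 \<and> linfrac_sphere \<alpha> \<beta> \<gamma> \<delta> ` Fin ` unit_disk \<subseteq> Fin ` unit_disk"

definition fixed_points :: "('a \<Rightarrow> 'a) \<Rightarrow> 'a set" where
  "fixed_points \<Phi> = {p. \<Phi> p = p}"

text \<open>
  A linear fractional map other than the identity that fixes two distinct points of the sphere
  fixes no other point, so ``the two fixed points are \<open>p\<close> and \<open>q\<close>'' can be expressed by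
  \<open>{p, q} \<subseteq> fixed_points \<Phi>\<close>. For the identity, which fixes every point, the inclusion holds
  while equality fails; its composition operator is the identity operator, which is
  complex symmetric.
\<close>

lemma fixed_points_linfrac_sphere:
  assumes det: "\<alpha> * \<delta> - \<beta> * \<gamma> \<noteq> 0"
    and nid: "linfrac_sphere \<alpha> \<beta> \<gamma> \<delta> \<noteq> id"
    and pq: "p \<noteq> q" "{p, q} \<subseteq> fixed_points (linfrac_sphere \<alpha> \<beta> \<gamma> \<delta>)"
  shows "fixed_points (linfrac_sphere \<alpha> \<beta> \<gamma> \<delta>) = {p, q}"
proof -
  let ?\<Phi> = "linfrac_sphere \<alpha> \<beta> \<gamma> \<delta>"
  let ?Q = "\<lambda>z. \<gamma> * z * z + (\<delta> - \<alpha>) * z - \<beta>"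
  have finD: "?Q z = 0" if "?\<Phi> (Fin z) = Fin z" for z
  proof -
    from that have nz: "\<gamma> * z + \<delta> \<noteq> 0" and "linfrac \<alpha> \<beta> \<gamma> \<delta> z = z"
      by (auto split: if_splits)
    then have "\<alpha> * z + \<beta> = z * (\<gamma> * z + \<delta>)"
      by (simp add: linfrac_def divide_eq_eq)
    then show ?thesis by (simp add: algebra_simps)
  qed
  have infD: "\<gamma> = 0" if "?\<Phi> Infty = Infty"
    using that by (auto split: if_splits)
  have nontriv: "\<not> (\<gamma> = 0 \<and> \<alpha> = \<delta> \<and> \<beta> = 0)"
  proof
    assume *: "\<gamma> = 0 \<and> \<alpha> = \<delta> \<and> \<beta> = 0"
    then have "\<delta> \<noteq> 0" using det by auto
    then have "?\<Phi> x = x" for x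
      using * by (cases x) (auto simp: linfrac_def)
    then show False using nid by auto
  qed
  have diff: "\<gamma> * (x + y) + (\<delta> - \<alpha>) = 0" if "?Q x = 0" "?Q y = 0" "x \<noteq> y" for x y
  proof -
    have "(x - y) * (\<gamma> * (x + y) + (\<delta> - \<alpha>)) = ?Q x - ?Q y"
      by (simp add: algebra_simps)
    then show ?thesis using that by simp
  qed
  have three: False if "?Q x = 0" "?Q y = 0" "?Q z = 0" "x \<noteq> y" "x \<noteq> z" "y \<noteq> z" for x y z
  proof -
    have "\<gamma> * (x + y) + (\<delta> - \<alpha>) = 0" "\<gamma> * (x + z) + (\<delta> - \<alpha>) = 0"
      using diff that by blast+
    then have "\<gamma> * (y - z) = 0" by algebra
    then have "\<gamma> = 0" using that by simp
    moreover from this have "\<alpha> = \<delta>" using diff[OF that(1,2,4)] by simp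
    ultimately show False using nontriv that(1) by simp
  qed
  have two: False if "\<gamma> = 0" "?Q x = 0" "?Q y = 0" "x \<noteq> y" for x y
  proof -
    have "\<alpha> = \<delta>" using diff[OF that(2-4)] that(1) by simp
    then show False using nontriv that by simp
  qed
  have fixp: "?\<Phi> p = p" "?\<Phi> q = q" using pq by (auto simp: fixed_points_def)
  have "r = p \<or> r = q" if r: "?\<Phi> r = r" for r
  proof (rule ccontr)
    assume "\<not> (r = p \<or> r = q)"
    then have ne: "r \<noteq> p" "r \<noteq> q" by auto
    show False
    proof (cases "r = Infty \<or> p = Infty \<or> q = Infty")
      case True
      then have g: "\<gamma> = 0" using infD r fixp by blast
      have uniq: False if "x \<noteq> y" "?\<Phi> (Fin x) = Fin x" "?\<Phi> (Fin y) = Fin y" for x y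
        using two[OF g finD[OF that(2)] finD[OF that(3)] that(1)] .
      show False
      proof (cases r)
        case (Fin x)
        then show False using uniq r fixp ne pq(1) by (cases p; cases q) blast+
      next
        case Infty
        then show False using uniq fixp ne pq(1) by (cases p; cases q) blast+
      qed
    next
      case False
      then obtain x y z where xyz: "r = Fin x" "p = Fin y" "q = Fin z"
        by (cases r; cases p; cases q) blast+
      show False
        using three[of x y z] finD[of x] finD[of y] finD[of z] r fixp ne pq(1) unfolding xyz
        by blast
    qed
  qed
  then show ?thesis using fixp by (auto simp: fixed_points_def)
qed

definition disk_automorphism :: "(complex \<Rightarrow> complex) \<Rightarrow> bool" where
  "disk_automorphism \<phi> \<longleftrightarrow>
     \<phi> holomorphic_on unit_disk \<and> bij_betw \<phi> unit_disk unit_disk \<and>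
     inv_into unit_disk \<phi> holomorphic_on unit_disk"

definition has_order_on_disk :: "(complex \<Rightarrow> complex) \<Rightarrow> nat \<Rightarrow> bool" where
  "has_order_on_disk \<phi> n \<longleftrightarrow>
     n > 0 \<and> (\<forall>z\<in>unit_disk. (\<phi> ^^ n) z = z) \<and>
     (\<forall>m. 0 < m \<and> m < n \<longrightarrow> \<not> (\<forall>z\<in>unit_disk. (\<phi> ^^ m) z = z))"

definition involutive_automorphism :: "(complex \<Rightarrow> complex) \<Rightarrow> bool" where
  "involutive_automorphism \<phi> \<longleftrightarrow> disk_automorphism \<phi> \<and> has_order_on_disk \<phi> 2"

end

theory Submission
  imports Defs
begin

text \<open>
  Taking Taylor coefficients identifies the Hardy space with \<open>ell2\<close>, and complex symmetry of \<open>C\<^sub>\<phi>\<close>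
  means that \<open>\<langle>C\<^sub>\<phi> f, C h\<rangle>\<close> is symmetric in \<open>f\<close> and \<open>h\<close> for some conjugation \<open>C\<close>.

  Sufficiency. Composition with the antiholomorphic involution of the disk that exchanges \<open>0\<close> and
  the fixed point \<open>p\<close>, suitably weighted, is a conjugation that works for affine symbols; the
  symmetry is checked on reproducing kernels. Symbols that fix \<open>0\<close> reduce to this case on \<open>z H\<^sup>2\<close>.
  For an involution, the conjugation is the product of \<open>f \<mapsto> cnj (f (\<nu> cnj z))\<close> and the unitary
  part of the polar decomposition of \<open>C\<^sub>\<phi>\<close>.

  Necessity. \<open>C\<close> maps eigenvectors of the adjoint to eigenvectors of \<open>C\<^sub>\<phi>\<close> and preserves angles.
  If \<open>\<phi>\<close> had no fixed point in the disk, its iterates would converge to a boundary point, and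
  the vector \<open>C 1\<close> fixed by the adjoint would vanish. At an attracting fixed point \<open>p\<close> the
  eigenvectors of \<open>C\<^sub>\<phi>\<close> are the powers of \<open>(z - p) / (1 - t z)\<close>, where \<open>1 / t\<close> is the other fixed
  point, and those of the adjoint are combinations of derivative kernels at \<open>p\<close>; comparing the
  angles for the exponents 0, 1, 2 yields \<open>t = 0\<close> if \<open>p\<close> is not \<open>0\<close>. For an elliptic automorphism
  with multiplier \<open>\<eta>\<close>, \<open>\<eta>\<^sup>2 \<noteq> 1\<close>, multiplication by the Blaschke factor at \<open>p\<close> is an isometry that
  raises eigenvalues of \<open>C\<^sub>\<phi>\<close> by the factor \<open>\<eta>\<close>, so the angle between the eigenspaces for \<open>1\<close>
  and \<open>\<eta>\<close> of the adjoint equals that for \<open>\<eta>\<close> and \<open>\<eta>\<^sup>2\<close>, which forces \<open>p = 0\<close>.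
\<close>

section \<open>The Hilbert space of square-summable sequences\<close>

text \<open>Nothing is known about a conjugation beyond its axioms, so necessity can use only what
  every conjugation preserves. At an attracting fixed point the relevant eigenspaces of
  \<open>C\<^sub>\<phi>\<close> are lines; the unknown scalars cancel from normalized inner
  products, and each pair of exponents yields one real equation. The pair (0, 1) alone gives |1 - t
  p|^2 = 1 - |t|^2, which t = 2 p / (1 + p^2) satisfies for every p in (0, 1); the pair (0, 2) is
  what excludes such t. An elliptic automorphism of finite order has infinite-dimensional
  eigenspaces, so the images under \<open>C\<close> are not determined up to scalars. There only the
  sets of exponents in the expansions are available, and the contradiction comes from an inequality
  instead of an equation. For the multiplier -1 these sets overlap, in accordance with case
  (iii).\<close>

typedef ell2 = "{a :: nat \<Rightarrow> complex. summable (\<lambda>n. (cmod (a n))\<^sup>2)}"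
  morphisms coef Abs_ell2
  by (rule exI[of _ "\<lambda>_. 0"]) simp

lemma coef_Abs: "summable (\<lambda>n. (cmod (a n))\<^sup>2) \<Longrightarrow> coef (Abs_ell2 a) = a"
  by (simp add: Abs_ell2_inverse)

lemma summable_coef_sq: "summable (\<lambda>n. (cmod (coef f n))\<^sup>2)"
  using coef[of f] by simp

lemma ell2_eqI: "(\<And>n. coef f n = coef g n) \<Longrightarrow> f = g"
  using coef_inject by blast

lemma summable_coef_mult:
  assumes "summable (\<lambda>n. (cmod (a n))\<^sup>2)" "summable (\<lambda>n. (cmod (b n))\<^sup>2)"
  shows "summable (\<lambda>n. a n * cnj (b n) :: complex)"
proof (rule summable_norm_cancel, rule summable_comparison_test'[OF summable_add[OF assms]])
  fix n
  have "2 * (cmod (a n) * cmod (b n)) \<le> (cmod (a n))\<^sup>2 + (cmod (b n))\<^sup>2"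
    using sum_squares_bound[of "cmod (a n)" "cmod (b n)"] by simp
  moreover have "0 \<le> cmod (a n) * cmod (b n)" by simp
  ultimately show "norm (norm (a n * cnj (b n))) \<le> (cmod (a n))\<^sup>2 + (cmod (b n))\<^sup>2"
    unfolding real_norm_def abs_norm_cancel norm_mult complex_mod_cnj by linarith
qed

lemma summable_sq_add:
  assumes "summable (\<lambda>n. (cmod (a n))\<^sup>2)" "summable (\<lambda>n. (cmod (b n))\<^sup>2)"
  shows "summable (\<lambda>n. (cmod (a n + b n))\<^sup>2)"
proof (rule summable_comparison_test'[OF summable_mult[OF summable_add[OF assms], of 2]])
  fix n
  have "(cmod (a n + b n))\<^sup>2 \<le> (cmod (a n) + cmod (b n))\<^sup>2"
    by (intro power_mono norm_triangle_ineq) auto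
  also have "\<dots> \<le> 2 * ((cmod (a n))\<^sup>2 + (cmod (b n))\<^sup>2)"
    using sum_squares_bound[of "cmod (a n)" "cmod (b n)"] by (simp add: power2_sum)
  finally show "norm ((cmod (a n + b n))\<^sup>2) \<le> 2 * ((cmod (a n))\<^sup>2 + (cmod (b n))\<^sup>2)"
    by simp
qed

lemma summable_sq_mult:
  assumes "summable (\<lambda>n. (cmod (a n))\<^sup>2)"
  shows "summable (\<lambda>n. (cmod (c * a n))\<^sup>2)"
  using summable_mult[OF assms, of "(cmod c)\<^sup>2"] by (simp add: norm_mult power_mult_distrib)

definition scaleC :: "complex \<Rightarrow> ell2 \<Rightarrow> ell2" (infixr \<open>*\<^sub>C\<close> 75) where
  "c *\<^sub>C f = Abs_ell2 (\<lambda>n. c * coef f n)"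

definition cinner :: "ell2 \<Rightarrow> ell2 \<Rightarrow> complex" where
  "cinner f g = (\<Sum>n. coef f n * cnj (coef g n))"

lemma coef_scaleC [simp]: "coef (c *\<^sub>C f) n = c * coef f n"
  by (simp add: scaleC_def coef_Abs summable_sq_mult summable_coef_sq)

instantiation ell2 :: real_vector
begin

definition zero_ell2 :: ell2 where "zero_ell2 = Abs_ell2 (\<lambda>_. 0)"
definition plus_ell2 :: "ell2 \<Rightarrow> ell2 \<Rightarrow> ell2"
  where "plus_ell2 f g = Abs_ell2 (\<lambda>n. coef f n + coef g n)"
definition uminus_ell2 :: "ell2 \<Rightarrow> ell2" where "uminus_ell2 f = (- 1) *\<^sub>C f"
definition minus_ell2 :: "ell2 \<Rightarrow> ell2 \<Rightarrow> ell2" where "minus_ell2 f g = f + (- 1) *\<^sub>C g"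
definition scaleR_ell2 :: "real \<Rightarrow> ell2 \<Rightarrow> ell2"
  where "scaleR_ell2 r f = complex_of_real r *\<^sub>C f"

lemma coef_zero_aux: "coef 0 n = 0"
  by (simp add: zero_ell2_def coef_Abs)

lemma coef_add_aux: "coef (f + g) n = coef f n + coef g n"
  by (simp add: plus_ell2_def coef_Abs summable_sq_add summable_coef_sq)

instance
  by standard (auto intro!: ell2_eqI simp: uminus_ell2_def minus_ell2_def scaleR_ell2_def
      coef_zero_aux coef_add_aux algebra_simps)

end

lemma coef_zero [simp]: "coef 0 n = 0"
  by (rule coef_zero_aux)

lemma coef_add [simp]: "coef (f + g) n = coef f n + coef g n"
  by (rule coef_add_aux)

text \<open>Only the real part of \<open>cinner\<close> enters the type class. This suffices for
  Cauchy-Schwarz, bounded linear maps and Banach's fixed point theorem on \<open>ell2\<close>;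
  complex linearity is carried separately by \<open>scaleC\<close> and
  \<open>bounded_clinear\<close>.\<close>

instantiation ell2 :: real_inner
begin

definition inner_ell2 :: "ell2 \<Rightarrow> ell2 \<Rightarrow> real" where "inner_ell2 f g = Re (cinner f g)"
definition norm_ell2 :: "ell2 \<Rightarrow> real" where "norm_ell2 f = sqrt (Re (cinner f f))"
definition dist_ell2 :: "ell2 \<Rightarrow> ell2 \<Rightarrow> real" where "dist_ell2 f g = norm (f - g)"
definition sgn_ell2 :: "ell2 \<Rightarrow> ell2" where "sgn_ell2 f = f /\<^sub>R norm f"
definition uniformity_ell2 :: "(ell2 \<times> ell2) filter"
  where "uniformity_ell2 = (INF e\<in>{0<..}. principal {(x, y). dist x y < e})"
definition open_ell2 :: "ell2 set \<Rightarrow> bool"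
  where "open_ell2 U \<longleftrightarrow> (\<forall>x\<in>U. \<forall>\<^sub>F (x', y) in uniformity. x' = x \<longrightarrow> y \<in> U)"

instance
proof
  fix f g h :: ell2 and r s :: real
  have sm: "summable (\<lambda>n. coef x n * cnj (coef y n))" for x y
    by (intro summable_coef_mult summable_coef_sq)
  show "dist f g = norm (f - g)" "sgn f = f /\<^sub>R norm f"
    "uniformity = (INF e\<in>{0<..}. principal {(x, y). dist x (y::ell2) < e})"
    "open U \<longleftrightarrow> (\<forall>x\<in>U. \<forall>\<^sub>F (x', y) in uniformity. x' = x \<longrightarrow> y \<in> U)" for U :: "ell2 set"
    by (rule dist_ell2_def sgn_ell2_def uniformity_ell2_def open_ell2_def)+
  have "cinner g f = cnj (cinner f g)"
    unfolding cinner_def by (subst bounded_linear.suminf[OF bounded_linear_cnj sm])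
      (simp add: mult.commute)
  then show "inner f g = inner g f" by (simp add: inner_ell2_def)
  have "cinner (f + g) h = cinner f h + cinner g h"
    unfolding cinner_def by (subst suminf_add[OF sm sm]) (simp add: algebra_simps)
  then show "inner (f + g) h = inner f h + inner g h" by (simp add: inner_ell2_def)
  have "cinner (r *\<^sub>R f) g = r * cinner f g"
    unfolding cinner_def by (subst suminf_mult[OF sm, symmetric])
      (simp add: algebra_simps scaleR_ell2_def)
  then show "inner (r *\<^sub>R f) g = r * inner f g" by (simp add: inner_ell2_def)
  have *: "inner f f = (\<Sum>n. (cmod (coef f n))\<^sup>2)"
    unfolding inner_ell2_def cinner_def
    by (subst bounded_linear.suminf[OF bounded_linear_Re sm])
      (simp add: complex_norm_square[symmetric] del: of_real_power)
  show "0 \<le> inner f f"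
    unfolding * by (intro suminf_nonneg summable_coef_sq) auto
  show "inner f f = 0 \<longleftrightarrow> f = 0"
    unfolding * by (subst suminf_eq_zero_iff[OF summable_coef_sq])
      (auto intro: ell2_eqI)
  show "norm f = sqrt (inner f f)" by (simp add: norm_ell2_def inner_ell2_def)
qed

end

lemma coef_uminus [simp]: "coef (- f) n = - coef f n"
  by (simp add: uminus_ell2_def)

lemma coef_minus [simp]: "coef (f - g) n = coef f n - coef g n"
  by (simp add: minus_ell2_def)

lemma scaleR_scaleC: "r *\<^sub>R f = complex_of_real r *\<^sub>C f"
  by (rule scaleR_ell2_def)

lemma coef_scaleR [simp]: "coef (r *\<^sub>R f) n = complex_of_real r * coef f n"
  by (simp add: scaleR_ell2_def)

lemma coef_sum [simp]: "coef (sum f A) n = (\<Sum>i\<in>A. coef (f i) n)"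
  by (induction A rule: infinite_finite_induct) auto

lemma summable_cinner: "summable (\<lambda>n. coef x n * cnj (coef y n))"
  by (intro summable_coef_mult summable_coef_sq)

lemma cinner_commute: "cinner g f = cnj (cinner f g)"
  unfolding cinner_def by (subst bounded_linear.suminf[OF bounded_linear_cnj summable_cinner])
    (simp add: mult.commute)

lemma cinner_add_left: "cinner (f + g) h = cinner f h + cinner g h"
  unfolding cinner_def by (subst suminf_add[OF summable_cinner summable_cinner])
    (simp add: algebra_simps)

lemma cinner_scaleC_left [simp]: "cinner (c *\<^sub>C f) g = c * cinner f g"
  unfolding cinner_def by (subst suminf_mult[OF summable_cinner, symmetric])
    (simp add: algebra_simps)

lemma cinner_add_right: "cinner f (g + h) = cinner f g + cinner f h"
  by (metis cinner_add_left cinner_commute complex_cnj_add)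

lemma cinner_scaleC_right [simp]: "cinner f (c *\<^sub>C g) = cnj c * cinner f g"
  by (metis cinner_scaleC_left cinner_commute complex_cnj_mult)

lemma cinner_minus_left: "cinner (f - g) h = cinner f h - cinner g h"
  by (simp add: minus_ell2_def cinner_add_left)

lemma cinner_minus_right: "cinner h (f - g) = cinner h f - cinner h g"
  by (simp add: minus_ell2_def cinner_add_right)

lemma cinner_zero_left [simp]: "cinner 0 f = 0" and cinner_zero_right [simp]: "cinner f 0 = 0"
  by (simp_all add: cinner_def)

lemma inner_eq_Re_cinner: "inner f g = Re (cinner f g)"
  by (rule inner_ell2_def)

lemma norm_sq_eq_suminf: "(norm f)\<^sup>2 = (\<Sum>n. (cmod (coef f n))\<^sup>2)"
proof -
  have "(norm f)\<^sup>2 = Re (cinner f f)"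
    by (simp add: power2_norm_eq_inner inner_ell2_def)
  also have "\<dots> = (\<Sum>n. (cmod (coef f n))\<^sup>2)"
    unfolding cinner_def by (subst bounded_linear.suminf[OF bounded_linear_Re summable_cinner])
      (simp add: complex_norm_square[symmetric] del: of_real_power)
  finally show ?thesis .
qed

lemma cinner_self: "cinner f f = complex_of_real ((norm f)\<^sup>2)"
proof (rule complex_eqI)
  have "Im (cinner f f) = - Im (cinner f f)"
    using arg_cong[OF cinner_commute[of f f], of Im] by simp
  then show "Im (cinner f f) = Im (complex_of_real ((norm f)\<^sup>2))" by simp
  show "Re (cinner f f) = Re (complex_of_real ((norm f)\<^sup>2))"
    by (simp add: power2_norm_eq_inner inner_ell2_def)
qed

lemma norm_scaleC [simp]: "norm (c *\<^sub>C f) = cmod c * norm f"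
proof -
  have "cinner (c *\<^sub>C f) (c *\<^sub>C f) = (c * cnj c) * cinner f f" by simp
  also have "\<dots> = complex_of_real ((cmod c * norm f)\<^sup>2)"
    unfolding cinner_self complex_norm_square[symmetric] by (simp add: power_mult_distrib)
  finally have "(norm (c *\<^sub>C f))\<^sup>2 = (cmod c * norm f)\<^sup>2"
    unfolding cinner_self of_real_eq_iff .
  then show ?thesis by (simp add: power2_eq_iff_nonneg)
qed

lemma cmod_cinner_le: "cmod (cinner f g) \<le> norm f * norm g"
proof (cases "cinner f g = 0")
  case False
  \<comment> \<open>Rotating \<open>f\<close> by this unimodular factor makes the inner product real
    and nonnegative, so that the real Cauchy-Schwarz inequality applies.\<close>
  define u where "u = cnj (cinner f g) / cmod (cinner f g)"
  have u: "cmod u = 1" using False by (simp add: u_def norm_divide)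
  have "cinner (u *\<^sub>C f) g = (cinner f g * cnj (cinner f g)) / cmod (cinner f g)"
    by (simp add: u_def)
  also have "\<dots> = cmod (cinner f g)"
    using False unfolding complex_norm_square[symmetric] by (simp add: power2_eq_square)
  finally have "cmod (cinner f g) = inner (u *\<^sub>C f) g" by (simp add: inner_ell2_def)
  also have "\<dots> \<le> norm (u *\<^sub>C f) * norm g" by (rule norm_cauchy_schwarz)
  finally show ?thesis using u by simp
qed simp

lemma cmod_coef_le: "cmod (coef f n) \<le> norm f"
proof -
  have "(cmod (coef f n))\<^sup>2 = (\<Sum>i\<in>{n}. (cmod (coef f i))\<^sup>2)" by simp
  also have "\<dots> \<le> (norm f)\<^sup>2"
    unfolding norm_sq_eq_suminf by (rule sum_le_suminf[OF summable_coef_sq]) auto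
  finally show ?thesis by (rule power2_le_imp_le) simp
qed

text \<open>Coordinates are bounded by the norm, so they converge; the estimate for finitely many
  coordinates survives the limit and then gives convergence in norm.\<close>

instance ell2 :: complete_space
proof
  fix X :: "nat \<Rightarrow> ell2"
  assume X: "Cauchy X"
  have "Cauchy (\<lambda>m. coef (X m) i)" for i
    unfolding Cauchy_def
  proof (intro allI impI)
    fix e :: real assume "e > 0"
    then obtain M where M: "\<forall>m\<ge>M. \<forall>n\<ge>M. dist (X m) (X n) < e"
      using X unfolding Cauchy_def by blast
    have "dist (coef (X m) i) (coef (X n) i) < e" if "m \<ge> M" "n \<ge> M" for m n
      using cmod_coef_le[of "X m - X n" i] M that by (fastforce simp: dist_norm)
    then show "\<exists>M. \<forall>m\<ge>M. \<forall>n\<ge>M. dist (coef (X m) i) (coef (X n) i) < e" by blast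
  qed
  then obtain a where a: "\<And>i. (\<lambda>m. coef (X m) i) \<longlonglongrightarrow> a i"
    unfolding Cauchy_convergent_iff convergent_def by metis
  have part: "(\<Sum>i<K. (cmod (coef (X m) i - a i))\<^sup>2) \<le> e\<^sup>2"
    if N: "\<forall>m\<ge>N. \<forall>n\<ge>N. norm (X m - X n) < e" and m: "m \<ge> N" for N e m K
  proof (rule LIMSEQ_le_const2)
    show "(\<lambda>n. \<Sum>i<K. (cmod (coef (X m) i - coef (X n) i))\<^sup>2) \<longlonglongrightarrow>
        (\<Sum>i<K. (cmod (coef (X m) i - a i))\<^sup>2)"
      by (intro tendsto_intros a)
    have "(\<Sum>i<K. (cmod (coef (X m) i - coef (X n) i))\<^sup>2) \<le> e\<^sup>2" if "n \<ge> N" for n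
    proof -
      have "(\<Sum>i<K. (cmod (coef (X m - X n) i))\<^sup>2) \<le> (norm (X m - X n))\<^sup>2"
        unfolding norm_sq_eq_suminf by (rule sum_le_suminf[OF summable_coef_sq]) auto
      also have "\<dots> \<le> e\<^sup>2" using N m that by (intro power_mono) (auto intro: less_imp_le)
      finally show ?thesis by simp
    qed
    then show "\<exists>N. \<forall>n\<ge>N. (\<Sum>i<K. (cmod (coef (X m) i - coef (X n) i))\<^sup>2) \<le> e\<^sup>2" by blast
  qed
  have summ: "summable (\<lambda>i. (cmod (coef (X m) i - a i))\<^sup>2) \<and>
      (\<Sum>i. (cmod (coef (X m) i - a i))\<^sup>2) \<le> e\<^sup>2"
    if N: "\<forall>m\<ge>N. \<forall>n\<ge>N. norm (X m - X n) < e" and m: "m \<ge> N" for N e m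
  proof -
    have sm: "summable (\<lambda>i. (cmod (coef (X m) i - a i))\<^sup>2)"
    proof (rule bounded_imp_summable)
      show "(\<Sum>i\<le>n. (cmod (coef (X m) i - a i))\<^sup>2) \<le> e\<^sup>2" for n
        unfolding lessThan_Suc_atMost[symmetric] by (rule part[OF that])
    qed simp
    show ?thesis by (intro conjI sm suminf_le_const part[OF that])
  qed
  have N_ex: "\<exists>N. \<forall>m\<ge>N. \<forall>n\<ge>N. norm (X m - X n) < e" if "e > 0" for e
    using X that unfolding Cauchy_def dist_norm by blast
  obtain N where "\<forall>m\<ge>N. \<forall>n\<ge>N. norm (X m - X n) < 1" using N_ex[of 1] by auto
  then have "summable (\<lambda>i. (cmod (coef (X N) i - a i))\<^sup>2)" using summ by blast
  from summable_sq_add[OF summable_coef_sq[of "X N"] summable_sq_mult[OF this, of "-1"]]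
  have sa: "summable (\<lambda>i. (cmod (a i))\<^sup>2)" by (simp add: algebra_simps)
  have "X \<longlonglongrightarrow> Abs_ell2 a"
  proof (rule LIMSEQ_I)
    fix r :: real assume "r > 0"
    then obtain N where N: "\<forall>m\<ge>N. \<forall>n\<ge>N. norm (X m - X n) < r/2" using N_ex[of "r/2"] by auto
    have "norm (X m - Abs_ell2 a) < r" if "m \<ge> N" for m
    proof -
      have "(norm (X m - Abs_ell2 a))\<^sup>2 \<le> (r/2)\<^sup>2"
        using summ[OF N that] unfolding norm_sq_eq_suminf by (simp add: coef_Abs sa)
      then have "norm (X m - Abs_ell2 a) \<le> r/2"
        by (rule power2_le_imp_le) (use \<open>r > 0\<close> in simp)
      then show ?thesis using \<open>r > 0\<close> by linarith
    qed
    then show "\<exists>N. \<forall>m\<ge>N. norm (X m - Abs_ell2 a) < r" by blast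
  qed
  then show "convergent X" by (auto simp: convergent_def)
qed

instance ell2 :: banach ..

subsection \<open>Bounded operators on \<open>ell2\<close>\<close>

lemma scaleC_add_right: "c *\<^sub>C (f + g) = c *\<^sub>C f + c *\<^sub>C g"
  and scaleC_add_left: "(c + d) *\<^sub>C f = c *\<^sub>C f + d *\<^sub>C f"
  and scaleC_scaleC [simp]: "c *\<^sub>C d *\<^sub>C f = (c * d) *\<^sub>C f"
  and scaleC_one [simp]: "1 *\<^sub>C f = f"
  and scaleC_zero_left [simp]: "0 *\<^sub>C f = 0"
  and scaleC_zero_right [simp]: "c *\<^sub>C 0 = 0"
  by (auto intro!: ell2_eqI simp: algebra_simps)

definition bounded_clinear :: "(ell2 \<Rightarrow> ell2) \<Rightarrow> bool" where
  "bounded_clinear T \<longleftrightarrow>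
     (\<forall>a f b g. T (a *\<^sub>C f + b *\<^sub>C g) = a *\<^sub>C T f + b *\<^sub>C T g) \<and>
     (\<exists>K. \<forall>f. norm (T f) \<le> K * norm f)"

lemma bounded_clinear_add: "bounded_clinear T \<Longrightarrow> T (f + g) = T f + T g"
  unfolding bounded_clinear_def by (metis scaleC_one)

lemma bounded_clinear_scaleC: "bounded_clinear T \<Longrightarrow> T (c *\<^sub>C f) = c *\<^sub>C T f"
  unfolding bounded_clinear_def by (metis add.right_neutral scaleC_zero_left)

lemma bounded_clinear_imp_bounded_linear:
  assumes "bounded_clinear T"
  shows "bounded_linear T"
proof -
  obtain K where "\<And>f. norm (T f) \<le> K * norm f"
    using assms unfolding bounded_clinear_def by blast
  then show ?thesis
    by (intro bounded_linear_intro[of T K])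
      (auto simp: assms bounded_clinear_add bounded_clinear_scaleC scaleR_scaleC mult.commute)
qed

lemma bounded_clinear_0: "bounded_clinear T \<Longrightarrow> T 0 = 0"
  by (metis bounded_clinear_imp_bounded_linear bounded_linear.axioms(1) linear_0)

lemma bounded_clinear_compose:
  assumes "bounded_clinear S" "bounded_clinear T"
  shows "bounded_clinear (\<lambda>f. S (T f))"
proof -
  obtain K L where "\<And>f. norm (S f) \<le> K * norm f" "\<And>f. norm (T f) \<le> L * norm f"
    using assms unfolding bounded_clinear_def by blast
  then have "norm (S (T f)) \<le> (\<bar>K\<bar> * \<bar>L\<bar>) * norm f" for f
    by (smt (verit) mult.assoc mult_left_mono mult_right_mono norm_ge_zero abs_ge_self abs_ge_zero)
  moreover have "S (T (a *\<^sub>C f + b *\<^sub>C g)) = a *\<^sub>C S (T f) + b *\<^sub>C S (T g)" for a f b g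
    using assms by (simp add: bounded_clinear_add bounded_clinear_scaleC)
  ultimately show ?thesis unfolding bounded_clinear_def by blast
qed

definition zpow :: "nat \<Rightarrow> ell2" where
  "zpow n = Abs_ell2 (\<lambda>k. if k = n then 1 else 0)"

lemma coef_zpow [simp]: "coef (zpow n) k = (if k = n then 1 else 0)"
proof -
  have "summable (\<lambda>k. (cmod (if k = n then 1 else 0))\<^sup>2)"
    by (rule summable_finite[of "{n}"]) auto
  then show ?thesis by (simp add: zpow_def coef_Abs)
qed

lemma cinner_zpow_right [simp]: "cinner f (zpow n) = coef f n"
proof -
  have "cinner f (zpow n) = (\<Sum>k\<in>{n}. coef f k * cnj (coef (zpow n) k))"
    unfolding cinner_def by (rule suminf_finite) auto
  then show ?thesis by simp
qed

lemma norm_zpow [simp]: "norm (zpow n) = 1"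
  using cinner_self[of "zpow n"] by (simp add: complex_eq_iff power2_eq_1_iff)
    (use norm_ge_zero[of "zpow n"] in linarith)

lemma norm_sq_sum_zpow: "(norm (\<Sum>n<N. c n *\<^sub>C zpow n))\<^sup>2 = (\<Sum>n<N. (cmod (c n))\<^sup>2)"
proof -
  have c: "coef (\<Sum>n<N. c n *\<^sub>C zpow n) k = (if k < N then c k else 0)" for k
    by (simp add: if_distrib[of "\<lambda>x. _ * x"] cong: if_cong)
  show ?thesis
    unfolding norm_sq_eq_suminf c
    by (subst suminf_finite[of "{..<N}"]) auto
qed

lemma tendsto_truncation: "(\<lambda>N. \<Sum>n<N. coef f n *\<^sub>C zpow n) \<longlonglongrightarrow> f"
proof -
  have "(norm (f - (\<Sum>n<N. coef f n *\<^sub>C zpow n)))\<^sup>2 = (norm f)\<^sup>2 - (\<Sum>n<N. (cmod (coef f n))\<^sup>2)" for N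
  proof -
    have c: "coef (f - (\<Sum>n<N. coef f n *\<^sub>C zpow n)) k = (if k < N then 0 else coef f k)" for k
      by (simp add: if_distrib[of "\<lambda>x. _ * x"] cong: if_cong)
    have "(\<Sum>k. (cmod (coef f k))\<^sup>2) =
        (\<Sum>k. (cmod (coef f (k + N)))\<^sup>2) + (\<Sum>n<N. (cmod (coef f n))\<^sup>2)"
      by (rule suminf_split_initial_segment[OF summable_coef_sq])
    moreover have "(\<Sum>k. (cmod (if k < N then 0 else coef f k))\<^sup>2) = (\<Sum>k. (cmod (coef f (k + N)))\<^sup>2)"
      using suminf_split_initial_segment[OF summable_coef_sq, of "f - (\<Sum>n<N. coef f n *\<^sub>C zpow n)" N]
      unfolding c by simp
    ultimately show ?thesis unfolding norm_sq_eq_suminf c by simp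
  qed
  moreover have "(\<lambda>N. (norm f)\<^sup>2 - (\<Sum>n<N. (cmod (coef f n))\<^sup>2)) \<longlonglongrightarrow> (norm f)\<^sup>2 - (norm f)\<^sup>2"
    using summable_LIMSEQ[OF summable_coef_sq[of f]] unfolding norm_sq_eq_suminf
    by (intro tendsto_intros)
  ultimately have "(\<lambda>N. sqrt ((norm (f - (\<Sum>n<N. coef f n *\<^sub>C zpow n)))\<^sup>2)) \<longlonglongrightarrow> sqrt 0"
    by (intro tendsto_real_sqrt) simp
  then have "(\<lambda>N. norm (f - (\<Sum>n<N. coef f n *\<^sub>C zpow n))) \<longlonglongrightarrow> 0" by simp
  then have "(\<lambda>N. f - (\<Sum>n<N. coef f n *\<^sub>C zpow n)) \<longlonglongrightarrow> 0" by (rule tendsto_norm_zero_cancel)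
  from tendsto_diff[OF tendsto_const[of f] this] show ?thesis by simp
qed

lemma bounded_linear_cinner_left: "bounded_linear (\<lambda>f. cinner f g)"
  by (rule bounded_linear_intro[of _ "norm g"])
    (auto simp: cinner_add_left scaleR_scaleC scaleR_conv_of_real cmod_cinner_le)

lemmas tendsto_cinner_left = bounded_linear.tendsto[OF bounded_linear_cinner_left]

lemma cinner_sum_left: "cinner (sum f A) g = (\<Sum>i\<in>A. cinner (f i) g)"
  by (induction A rule: infinite_finite_induct) (auto simp: cinner_add_left)

lemma cinner_ext: "(\<And>h. cinner h f = cinner h g) \<Longrightarrow> f = g"
proof -
  assume "\<And>h. cinner h f = cinner h g"
  then have "cinner (f - g) (f - g) = 0" by (simp add: cinner_minus_right)
  then show "f = g" by (simp add: cinner_self)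
qed

text \<open>The coefficients of the representing vector are forced to be
  \<open>cnj (L (zpow n))\<close>. They are square-summable because testing \<open>L\<close> on the
  truncations \<open>s\<close> of this very sequence gives
  \<open>(norm s)\<^sup>2 \<le> K * norm s\<close>.\<close>

lemma riesz_representation:
  fixes L :: "ell2 \<Rightarrow> complex"
  assumes add: "\<And>f g. L (f + g) = L f + L g" and homog: "\<And>c f. L (c *\<^sub>C f) = c * L f"
    and bd: "\<And>f. cmod (L f) \<le> K * norm f"
  shows "\<exists>g. \<forall>f. L f = cinner f g"
proof -
  interpret bounded_linear L
    by (rule bounded_linear_intro[of L K])
      (auto simp: add scaleR_scaleC homog scaleR_conv_of_real bd mult.commute[of _ K])
  have Lsum: "L (\<Sum>n<N. c n *\<^sub>C zpow n) = (\<Sum>n<N. c n * L (zpow n))" for c N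
    by (subst sum) (simp add: homog)
  have K: "K \<ge> 0" using order_trans[OF norm_ge_zero bd[of "zpow 0"]] by simp
  have part: "(\<Sum>n<N. (cmod (L (zpow n)))\<^sup>2) \<le> K\<^sup>2" for N
  proof -
    define s where "s = (\<Sum>n<N. cnj (L (zpow n)) *\<^sub>C zpow n)"
    have ns: "(norm s)\<^sup>2 = (\<Sum>n<N. (cmod (L (zpow n)))\<^sup>2)"
      unfolding s_def norm_sq_sum_zpow by simp
    have "L s = (\<Sum>n<N. complex_of_real ((cmod (L (zpow n)))\<^sup>2))"
      unfolding s_def Lsum complex_norm_square by (simp add: mult.commute)
    then have "L s = complex_of_real ((norm s)\<^sup>2)" unfolding ns by simp
    then have "(norm s)\<^sup>2 \<le> K * norm s"
      using bd[of s] by (simp add: norm_power)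
    then have "norm s \<le> K"
      using K by (cases "norm s = 0") (auto simp: power2_eq_square)
    then show ?thesis unfolding ns[symmetric] by (intro power_mono) auto
  qed
  have summ: "summable (\<lambda>n. (cmod (cnj (L (zpow n))))\<^sup>2)"
  proof (rule bounded_imp_summable)
    show "(\<Sum>n\<le>N. (cmod (cnj (L (zpow n))))\<^sup>2) \<le> K\<^sup>2" for N
      using part[of "Suc N"] by (simp add: lessThan_Suc_atMost)
  qed simp
  define g where "g = Abs_ell2 (\<lambda>n. cnj (L (zpow n)))"
  have cg: "coef g n = cnj (L (zpow n))" for n unfolding g_def coef_Abs[OF summ] ..
  have "L f = cinner f g" for f
  proof -
    have "L (\<Sum>n<N. coef f n *\<^sub>C zpow n) = cinner (\<Sum>n<N. coef f n *\<^sub>C zpow n) g" for N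
      unfolding Lsum by (simp add: cinner_sum_left cinner_commute[of "zpow _"] cg)
    moreover have "(\<lambda>N. L (\<Sum>n<N. coef f n *\<^sub>C zpow n)) \<longlonglongrightarrow> L f"
      by (intro tendsto tendsto_truncation)
    moreover have "(\<lambda>N. cinner (\<Sum>n<N. coef f n *\<^sub>C zpow n) g) \<longlonglongrightarrow> cinner f g"
      by (intro tendsto_cinner_left tendsto_truncation)
    ultimately show ?thesis using LIMSEQ_unique by simp
  qed
  then show ?thesis by blast
qed

lemma adjoint_exists:
  assumes T: "bounded_clinear T"
  obtains Ts where "bounded_clinear Ts" "\<And>f g. cinner (T f) g = cinner f (Ts g)"
proof -
  obtain K where K: "\<And>f. norm (T f) \<le> K * norm f"
    using T unfolding bounded_clinear_def by blast
  have "\<exists>h. \<forall>f. cinner (T f) g = cinner f h" for g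
  proof (rule riesz_representation[of _ "K * norm g"])
    fix f
    have "cmod (cinner (T f) g) \<le> norm (T f) * norm g" by (rule cmod_cinner_le)
    also have "\<dots> \<le> (K * norm f) * norm g" by (intro mult_right_mono K) auto
    finally show "cmod (cinner (T f) g) \<le> K * norm g * norm f" by (simp add: mult_ac)
  qed (auto simp: T bounded_clinear_add bounded_clinear_scaleC cinner_add_left)
  then obtain Ts where Ts: "\<And>f g. cinner (T f) g = cinner f (Ts g)" by metis
  have "Ts (a *\<^sub>C f + b *\<^sub>C g) = a *\<^sub>C Ts f + b *\<^sub>C Ts g" for a f b g
    by (rule cinner_ext) (simp add: Ts[symmetric] cinner_add_right)
  moreover have "norm (Ts g) \<le> K * norm g" for g
  proof -
    have "(norm (Ts g))\<^sup>2 = cmod (cinner (T (Ts g)) g)"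
      by (simp add: Ts cinner_self norm_power)
    also have "\<dots> \<le> norm (T (Ts g)) * norm g" by (rule cmod_cinner_le)
    also have "\<dots> \<le> K * norm (Ts g) * norm g" by (intro mult_right_mono K) auto
    finally have "norm (Ts g) * norm (Ts g) \<le> norm (Ts g) * (K * norm g)"
      by (simp add: power2_eq_square mult_ac)
    moreover have "0 \<le> K * norm g"
      using order_trans[OF norm_ge_zero K[of "zpow 0"]] by simp
    ultimately show ?thesis by (cases "norm (Ts g) = 0") auto
  qed
  ultimately show ?thesis using that Ts unfolding bounded_clinear_def by blast
qed

text \<open>Extension by continuity from polynomials: an operator is specified by the images
  \<open>u n\<close> of the monomials, and its bound need only be checked on finite sums. The
  truncations of \<open>f\<close> form a Cauchy sequence, hence so do their images.\<close>

lemma bounded_clinear_extension: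
  assumes bd: "\<And>N c. norm (\<Sum>n<N. c n *\<^sub>C u n) \<le> K * norm (\<Sum>n<N. c n *\<^sub>C zpow n)"
  obtains T where "bounded_clinear T" "\<And>f. norm (T f) \<le> K * norm f"
    "\<And>f. (\<lambda>N. \<Sum>n<N. coef f n *\<^sub>C u n) \<longlonglongrightarrow> T f"
proof -
  have K: "K \<ge> 0"
    using order_trans[OF norm_ge_zero bd[where N = "Suc 0" and c = "\<lambda>_. 1"]] by simp
  define s where "s v f N = (\<Sum>n<N. coef f n *\<^sub>C v n)" for v :: "nat \<Rightarrow> ell2" and f N
  have diff: "s v f N - s v f M = (\<Sum>n<N. (if n < M then 0 else coef f n) *\<^sub>C v n)"
    if "M \<le> N" for v f M N
  proof -
    have "s v f N = s v f M + (\<Sum>n\<in>{M..<N}. coef f n *\<^sub>C v n)"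
      using that unfolding s_def lessThan_atLeast0 by (simp add: sum.atLeastLessThan_concat)
    moreover have "(\<Sum>n<N. (if n < M then 0 else coef f n) *\<^sub>C v n) = (\<Sum>n\<in>{M..<N}. coef f n *\<^sub>C v n)"
      by (rule sum.mono_neutral_cong_right) auto
    ultimately show ?thesis by simp
  qed
  have le: "norm (s u f N - s u f M) \<le> K * norm (s zpow f N - s zpow f M)" for f N M
  proof (cases M N rule: le_cases)
    case le show ?thesis unfolding diff[OF le] by (rule bd)
  next
    case ge show ?thesis
      unfolding norm_minus_commute[of "s u f N"] norm_minus_commute[of "s zpow f N"] diff[OF ge]
      by (rule bd)
  qed
  have "Cauchy (s u f)" for f
  proof (rule metric_CauchyI)
    fix e :: real assume e: "e > 0"
    have "Cauchy (s zpow f)"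
      unfolding s_def by (rule LIMSEQ_imp_Cauchy[OF tendsto_truncation])
    then obtain M where M: "\<And>m n. m \<ge> M \<Longrightarrow> n \<ge> M \<Longrightarrow> dist (s zpow f m) (s zpow f n) < e / (K + 1)"
      using metric_CauchyD[of "s zpow f" "e / (K + 1)"] e K by auto
    have "dist (s u f m) (s u f n) < e" if "m \<ge> M" "n \<ge> M" for m n
    proof -
      have "dist (s u f m) (s u f n) \<le> K * dist (s zpow f m) (s zpow f n)"
        unfolding dist_norm by (rule le)
      also have "\<dots> \<le> K * (e / (K + 1))" using K M[OF that] by (intro mult_left_mono) auto
      also have "\<dots> < e" using K e by (simp add: field_simps)
      finally show ?thesis .
    qed
    then show "\<exists>M. \<forall>m\<ge>M. \<forall>n\<ge>M. dist (s u f m) (s u f n) < e" by blast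
  qed
  then obtain T where T: "\<And>f. s u f \<longlonglongrightarrow> T f"
    unfolding Cauchy_convergent_iff convergent_def by metis
  have nT: "norm (T f) \<le> K * norm f" for f
  proof (rule LIMSEQ_le)
    show "(\<lambda>N. norm (s u f N)) \<longlonglongrightarrow> norm (T f)" by (intro tendsto_norm T)
    show "(\<lambda>N. K * norm (s zpow f N)) \<longlonglongrightarrow> K * norm f"
      unfolding s_def by (intro tendsto_intros tendsto_truncation)
    show "\<exists>N. \<forall>n\<ge>N. norm (s u f n) \<le> K * norm (s zpow f n)"
      unfolding s_def using bd by blast
  qed
  have "T (a *\<^sub>C f + b *\<^sub>C g) = a *\<^sub>C T f + b *\<^sub>C T g" for a f b g
  proof (rule LIMSEQ_unique[OF T])
    have bl: "bounded_linear (\<lambda>f. c *\<^sub>C f)" for c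
      by (rule bounded_linear_intro[of _ "cmod c"])
        (auto simp: scaleC_add_right scaleR_scaleC mult.commute)
    have "s u (a *\<^sub>C f + b *\<^sub>C g) = (\<lambda>N. a *\<^sub>C s u f N + b *\<^sub>C s u g N)"
      by (auto simp: s_def linear_sum[OF bounded_linear.linear[OF bl]] scaleC_add_left
          simp flip: sum.distrib)
    then show "s u (a *\<^sub>C f + b *\<^sub>C g) \<longlonglongrightarrow> a *\<^sub>C T f + b *\<^sub>C T g"
      by (simp add: tendsto_add bounded_linear.tendsto[OF bl] T)
  qed
  then show ?thesis using that nT T unfolding bounded_clinear_def s_def by blast
qed

subsection \<open>Point evaluations and reproducing kernels\<close>

definition ev :: "ell2 \<Rightarrow> complex \<Rightarrow> complex" where
  "ev f z = (\<Sum>n. coef f n * z ^ n)"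

text \<open>For \<open>cmod w \<ge> 1\<close> the sequence is not square-summable and \<open>kern w\<close> is unspecified.\<close>

definition kern :: "complex \<Rightarrow> ell2" where
  "kern w = Abs_ell2 (\<lambda>n. cnj w ^ n)"

lemma coef_kern [simp]: "cmod w < 1 \<Longrightarrow> coef (kern w) n = cnj w ^ n"
proof -
  assume "cmod w < 1"
  then have "(cmod w)\<^sup>2 < 1" by (simp add: power_less_one_iff)
  then have "summable (\<lambda>n. ((cmod w)\<^sup>2) ^ n)" by (intro summable_geometric) simp
  then have "summable (\<lambda>n. (cmod (cnj w ^ n))\<^sup>2)"
    by (simp add: norm_power power_mult[symmetric] mult.commute)
  then show ?thesis unfolding kern_def by (subst coef_Abs) auto
qed

lemma cinner_kern: "cmod w < 1 \<Longrightarrow> cinner f (kern w) = ev f w"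
  by (simp add: cinner_def ev_def)

lemma cinner_kern_left: "cmod w < 1 \<Longrightarrow> cinner (kern w) f = cnj (ev f w)"
  by (subst cinner_commute) (simp add: cinner_kern)

lemma ev_sums: "cmod z < 1 \<Longrightarrow> (\<lambda>n. coef f n * z ^ n) sums ev f z"
  unfolding ev_def using summable_cinner[of f "kern z"] by (intro summable_sums) simp

lemma ev_add [simp]: "cmod z < 1 \<Longrightarrow> ev (f + g) z = ev f z + ev g z"
  by (simp add: cinner_kern[symmetric] cinner_add_left)

lemma ev_diff [simp]: "cmod z < 1 \<Longrightarrow> ev (f - g) z = ev f z - ev g z"
  by (simp add: cinner_kern[symmetric] cinner_minus_left)

lemma ev_scaleC [simp]: "cmod z < 1 \<Longrightarrow> ev (c *\<^sub>C f) z = c * ev f z"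
  by (simp add: cinner_kern[symmetric])

lemma ev_zero [simp]: "ev 0 z = 0"
  by (simp add: ev_def)

lemma ev_zpow [simp]: "ev (zpow n) z = z ^ n"
proof -
  have "ev (zpow n) z = (\<Sum>k\<in>{n}. coef (zpow n) k * z ^ k)"
    unfolding ev_def by (rule suminf_finite) auto
  then show ?thesis by simp
qed

lemma ev_at_0 [simp]: "ev f 0 = coef f 0"
  using powser_sums_zero_iff[of "coef f" "coef f 0"] by (simp add: ev_def sums_iff)

lemma norm_mult_less_1: "cmod w < 1 \<Longrightarrow> cmod z < 1 \<Longrightarrow> cmod (w * z) < 1"
  using mult_strict_mono'[of "cmod w" 1 "cmod z" 1] by (simp add: norm_mult)

lemma one_minus_mult_nonzero: "cmod w < 1 \<Longrightarrow> cmod z < 1 \<Longrightarrow> 1 - w * z \<noteq> 0"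
  using norm_mult_less_1[of w z] by auto

lemma one_minus_cnj_mult_nonzero: "cmod w < 1 \<Longrightarrow> cmod z < 1 \<Longrightarrow> 1 - cnj w * z \<noteq> 0"
  using one_minus_mult_nonzero[of "cnj w" z] by simp

lemma ev_kern: "cmod w < 1 \<Longrightarrow> cmod z < 1 \<Longrightarrow> ev (kern w) z = 1 / (1 - cnj w * z)"
  using norm_mult_less_1[of "cnj w" z]
  by (simp add: ev_def suminf_geometric power_mult_distrib[symmetric])

lemma ev_holomorphic: "ev f holomorphic_on ball 0 1"
  by (rule power_series_holomorphic[of _ _ "coef f"]) (use ev_sums[of _ f] in simp)

text \<open>A nonzero power series has isolated zeros, while the difference would vanish on the
  whole disk. Operators are identified throughout by comparing values at points.\<close>

lemma ev_eqI:
  assumes "\<And>z. cmod z < 1 \<Longrightarrow> ev f z = ev g z"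
  shows "f = g"
proof (rule ccontr)
  assume "f \<noteq> g"
  define h where "h = f - g"
  have h0: "ev h z = 0" if "cmod z < 1" for z
    using assms that by (simp add: h_def)
  obtain m where m: "coef h m \<noteq> 0"
    using \<open>f \<noteq> g\<close> ell2_eqI[of f g] by (auto simp: h_def)
  have "m \<noteq> 0" using h0[of 0] m by (intro notI) simp
  then obtain s where s: "0 < s" "\<And>z. z \<in> cball 0 s - {0} \<Longrightarrow> ev h z \<noteq> 0"
    using powser_0_nonzero[of 1 0 "coef h" "ev h" m] ev_sums[of _ h] m h0[of 0] by auto
  define z where "z = complex_of_real (min s (1/2))"
  have "z \<in> cball 0 s - {0}" "cmod z < 1" using s(1) by (auto simp: z_def)
  then show False using s(2) h0 by blast
qed

text \<open>Density of the span of the kernels in dual form: the vector that represents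
  \<open>L\<close> has the value zero at every point of the disk.\<close>

lemma kernel_density:
  fixes L :: "ell2 \<Rightarrow> complex"
  assumes "\<And>f g. L (f + g) = L f + L g" "\<And>c f. L (c *\<^sub>C f) = c * L f"
    "\<And>f. cmod (L f) \<le> K * norm f" and z: "\<And>w. cmod w < 1 \<Longrightarrow> L (kern w) = 0"
  shows "L f = 0"
proof -
  obtain g where g: "\<And>f. L f = cinner f g"
    using riesz_representation[of L K] assms by blast
  have "ev g w = 0" if "cmod w < 1" for w
    using z[OF that] unfolding g cinner_kern_left[OF that] by simp
  then have "g = 0" by (intro ev_eqI) auto
  then show ?thesis by (simp add: g)
qed

subsection \<open>The Hardy space as \<open>ell2\<close>\<close>

lemma has_integral_cis:
  fixes k :: int
  shows "((\<lambda>\<theta>. cis (of_int k * \<theta>)) has_integral (if k = 0 then 2 * pi else 0)) {0..2*pi}"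
proof (cases "k = 0")
  case True
  then show ?thesis
    using has_integral_const_real[of "1::complex" 0 "2*pi"] by (simp add: scaleR_conv_of_real)
next
  case False
  define F where "F \<theta> = cis (of_int k * \<theta>) / (\<i> * of_int k)" for \<theta> :: real
  have "((\<lambda>\<theta>. cis (of_int k * \<theta>)) has_integral (F (2*pi) - F 0)) {0..2*pi}"
  proof (rule fundamental_theorem_of_calculus)
    fix \<theta> :: real
    have "((\<lambda>\<theta>. exp (\<i> * of_real (of_int k * \<theta>)) / (\<i> * of_int k)) has_vector_derivative
        exp (\<i> * of_real (of_int k * \<theta>))) (at \<theta> within {0..2*pi})"
      using False
      by (auto intro!: derivative_eq_intros has_vector_derivative_real_field
          simp: field_simps)
    then show "(F has_vector_derivative cis (of_int k * \<theta>)) (at \<theta> within {0..2*pi})"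
      unfolding F_def cis_conv_exp .
  qed simp
  moreover have "F (2*pi) = F 0"
  proof -
    have "cis (of_int k * (2 * pi)) = cis (2 * pi) powi k"
      by (simp add: cis_power_int mult.commute)
    then show ?thesis by (simp add: F_def)
  qed
  ultimately show ?thesis using False by simp
qed

lemma integral_trig_polynomial_sq:
  fixes b :: "nat \<Rightarrow> complex"
  shows "((\<lambda>\<theta>. (cmod (\<Sum>n<N. b n * cis (n * \<theta>)))\<^sup>2) has_integral
    (2 * pi * (\<Sum>n<N. (cmod (b n))\<^sup>2))) {0..2*pi}"
proof -
  have "((\<lambda>\<theta>. \<Sum>n<N. \<Sum>m<N. (b n * cnj (b m)) * cis (of_int (int n - int m) * \<theta>)) has_integral
      (\<Sum>n<N. \<Sum>m<N. (b n * cnj (b m)) * (if int n - int m = 0 then 2 * pi else 0))) {0..2*pi}"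
    by (intro has_integral_sum has_integral_mult_right has_integral_cis) auto
  moreover have "(\<Sum>n<N. \<Sum>m<N. (b n * cnj (b m)) * cis (of_int (int n - int m) * \<theta>)) =
      complex_of_real ((cmod (\<Sum>n<N. b n * cis (n * \<theta>)))\<^sup>2)" for \<theta> :: real
  proof -
    have "complex_of_real ((cmod (\<Sum>n<N. b n * cis (n * \<theta>)))\<^sup>2) =
        (\<Sum>n<N. b n * cis (n * \<theta>)) * (\<Sum>m<N. cnj (b m * cis (m * \<theta>)))"
      unfolding complex_norm_square by (simp add: cnj_sum)
    also have "\<dots> = (\<Sum>n<N. \<Sum>m<N. (b n * cis (n * \<theta>)) * cnj (b m * cis (m * \<theta>)))"
      by (rule sum_product)
    also have "\<dots> = (\<Sum>n<N. \<Sum>m<N. (b n * cnj (b m)) * cis (of_int (int n - int m) * \<theta>))"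
      by (intro sum.cong refl) (simp add: cis_cnj cis_mult algebra_simps)
    finally show ?thesis by simp
  qed
  moreover have "(\<Sum>n<N. \<Sum>m<N. (b n * cnj (b m)) * (if int n - int m = 0 then 2 * pi else 0)) =
      complex_of_real (2 * pi * (\<Sum>n<N. (cmod (b n))\<^sup>2))"
    by (simp add: sum_distrib_left if_distrib[of "\<lambda>x. _ * complex_of_real x"] complex_norm_square[symmetric]
        mult_ac cong: if_cong del: of_real_power)
  ultimately have "((\<lambda>\<theta>. complex_of_real ((cmod (\<Sum>n<N. b n * cis (n * \<theta>)))\<^sup>2)) has_integral
      complex_of_real (2 * pi * (\<Sum>n<N. (cmod (b n))\<^sup>2))) {0..2*pi}" by simp
  from has_integral_linear[OF this bounded_linear_Re] show ?thesis by (simp add: o_def)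
qed

text \<open>Parseval on the circle of radius \<open>r\<close>. The partial sums are trigonometric
  polynomials, and absolute convergence supplies a constant majorant for the limit under the
  integral.\<close>

lemma hardy_mean_power_series:
  assumes f: "\<And>z. cmod z < 1 \<Longrightarrow> (\<lambda>n. a n * z ^ n) sums f z" and r: "0 < r" "r < 1"
  shows "(\<lambda>n. (cmod (a n))\<^sup>2 * r ^ (2 * n)) sums hardy_mean f r"
proof -
  define b where "b n = a n * complex_of_real r ^ n" for n
  define g where "g N \<theta> = (cmod (\<Sum>n<N. b n * cis (n * \<theta>)))\<^sup>2" for N :: nat and \<theta> :: real
  obtain R where R: "r < R" "R < 1" using r dense by blast
  have "summable (\<lambda>n. a n * complex_of_real R ^ n)"
    using f[of R] R r by (auto simp: sums_iff)
  then have "summable (\<lambda>n. norm (a n * complex_of_real r ^ n))"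
    by (rule powser_insidea) (use R r in auto)
  then have sb: "summable (\<lambda>n. cmod (b n))" by (simp add: b_def)
  have point: "(\<lambda>N. g N \<theta>) \<longlonglongrightarrow> (cmod (f (r * cis \<theta>)))\<^sup>2" for \<theta>
  proof -
    have "(\<lambda>n. a n * (r * cis \<theta>) ^ n) sums f (r * cis \<theta>)"
      using f[of "r * cis \<theta>"] r by (simp add: norm_mult)
    moreover have "a n * (r * cis \<theta>) ^ n = b n * cis (n * \<theta>)" for n
      unfolding b_def power_mult_distrib Complex.DeMoivre by (simp only: mult.assoc)
    ultimately have "(\<lambda>N. \<Sum>n<N. b n * cis (n * \<theta>)) \<longlonglongrightarrow> f (r * cis \<theta>)"
      unfolding sums_def by simp
    then show ?thesis unfolding g_def by (intro tendsto_intros)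
  qed
  have "(\<lambda>N. integral {0..2*pi} (g N)) \<longlonglongrightarrow> integral {0..2*pi} (\<lambda>\<theta>. (cmod (f (r * cis \<theta>)))\<^sup>2)"
  proof (rule dominated_convergence(2)[where h = "\<lambda>_. (\<Sum>n. cmod (b n))\<^sup>2"])
    show "g N integrable_on {0..2*pi}" for N
      unfolding g_def using integral_trig_polynomial_sq by blast
    show "norm (g N \<theta>) \<le> (\<Sum>n. cmod (b n))\<^sup>2" for N \<theta>
    proof -
      have "cmod (\<Sum>n<N. b n * cis (n * \<theta>)) \<le> (\<Sum>n<N. cmod (b n))"
        by (rule order_trans[OF norm_sum]) (simp add: norm_mult)
      also have "\<dots> \<le> (\<Sum>n. cmod (b n))" by (rule sum_le_suminf[OF sb]) auto
      finally show ?thesis unfolding g_def by (simp add: power_mono)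
    qed
  qed (use point in auto)
  moreover have "integral {0..2*pi} (g N) = 2 * pi * (\<Sum>n<N. (cmod (b n))\<^sup>2)" for N
    unfolding g_def using integral_trig_polynomial_sq by blast
  ultimately have "(\<lambda>N. 2 * pi * (\<Sum>n<N. (cmod (b n))\<^sup>2) / (2 * pi)) \<longlonglongrightarrow> hardy_mean f r"
    unfolding hardy_mean_def by (intro tendsto_divide) auto
  then show ?thesis
    using r by (simp add: sums_def b_def norm_mult norm_power power_mult_distrib power_mult[symmetric]
        mult.commute[of 2])
qed

text \<open>Letting \<open>r\<close> tend to \<open>1\<close> in finitely many terms at a time
  avoids interchanging this limit with the infinite sum.\<close>

lemma coefficients_bounded_by_hardy_mean:
  assumes f: "\<And>z. cmod z < 1 \<Longrightarrow> (\<lambda>n. a n * z ^ n) sums f z"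
    and B: "\<And>r. 0 < r \<Longrightarrow> r < 1 \<Longrightarrow> hardy_mean f r \<le> B"
  shows "summable (\<lambda>n. (cmod (a n))\<^sup>2)" "(\<Sum>n. (cmod (a n))\<^sup>2) \<le> B"
proof -
  have part: "(\<Sum>n<N. (cmod (a n))\<^sup>2) \<le> B" for N
  proof (rule tendsto_upperbound)
    show "((\<lambda>r. \<Sum>n<N. (cmod (a n))\<^sup>2 * r ^ (2 * n)) \<longlongrightarrow> (\<Sum>n<N. (cmod (a n))\<^sup>2)) (at_left 1)"
      by (auto intro!: tendsto_eq_intros)
    have "(\<Sum>n<N. (cmod (a n))\<^sup>2 * r ^ (2 * n)) \<le> B" if "0 < r" "r < 1" for r
    proof -
      have "(\<Sum>n<N. (cmod (a n))\<^sup>2 * r ^ (2 * n)) \<le> hardy_mean f r"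
        using hardy_mean_power_series[OF f that] unfolding sums_iff
        by (metis (no_types, lifting) sum_le_suminf finite_lessThan mult_nonneg_nonneg zero_le_even_power'
            zero_le_power2 power_mult)
      then show ?thesis using B[OF that] by simp
    qed
    then show "\<forall>\<^sub>F r in at_left 1. (\<Sum>n<N. (cmod (a n))\<^sup>2 * r ^ (2 * n)) \<le> B"
      using eventually_at_left_real[of 0 "1::real"] by (auto elim: eventually_mono)
  qed simp
  show s: "summable (\<lambda>n. (cmod (a n))\<^sup>2)"
  proof (rule bounded_imp_summable)
    show "(\<Sum>n\<le>N. (cmod (a n))\<^sup>2) \<le> B" for N
      using part[of "Suc N"] by (simp add: lessThan_Suc_atMost)
  qed simp
  show "(\<Sum>n. (cmod (a n))\<^sup>2) \<le> B" by (rule suminf_le_const[OF s part])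
qed

lemma hardy_mean_ev:
  assumes "0 < r" "r < 1"
  shows "(\<lambda>n. (cmod (coef f n))\<^sup>2 * r ^ (2 * n)) sums hardy_mean (ev f) r"
  using hardy_mean_power_series[OF ev_sums assms] .

lemma hardy_mean_ev_le:
  assumes "0 < r" "r < 1"
  shows "hardy_mean (ev f) r \<le> (norm f)\<^sup>2"
proof -
  have "(cmod (coef f n))\<^sup>2 * r ^ (2 * n) \<le> (cmod (coef f n))\<^sup>2" for n
    using assms by (simp add: mult_left_le power_le_one)
  then show ?thesis
    unfolding norm_sq_eq_suminf
    by (rule sums_le[OF _ hardy_mean_ev[OF assms] summable_sums[OF summable_coef_sq]])
qed

lemma hardy_mean_cong:
  assumes "\<And>z. cmod z < 1 \<Longrightarrow> f z = g z" "0 < r" "r < 1"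
  shows "hardy_mean f r = hardy_mean g r"
  unfolding hardy_mean_def using assms by (intro arg_cong[of _ _ "\<lambda>x. x / _"] integral_cong)
    (simp add: norm_mult)

lemma ell2_of_hardy_mean_bound:
  assumes hol: "h holomorphic_on ball 0 1" and B: "\<And>r. 0 < r \<Longrightarrow> r < 1 \<Longrightarrow> hardy_mean h r \<le> B"
  obtains f where "\<And>z. cmod z < 1 \<Longrightarrow> ev f z = h z" "(norm f)\<^sup>2 \<le> B"
proof -
  define a where "a n = (deriv ^^ n) h 0 / fact n" for n
  have a: "(\<lambda>n. a n * z ^ n) sums h z" if "cmod z < 1" for z
    using holomorphic_power_series[OF hol, of z] that by (simp add: a_def)
  have s: "summable (\<lambda>n. (cmod (a n))\<^sup>2)" and le: "(\<Sum>n. (cmod (a n))\<^sup>2) \<le> B"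
    using coefficients_bounded_by_hardy_mean[OF a B] by blast+
  show thesis
  proof
    show "ev (Abs_ell2 a) z = h z" if "cmod z < 1" for z
      using a[OF that] by (simp add: ev_def coef_Abs[OF s] sums_iff)
    show "(norm (Abs_ell2 a))\<^sup>2 \<le> B" using le by (simp add: norm_sq_eq_suminf coef_Abs[OF s])
  qed
qed

text \<open>The unitary identification of \<open>ell2\<close> with \<open>hardy_space\<close>; the
  value \<open>0\<close> off the disk matches the choice of representatives there.\<close>

definition hardy_fun :: "ell2 \<Rightarrow> complex \<Rightarrow> complex" where
  "hardy_fun f = (\<lambda>z. if z \<in> unit_disk then ev f z else 0)"

lemma hardy_fun_in_hardy_space: "hardy_fun f \<in> hardy_space"
proof -
  have "hardy_fun f holomorphic_on unit_disk"
    using ev_holomorphic[of f] by (rule holomorphic_transform) (simp add: hardy_fun_def)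
  moreover have "bdd_above (hardy_mean (hardy_fun f) ` {0<..<1})"
  proof (rule bdd_aboveI2)
    show "hardy_mean (hardy_fun f) r \<le> (norm f)\<^sup>2" if "r \<in> {0<..<1}" for r
    using hardy_mean_cong[of "hardy_fun f" "ev f" r] hardy_mean_ev_le[of r f] that
    by (simp add: hardy_fun_def)
  qed
  ultimately show ?thesis by (simp add: hardy_space_def) (simp add: hardy_fun_def)
qed

lemma hardy_norm_hardy_fun: "hardy_norm (hardy_fun f) = norm f"
proof -
  have eq: "hardy_mean (hardy_fun f) r = hardy_mean (ev f) r" if "r \<in> {0<..<1}" for r
    using hardy_mean_cong[of "hardy_fun f" "ev f" r] that by (simp add: hardy_fun_def)
  have bdd: "bdd_above (hardy_mean (ev f) ` {0<..<1})"
    by (rule bdd_aboveI2[of _ _ "(norm f)\<^sup>2"]) (auto intro: hardy_mean_ev_le)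
  have "(SUP r\<in>{0<..<1}. hardy_mean (hardy_fun f) r) = (SUP r\<in>{0<..<1}. hardy_mean (ev f) r)"
    by (intro SUP_cong eq) auto
  also have "\<dots> = (norm f)\<^sup>2"
  proof (rule antisym)
    show "(SUP r\<in>{0<..<1}. hardy_mean (ev f) r) \<le> (norm f)\<^sup>2"
      using hardy_mean_ev_le[of _ f] by (intro cSUP_least) auto
    have "hardy_mean (ev f) r \<le> (SUP r\<in>{0<..<1}. hardy_mean (ev f) r)" if "0 < r" "r < 1" for r
      using that by (intro cSUP_upper bdd) auto
    from coefficients_bounded_by_hardy_mean(2)[OF ev_sums this]
    show "(norm f)\<^sup>2 \<le> (SUP r\<in>{0<..<1}. hardy_mean (ev f) r)"
      by (simp add: norm_sq_eq_suminf)
  qed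
  finally show ?thesis by (simp add: hardy_norm_def)
qed

lemma hardy_fun_eq_iff [simp]: "hardy_fun f = hardy_fun g \<longleftrightarrow> f = g"
proof
  assume "hardy_fun f = hardy_fun g"
  then have "ev f z = ev g z" if "cmod z < 1" for z
    using that by (auto simp: hardy_fun_def dest!: fun_cong[of _ _ z])
  then show "f = g" by (rule ev_eqI)
qed simp

lemma hardy_fun_linear:
  "(\<lambda>z. a * hardy_fun f z + b * hardy_fun g z) = hardy_fun (a *\<^sub>C f + b *\<^sub>C g)"
  by (auto simp: hardy_fun_def)

lemma hardy_space_eq_range: "hardy_space = range hardy_fun"
proof
  show "hardy_space \<subseteq> range hardy_fun"
  proof
    fix h assume h: "h \<in> hardy_space"
    then obtain B where "\<And>r. 0 < r \<Longrightarrow> r < 1 \<Longrightarrow> hardy_mean h r \<le> B"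
      unfolding hardy_space_def bdd_above_def by fastforce
    with h obtain f where "\<And>z. cmod z < 1 \<Longrightarrow> ev f z = h z"
      using ell2_of_hardy_mean_bound[of h B] unfolding hardy_space_def by blast
    then have "h = hardy_fun f" using h by (auto simp: hardy_fun_def hardy_space_def)
    then show "h \<in> range hardy_fun" by blast
  qed
qed (use hardy_fun_in_hardy_space in blast)

lemma hardy_inner_hardy_fun: "hardy_inner (hardy_fun f) (hardy_fun g) = cinner f g"
proof -
  have "(hardy_norm (\<lambda>z. hardy_fun f z + \<i> ^ k * hardy_fun g z))\<^sup>2 = (norm (f + \<i> ^ k *\<^sub>C g))\<^sup>2" for k
    using hardy_fun_linear[of 1 f "\<i> ^ k" g] by (simp add: hardy_norm_hardy_fun)
  then have "hardy_inner (hardy_fun f) (hardy_fun g) =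
      (\<Sum>k<4. \<i> ^ k * cinner (f + \<i> ^ k *\<^sub>C g) (f + \<i> ^ k *\<^sub>C g)) / 4"
    unfolding hardy_inner_def cinner_self by simp
  also have "\<dots> = cinner f g"
    by (simp add: eval_nat_numeral cinner_add_left cinner_add_right algebra_simps)
  finally show ?thesis .
qed

subsection \<open>Multiplication operators\<close>

text \<open>The mean of the product over each circle is at most \<open>K\<^sup>2\<close> times that
  of \<open>ev f\<close>, which yields an element of \<open>ell2\<close>. Since values determine
  elements, the choice made for each \<open>f\<close> is automatically linear.\<close>

lemma multiplication_operator:
  assumes hol: "\<psi> holomorphic_on ball 0 1" and bd: "\<And>z. cmod z < 1 \<Longrightarrow> cmod (\<psi> z) \<le> K"
  obtains M where "bounded_clinear M" "\<And>f. norm (M f) \<le> K * norm f"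
    "\<And>f z. cmod z < 1 \<Longrightarrow> ev (M f) z = \<psi> z * ev f z"
proof -
  have K: "K \<ge> 0" using order_trans[OF norm_ge_zero bd[of 0]] by simp
  have "\<exists>g. (\<forall>z. cmod z < 1 \<longrightarrow> ev g z = \<psi> z * ev f z) \<and> norm g \<le> K * norm f" for f
  proof -
    have hol': "(\<lambda>z. \<psi> z * ev f z) holomorphic_on ball 0 1"
      by (intro holomorphic_on_mult hol ev_holomorphic)
    have int: "(\<lambda>\<theta>. (cmod (h (complex_of_real r * cis \<theta>)))\<^sup>2) integrable_on {0..2*pi}"
      if "h holomorphic_on ball 0 1" "0 < r" "r < 1" for h r
    proof (intro integrable_continuous_real continuous_intros)
      show "continuous_on {0..2*pi} (\<lambda>\<theta>. h (complex_of_real r * cis \<theta>))"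
        by (rule continuous_on_compose2[OF holomorphic_on_imp_continuous_on[OF that(1)]])
          (use that in \<open>auto intro!: continuous_intros simp: norm_mult\<close>)
    qed
    have "hardy_mean (\<lambda>z. \<psi> z * ev f z) r \<le> (K * norm f)\<^sup>2" if r: "0 < r" "r < 1" for r
    proof -
      have "integral {0..2*pi} (\<lambda>\<theta>. (cmod (\<psi> (r * cis \<theta>) * ev f (r * cis \<theta>)))\<^sup>2) \<le>
          integral {0..2*pi} (\<lambda>\<theta>. K\<^sup>2 * (cmod (ev f (r * cis \<theta>)))\<^sup>2)"
      proof (rule integral_le)
        show "(\<lambda>\<theta>. K\<^sup>2 * (cmod (ev f (r * cis \<theta>)))\<^sup>2) integrable_on {0..2*pi}"
          by (intro integrable_on_mult_right int ev_holomorphic r)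
        show "(cmod (\<psi> (r * cis \<theta>) * ev f (r * cis \<theta>)))\<^sup>2 \<le> K\<^sup>2 * (cmod (ev f (r * cis \<theta>)))\<^sup>2" for \<theta>
          unfolding norm_mult power_mult_distrib using r
          by (intro mult_right_mono power_mono bd) (auto simp: norm_mult)
      qed (use int[OF hol' r] in simp)
      then have "hardy_mean (\<lambda>z. \<psi> z * ev f z) r \<le> K\<^sup>2 * hardy_mean (ev f) r"
        unfolding hardy_mean_def by (simp add: divide_right_mono)
      also have "\<dots> \<le> K\<^sup>2 * (norm f)\<^sup>2" by (intro mult_left_mono hardy_mean_ev_le r) auto
      finally show ?thesis by (simp add: power_mult_distrib)
    qed
    from ell2_of_hardy_mean_bound[OF hol' this] obtain g where
      "\<And>z. cmod z < 1 \<Longrightarrow> ev g z = \<psi> z * ev f z" "(norm g)\<^sup>2 \<le> (K * norm f)\<^sup>2" by blast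
    then show ?thesis using K by (metis mult_nonneg_nonneg norm_ge_zero power2_le_imp_le)
  qed
  then obtain M where M: "\<And>f z. cmod z < 1 \<Longrightarrow> ev (M f) z = \<psi> z * ev f z"
    "\<And>f. norm (M f) \<le> K * norm f" by metis
  have "M (a *\<^sub>C f + b *\<^sub>C g) = a *\<^sub>C M f + b *\<^sub>C M g" for a f b g
    by (rule ev_eqI) (simp add: M algebra_simps)
  then show ?thesis using that M unfolding bounded_clinear_def by blast
qed

lemma bounded_holomorphic_in_hardy:
  assumes "\<psi> holomorphic_on ball 0 1" and "\<And>z. cmod z < 1 \<Longrightarrow> cmod (\<psi> z) \<le> K"
  obtains f where "\<And>z. cmod z < 1 \<Longrightarrow> ev f z = \<psi> z" "norm f \<le> K"
proof (rule multiplication_operator[OF assms])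
  fix M
  assume M: "\<And>f. norm (M f) \<le> K * norm f"
    "\<And>f z. cmod z < 1 \<Longrightarrow> ev (M f) z = \<psi> z * ev f z"
  show thesis using that[of "M (zpow 0)"] M(1)[of "zpow 0"] M(2)[of _ "zpow 0"] by simp
qed

subsection \<open>Conjugations and complex symmetry on \<open>ell2\<close>\<close>

definition conjugation :: "(ell2 \<Rightarrow> ell2) \<Rightarrow> bool" where
  "conjugation C \<longleftrightarrow>
     (\<forall>a f b g. C (a *\<^sub>C f + b *\<^sub>C g) = cnj a *\<^sub>C C f + cnj b *\<^sub>C C g) \<and>
     (\<forall>f g. cinner (C f) (C g) = cinner g f) \<and> (\<forall>f. C (C f) = f)"

lemma conjugation_add: "conjugation C \<Longrightarrow> C (f + g) = C f + C g"
  unfolding conjugation_def by (metis scaleC_one complex_cnj_one)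

lemma conjugation_scaleC: "conjugation C \<Longrightarrow> C (c *\<^sub>C f) = cnj c *\<^sub>C C f"
  unfolding conjugation_def by (metis add.right_neutral scaleC_zero_left complex_cnj_zero)

lemma conjugation_cinner: "conjugation C \<Longrightarrow> cinner (C f) (C g) = cinner g f"
  by (simp add: conjugation_def)

lemma conjugation_involution: "conjugation C \<Longrightarrow> C (C f) = f"
  by (simp add: conjugation_def)

lemma conjugation_cinner_swap: "conjugation C \<Longrightarrow> cinner (C f) g = cinner (C g) f"
  by (metis conjugation_cinner conjugation_involution)

lemma conjugation_norm: "conjugation C \<Longrightarrow> norm (C f) = norm f"
  using conjugation_cinner[of C f f] unfolding cinner_self of_real_eq_iff
  by (simp add: power2_eq_iff_nonneg)

text \<open>A relation instead of an operator: it covers both the operators constructed from a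
  symbol and those extracted from a complex symmetry hypothesis.\<close>

definition composes_with :: "(ell2 \<Rightarrow> ell2) \<Rightarrow> (complex \<Rightarrow> complex) \<Rightarrow> bool" where
  "composes_with T \<phi> \<longleftrightarrow> (\<forall>f z. cmod z < 1 \<longrightarrow> ev (T f) z = ev f (\<phi> z))"

lemma composes_withD: "composes_with T \<phi> \<Longrightarrow> cmod z < 1 \<Longrightarrow> ev (T f) z = ev f (\<phi> z)"
  by (simp add: composes_with_def)

lemma composition_operator_hardy_fun:
  assumes "composes_with T \<phi>" "\<And>z. cmod z < 1 \<Longrightarrow> cmod (\<phi> z) < 1"
  shows "composition_operator \<phi> (hardy_fun f) = hardy_fun (T f)"
  using assms by (auto simp: composition_operator_def hardy_fun_def composes_with_def)

text \<open>Symmetry of the form says precisely that \<open>C T C\<close> is adjoint to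
  \<open>T\<close>. The adjoint demanded by \<open>complex_symmetric_on\<close> is therefore written
  down from \<open>C\<close>, and the identity between the two becomes trivial.\<close>

lemma complex_symmetric_onI:
  assumes T: "bounded_clinear T" and \<phi>: "composes_with T \<phi>" "\<And>z. cmod z < 1 \<Longrightarrow> cmod (\<phi> z) < 1"
    and C: "conjugation C" and sym: "\<And>f h. cinner (T f) (C h) = cinner (T h) (C f)"
  shows "complex_symmetric_on hardy_space hardy_inner (composition_operator \<phi>)"
proof -
  note co = composition_operator_hardy_fun[OF \<phi>]
  define C' where "C' h = hardy_fun (C (inv hardy_fun h))" for h
  define Ts where "Ts h = hardy_fun (C (T (C (inv hardy_fun h))))" for h
  have "inj hardy_fun" by (rule injI) simp
  then have C': "C' (hardy_fun f) = hardy_fun (C f)" "Ts (hardy_fun f) = hardy_fun (C (T (C f)))" for f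
    by (simp_all add: C'_def Ts_def)
  obtain K where "\<And>f. norm (T f) \<le> K * norm f"
    using T unfolding bounded_clinear_def by blast
  then have "bounded_operator_on hardy_space hardy_inner (composition_operator \<phi>)"
    unfolding bounded_operator_on_def hardy_space_eq_range
    by (auto simp: hardy_fun_linear co hardy_inner_hardy_fun cinner_self bounded_clinear_add[OF T]
        bounded_clinear_scaleC[OF T] intro!: exI[of _ K])
  moreover have "conjugation_on hardy_space hardy_inner C'"
    unfolding conjugation_on_def hardy_space_eq_range
    by (auto simp: hardy_fun_linear C' hardy_inner_hardy_fun conjugation_cinner[OF C]
        conjugation_involution[OF C] conjugation_add[OF C] conjugation_scaleC[OF C])
  moreover have "cinner (T f) g = cinner f (C (T (C g)))" for f g
  proof -
    have "cinner (T f) g = cinner (T f) (C (C g))" by (simp add: conjugation_involution[OF C])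
    also have "\<dots> = cinner (C (C (T (C g)))) (C f)"
      by (simp add: sym conjugation_involution[OF C])
    finally show ?thesis by (simp add: conjugation_cinner[OF C])
  qed
  then have "adjoint_on hardy_space hardy_inner (composition_operator \<phi>) Ts"
    unfolding adjoint_on_def hardy_space_eq_range
    by (auto simp: C' co hardy_inner_hardy_fun)
  moreover have "\<forall>f\<in>hardy_space. composition_operator \<phi> f = C' (Ts (C' f))"
    unfolding hardy_space_eq_range by (auto simp: C' co conjugation_involution[OF C])
  ultimately show ?thesis unfolding complex_symmetric_on_def by blast
qed

lemma complex_symmetric_onE:
  assumes cs: "complex_symmetric_on hardy_space hardy_inner (composition_operator \<phi>)"
    and \<phi>: "\<And>z. cmod z < 1 \<Longrightarrow> cmod (\<phi> z) < 1"
  obtains T C Ts where "composes_with T \<phi>" "conjugation C"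
    "\<And>f g. cinner (T f) g = cinner f (Ts g)" "\<And>f. T f = C (Ts (C f))"
proof -
  obtain C' Ts' where C': "conjugation_on hardy_space hardy_inner C'"
    and Ts': "adjoint_on hardy_space hardy_inner (composition_operator \<phi>) Ts'"
    and eq: "\<And>f. f \<in> hardy_space \<Longrightarrow> composition_operator \<phi> f = C' (Ts' (C' f))"
    and bd: "bounded_operator_on hardy_space hardy_inner (composition_operator \<phi>)"
    using cs unfolding complex_symmetric_on_def by blast
  have inj: "inj hardy_fun" by (rule injI) simp
  define lift where "lift A f = inv hardy_fun (A (hardy_fun f))" for A :: "(complex \<Rightarrow> complex) \<Rightarrow> _" and f
  have lift: "hardy_fun (lift A f) = A (hardy_fun f)" if "\<And>f. f \<in> hardy_space \<Longrightarrow> A f \<in> hardy_space" for A f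
    unfolding lift_def using that[OF hardy_fun_in_hardy_space[of f]] by (simp add: hardy_space_eq_range f_inv_into_f)
  have lT: "hardy_fun (lift (composition_operator \<phi>) f) = composition_operator \<phi> (hardy_fun f)" for f
    by (rule lift) (use bd in \<open>simp add: bounded_operator_on_def\<close>)
  have lC: "hardy_fun (lift C' f) = C' (hardy_fun f)" for f
    by (rule lift) (use C' in \<open>simp add: conjugation_on_def\<close>)
  have lTs: "hardy_fun (lift Ts' f) = Ts' (hardy_fun f)" for f
    by (rule lift) (use Ts' in \<open>simp add: adjoint_on_def\<close>)
  have mem: "hardy_fun f \<in> hardy_space" for f by (rule hardy_fun_in_hardy_space)
  show thesis
  proof
    show "composes_with (lift (composition_operator \<phi>)) \<phi>"
      unfolding composes_with_def
    proof (intro allI impI)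
      fix f z assume z: "cmod z < 1"
      have "hardy_fun (lift (composition_operator \<phi>) f) z = composition_operator \<phi> (hardy_fun f) z"
        by (simp add: lT)
      then show "ev (lift (composition_operator \<phi>) f) z = ev f (\<phi> z)"
        using z \<phi>[OF z] by (simp add: hardy_fun_def composition_operator_def)
    qed
    have "lift C' (a *\<^sub>C f + b *\<^sub>C g) = cnj a *\<^sub>C lift C' f + cnj b *\<^sub>C lift C' g" for a f b g
      using C' mem unfolding hardy_fun_eq_iff[symmetric] lC hardy_fun_linear[symmetric] conjugation_on_def
      by blast
    moreover have "cinner (lift C' f) (lift C' g) = cinner g f" for f g
      using C' mem unfolding hardy_inner_hardy_fun[symmetric] lC conjugation_on_def by blast
    moreover have "lift C' (lift C' f) = f" for f
      using C' mem unfolding hardy_fun_eq_iff[symmetric] lC conjugation_on_def by blast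
    ultimately show "conjugation (lift C')" unfolding conjugation_def by blast
    show "cinner (lift (composition_operator \<phi>) f) g = cinner f (lift Ts' g)" for f g
      using Ts' mem unfolding hardy_inner_hardy_fun[symmetric] lT lTs adjoint_on_def by blast
    show "lift (composition_operator \<phi>) f = lift C' (lift Ts' (lift C' f))" for f
      unfolding hardy_fun_eq_iff[symmetric] lT lC lTs by (rule eq[OF mem])
  qed
qed

text \<open>The difference of the two sides is linear in each argument and antisymmetric, so density
  of the kernels applies to one argument and then to the other.\<close>

lemma symmetric_if_symmetric_on_kernels:
  assumes T: "bounded_clinear T" and C: "conjugation C"
    and k: "\<And>u v. cmod u < 1 \<Longrightarrow> cmod v < 1 \<Longrightarrow>
      cinner (T (kern u)) (C (kern v)) = cinner (T (kern v)) (C (kern u))"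
  shows "cinner (T f) (C h) = cinner (T h) (C f)"
proof -
  obtain K where K: "\<And>f. norm (T f) \<le> K * norm f"
    using T unfolding bounded_clinear_def by blast
  define L where "L h f = cinner (T f) (C h) - cinner (T h) (C f)" for f h
  have add: "L h (f + g) = L h f + L h g" and scale: "L h (c *\<^sub>C f) = c * L h f" for h f g c
    by (simp_all add: L_def bounded_clinear_add[OF T] conjugation_add[OF C] cinner_add_left cinner_add_right
        bounded_clinear_scaleC[OF T] conjugation_scaleC[OF C] algebra_simps)
  have bd: "cmod (L h f) \<le> (2 * K * norm h) * norm f" for h f
  proof -
    have "cmod (L h f) \<le> cmod (cinner (T f) (C h)) + cmod (cinner (T h) (C f))"
      unfolding L_def by (rule norm_triangle_ineq4)
    also have "\<dots> \<le> norm (T f) * norm (C h) + norm (T h) * norm (C f)"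
      by (intro add_mono cmod_cinner_le)
    also have "\<dots> \<le> (K * norm f) * norm h + (K * norm h) * norm f"
      unfolding conjugation_norm[OF C] by (intro add_mono mult_right_mono K) auto
    finally show ?thesis by (simp add: algebra_simps)
  qed
  have 1: "L (kern v) f = 0" if "cmod v < 1" for v f
    by (rule kernel_density[OF add scale bd]) (use k that in \<open>simp add: L_def\<close>)
  have "L f h = 0"
  proof (rule kernel_density[OF add scale bd])
    fix w :: complex assume "cmod w < 1"
    then show "L f (kern w) = 0" using 1[of w f] by (simp add: L_def)
  qed
  then show ?thesis by (simp add: L_def)
qed

lemma cinner_polarization:
  "cinner f g = (\<Sum>k<4. \<i> ^ k * complex_of_real ((norm (f + \<i> ^ k *\<^sub>C g))\<^sup>2)) / 4"
  unfolding cinner_self[symmetric]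
  by (simp add: eval_nat_numeral cinner_add_left cinner_add_right algebra_simps)

lemma isometry_cinner:
  assumes T: "bounded_clinear T" and iso: "\<And>f. norm (T f) = norm f"
  shows "cinner (T f) (T g) = cinner f g"
  unfolding cinner_polarization[of "T f" "T g"] cinner_polarization[of f g]
  by (simp add: bounded_clinear_add[OF T, symmetric] bounded_clinear_scaleC[OF T, symmetric] iso)

subsection \<open>The shift\<close>

definition shift :: "ell2 \<Rightarrow> ell2" where
  "shift f = Abs_ell2 (\<lambda>n. case n of 0 \<Rightarrow> 0 | Suc m \<Rightarrow> coef f m)"

definition backshift :: "ell2 \<Rightarrow> ell2" where
  "backshift f = Abs_ell2 (\<lambda>n. coef f (Suc n))"

lemma coef_shift [simp]: "coef (shift f) n = (case n of 0 \<Rightarrow> 0 | Suc m \<Rightarrow> coef f m)"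
proof -
  have "summable (\<lambda>n. (cmod (case n of 0 \<Rightarrow> 0 | Suc m \<Rightarrow> coef f m))\<^sup>2)"
    by (subst summable_Suc_iff[symmetric]) (simp add: summable_coef_sq)
  then show ?thesis by (simp add: shift_def coef_Abs)
qed

lemma coef_backshift [simp]: "coef (backshift f) n = coef f (Suc n)"
  using summable_Suc_iff[of "\<lambda>n. (cmod (coef f n))\<^sup>2"] summable_coef_sq[of f]
  by (simp add: backshift_def coef_Abs)

text \<open>The orthogonal decomposition into constants and \<open>z H\<^sup>2\<close>, the latter
  identified with the whole space by the shift.\<close>

lemma cinner_split: "cinner f g = coef f 0 * cnj (coef g 0) + cinner (backshift f) (backshift g)"
  unfolding cinner_def using suminf_split_head[OF summable_cinner[of f g]] by simp

lemma backshift_shift [simp]: "backshift (shift f) = f"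
  by (rule ell2_eqI) simp

lemma cinner_shift_shift [simp]: "cinner (shift f) (shift g) = cinner f g"
  by (subst cinner_split) simp

lemma norm_shift [simp]: "norm (shift f) = norm f"
  using cinner_shift_shift[of f f] unfolding cinner_self of_real_eq_iff
  by (simp add: power2_eq_iff_nonneg)

lemma shift_backshift: "f = coef f 0 *\<^sub>C zpow 0 + shift (backshift f)"
  by (rule ell2_eqI) (simp split: nat.split)

lemma shift_add: "shift (f + g) = shift f + shift g"
  and shift_scaleC: "shift (c *\<^sub>C f) = c *\<^sub>C shift f"
  and backshift_add: "backshift (f + g) = backshift f + backshift g"
  and backshift_scaleC: "backshift (c *\<^sub>C f) = c *\<^sub>C backshift f"
  by (auto intro!: ell2_eqI split: nat.split)

lemma ev_shift [simp]:
  assumes "cmod z < 1"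
  shows "ev (shift f) z = z * ev f z"
proof -
  have "(\<lambda>n. z * (coef f n * z ^ n)) sums (z * ev f z)"
    by (intro sums_mult ev_sums assms)
  then have "(\<lambda>n. coef (shift f) n * z ^ n) sums (z * ev f z)"
    using sums_Suc_iff[of "\<lambda>n. coef (shift f) n * z ^ n" "z * ev f z"] by (simp add: mult_ac)
  then show ?thesis by (simp add: ev_def sums_iff)
qed

subsection \<open>Disk involutions and weighted composition operators\<close>

text \<open>The disk automorphism exchanging \<open>0\<close> and \<open>p\<close>. With this sign
  it is its own inverse.\<close>

definition blaschke :: "complex \<Rightarrow> complex \<Rightarrow> complex" where
  "blaschke p z = (p - z) / (1 - cnj p * z)"

lemma blaschke_0 [simp]: "blaschke p 0 = p" and blaschke_self [simp]: "blaschke p p = 0"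
  by (simp_all add: blaschke_def)

text \<open>Transformation rule of the Szego kernel under \<open>blaschke p\<close>. The case
  \<open>w = z\<close> bounds the modulus; the case \<open>w = 0\<close> gives the factor that makes
  the weighted composition involutive.\<close>

lemma one_minus_cnj_blaschke_mult:
  assumes "cmod p < 1" "cmod w < 1" "cmod z < 1"
  shows "1 - cnj (blaschke p w) * blaschke p z =
    (1 - p * cnj p) * (1 - cnj w * z) / ((1 - p * cnj w) * (1 - cnj p * z))"
proof -
  define a b where "a = 1 - cnj p * z" and "b = 1 - p * cnj w"
  have "a \<noteq> 0" "b \<noteq> 0"
    using one_minus_cnj_mult_nonzero[of p z] one_minus_mult_nonzero[of p "cnj w"] assms
    by (auto simp: a_def b_def)
  then have gen: "1 - (x / b) * (y / a) = (b * a - x * y) / (b * a)" for x y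
    by (simp add: field_simps)
  have "1 - cnj (blaschke p w) * blaschke p z = (b * a - (cnj p - cnj w) * (p - z)) / (b * a)"
    unfolding gen[symmetric] by (simp add: blaschke_def a_def b_def)
  also have "b * a - (cnj p - cnj w) * (p - z) = (1 - p * cnj p) * (1 - cnj w * z)"
    unfolding a_def b_def by (simp add: algebra_simps)
  finally show ?thesis by (simp add: a_def b_def)
qed

lemma cmod_blaschke_less_1:
  assumes "cmod p < 1" "cmod z < 1"
  shows "cmod (blaschke p z) < 1"
proof -
  have nz: "1 - cnj p * z \<noteq> 0" using one_minus_cnj_mult_nonzero assms by blast
  have "1 - cnj (blaschke p z) * blaschke p z =
      (1 - p * cnj p) * (1 - z * cnj z) / ((1 - cnj p * z) * cnj (1 - cnj p * z))"
    using one_minus_cnj_blaschke_mult[of p z z] assms by (simp add: mult_ac)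
  also have "\<dots> = complex_of_real ((1 - (cmod p)\<^sup>2) * (1 - (cmod z)\<^sup>2) / (cmod (1 - cnj p * z))\<^sup>2)"
    unfolding complex_norm_square[symmetric] by simp
  finally have "complex_of_real (1 - (cmod (blaschke p z))\<^sup>2) =
      complex_of_real ((1 - (cmod p)\<^sup>2) * (1 - (cmod z)\<^sup>2) / (cmod (1 - cnj p * z))\<^sup>2)"
    using complex_norm_square[of "blaschke p z"] by (simp add: mult.commute)
  then have "1 - (cmod (blaschke p z))\<^sup>2 =
      (1 - (cmod p)\<^sup>2) * (1 - (cmod z)\<^sup>2) / (cmod (1 - cnj p * z))\<^sup>2"
    unfolding of_real_eq_iff .
  moreover have "\<dots> > 0"
    using assms nz by (intro divide_pos_pos mult_pos_pos) (auto simp: power_less_one_iff)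
  ultimately have "(cmod (blaschke p z))\<^sup>2 < 1" by linarith
  then show ?thesis by (simp add: power_less_one_iff)
qed

lemma one_minus_mult_blaschke:
  assumes "cmod p < 1" "cmod z < 1"
  shows "1 - cnj p * blaschke p z = (1 - p * cnj p) / (1 - cnj p * z)"
  using one_minus_cnj_blaschke_mult[of p 0 z] assms by simp

lemma one_minus_norm_nonzero: "cmod p < 1 \<Longrightarrow> 1 - p * cnj p \<noteq> 0"
  using one_minus_mult_nonzero[of p "cnj p"] by simp

lemma blaschke_blaschke [simp]:
  assumes "cmod p < 1" "cmod z < 1"
  shows "blaschke p (blaschke p z) = z"
proof -
  have nz: "1 - cnj p * z \<noteq> 0" using one_minus_cnj_mult_nonzero assms by blast
  have "p - blaschke p z = z * (1 - p * cnj p) / (1 - cnj p * z)"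
    using nz by (simp add: blaschke_def field_simps)
  then have "blaschke p (blaschke p z) =
      (z * (1 - p * cnj p) / (1 - cnj p * z)) / ((1 - p * cnj p) / (1 - cnj p * z))"
    using one_minus_mult_blaschke[OF assms] by (simp add: blaschke_def)
  then show ?thesis using nz one_minus_norm_nonzero[OF assms(1)] by simp
qed

lemma blaschke_holomorphic: "cmod p < 1 \<Longrightarrow> blaschke p holomorphic_on ball 0 1"
  unfolding blaschke_def[abs_def]
  by (intro holomorphic_intros) (use one_minus_cnj_mult_nonzero[of p] in auto)

lemma multiplication_by_inverse_linear:
  assumes "cmod p < 1"
  obtains N where "bounded_clinear N" "\<And>f z. cmod z < 1 \<Longrightarrow> ev (N f) z = ev f z / (1 - cnj p * z)"
proof (rule multiplication_operator[of "\<lambda>z. 1 / (1 - cnj p * z)" "1 / (1 - cmod p)"])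
  show "(\<lambda>z. 1 / (1 - cnj p * z)) holomorphic_on ball 0 1"
    by (intro holomorphic_intros) (use one_minus_cnj_mult_nonzero[OF assms] in auto)
  show "cmod (1 / (1 - cnj p * z)) \<le> 1 / (1 - cmod p)" if "cmod z < 1" for z
  proof -
    have "1 - cmod p \<le> 1 - cmod (cnj p * z)"
      using that by (simp add: norm_mult mult_left_le)
    also have "\<dots> \<le> cmod (1 - cnj p * z)"
      using norm_triangle_ineq2[of 1 "cnj p * z"] by simp
    finally show ?thesis using assms by (simp add: norm_divide frac_le)
  qed
qed (use that in simp)

text \<open>Isometry without boundary values: with \<open>N f\<close> denoting the quotient of
  \<open>f\<close> by \<open>1 - cnj p * z\<close>, both \<open>f\<close> and its product with the
  Blaschke factor are combinations of \<open>N f\<close> and \<open>shift (N f)\<close>. Because the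
  shift is isometric, the two expansions give the same inner products.\<close>

lemma multiplication_by_blaschke:
  assumes p: "cmod p < 1"
  obtains M where "bounded_clinear M" "\<And>f z. cmod z < 1 \<Longrightarrow> ev (M f) z = blaschke p z * ev f z"
    "\<And>f g. cinner (M f) (M g) = cinner f g"
proof -
  obtain N where N: "bounded_clinear N" "\<And>f z. cmod z < 1 \<Longrightarrow> ev (N f) z = ev f z / (1 - cnj p * z)"
    using multiplication_by_inverse_linear[OF p] by blast
  have bl: "cmod (blaschke p z) \<le> 1" if "cmod z < 1" for z
    using cmod_blaschke_less_1[OF p that] by simp
  show thesis
  proof (rule multiplication_operator[OF blaschke_holomorphic[OF p] bl])
    fix M assume M: "bounded_clinear M" "\<And>f z. cmod z < 1 \<Longrightarrow> ev (M f) z = blaschke p z * ev f z"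
    have MN: "M f = p *\<^sub>C N f - shift (N f)" for f
      by (rule ev_eqI) (simp add: M N blaschke_def diff_divide_distrib left_diff_distrib)
    have fN: "f = N f - cnj p *\<^sub>C shift (N f)" for f
    proof (rule ev_eqI)
      fix z :: complex assume z: "cmod z < 1"
      have "ev f z / (1 - cnj p * z) - cnj p * (z * (ev f z / (1 - cnj p * z))) =
          (1 - cnj p * z) * (ev f z / (1 - cnj p * z))"
        by (simp only: left_diff_distrib mult.assoc mult_1)
      then show "ev f z = ev (N f - cnj p *\<^sub>C shift (N f)) z"
        using one_minus_cnj_mult_nonzero[OF p z] z by (simp add: N)
    qed
    have "cinner (M f) (M g) = cinner (N f - cnj p *\<^sub>C shift (N f)) (N g - cnj p *\<^sub>C shift (N g))" for f g
      unfolding MN by (simp add: cinner_minus_left cinner_minus_right algebra_simps)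
    then have "cinner (M f) (M g) = cinner f g" for f g unfolding fN[symmetric] .
    then show thesis using that M by blast
  qed
qed

text \<open>The images \<open>u n\<close> of the monomials are the normalized kernel at
  \<open>p\<close> times the powers of the Blaschke factor, an orthonormal system. The weight is
  what makes the composition unitary.\<close>

lemma weighted_blaschke_composition:
  assumes p: "cmod p < 1"
  obtains W where "bounded_clinear W"
    "\<And>f z. cmod z < 1 \<Longrightarrow>
       ev (W f) z = complex_of_real (sqrt (1 - (cmod p)\<^sup>2)) / (1 - cnj p * z) * ev f (blaschke p z)"
    "\<And>f g. cinner (W f) (W g) = cinner f g" "\<And>f. W (W f) = f"
proof -
  define s where "s = complex_of_real (sqrt (1 - (cmod p)\<^sup>2))"
  have p2: "(cmod p)\<^sup>2 < 1" using p by (simp add: power_less_one_iff)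
  have "s * s = complex_of_real (1 - (cmod p)\<^sup>2)"
    using p2 unfolding s_def of_real_mult[symmetric] by simp
  then have s2: "s * s = 1 - p * cnj p"
    by (simp only: of_real_diff of_real_1 complex_norm_square)
  have cs: "cnj s = s" by (simp add: s_def)
  obtain M where M: "bounded_clinear M" "\<And>f z. cmod z < 1 \<Longrightarrow> ev (M f) z = blaschke p z * ev f z"
    "\<And>f g. cinner (M f) (M g) = cinner f g" using multiplication_by_blaschke[OF p] by blast
  define u where "u n = (M ^^ n) (s *\<^sub>C kern p)" for n
  have evu: "ev (u n) z = s / (1 - cnj p * z) * blaschke p z ^ n" if "cmod z < 1" for n z
    by (induction n) (simp_all add: u_def M that p ev_kern)
  have shiftu: "cinner (u (m + k)) (u m) = cinner (u k) (u 0)" for m k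
    by (induction m) (simp_all add: u_def M)
  \<comment> \<open>Pairing with \<open>u 0\<close> evaluates at \<open>p\<close>, up to the factor
    \<open>s\<close>, and the Blaschke factor vanishes there.\<close>
  have u0: "cinner (u k) (u 0) = (if k = 0 then 1 else 0)" for k
    using evu[OF p, of k] one_minus_norm_nonzero[OF p] s2
    by (simp add: u_def cinner_kern p cs mult.commute)
  have orth: "cinner (u n) (u m) = (if n = m then 1 else 0)" for n m
  proof (cases "m \<le> n")
    case True
    then show ?thesis using shiftu[of m "n - m"] u0[of "n - m"] by auto
  next
    case False
    then show ?thesis using shiftu[of n "m - n"] u0[of "m - n"] cinner_commute[of "u m" "u n"]
      by (auto simp: cinner_commute[of "u m"])
  qed
  have nu: "(norm (\<Sum>n<N. c n *\<^sub>C u n))\<^sup>2 = (\<Sum>n<N. (cmod (c n))\<^sup>2)" for N c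
  proof -
    have "cinner (\<Sum>n<N. c n *\<^sub>C u n) (u m) = (if m < N then c m else 0)" for m
      by (simp add: cinner_sum_left orth if_distrib[of "\<lambda>x. _ * x"] cong: if_cong)
    then have r: "cinner (u m) (\<Sum>n<N. c n *\<^sub>C u n) = (if m < N then cnj (c m) else 0)" for m
      by (subst cinner_commute) simp
    have "cinner (\<Sum>n<N. c n *\<^sub>C u n) (\<Sum>n<N. c n *\<^sub>C u n) = (\<Sum>m<N. c m * cnj (c m))"
      by (subst cinner_sum_left) (simp add: r)
    then have "complex_of_real ((norm (\<Sum>n<N. c n *\<^sub>C u n))\<^sup>2) = complex_of_real (\<Sum>n<N. (cmod (c n))\<^sup>2)"
      unfolding cinner_self by (simp add: complex_norm_square del: of_real_power)
    then show ?thesis unfolding of_real_eq_iff .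
  qed
  have "norm (\<Sum>n<N. c n *\<^sub>C u n) = norm (\<Sum>n<N. c n *\<^sub>C zpow n)" for N c
    by (rule power2_eq_imp_eq) (simp_all only: nu norm_sq_sum_zpow norm_ge_zero)
  then have le: "norm (\<Sum>n<N. c n *\<^sub>C u n) \<le> 1 * norm (\<Sum>n<N. c n *\<^sub>C zpow n)" for N c
    by simp
  show thesis
  proof (rule bounded_clinear_extension[OF le])
    fix W assume W: "bounded_clinear W" "\<And>f. norm (W f) \<le> 1 * norm f"
      "\<And>f. (\<lambda>N. \<Sum>n<N. coef f n *\<^sub>C u n) \<longlonglongrightarrow> W f"
    have evW: "ev (W f) z = s / (1 - cnj p * z) * ev f (blaschke p z)" if z: "cmod z < 1" for f z
    proof (rule LIMSEQ_unique)
      show "(\<lambda>N. cinner (\<Sum>n<N. coef f n *\<^sub>C u n) (kern z)) \<longlonglongrightarrow> ev (W f) z"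
        unfolding cinner_kern[OF z, symmetric] by (intro tendsto_cinner_left W)
      have "cinner (\<Sum>n<N. coef f n *\<^sub>C u n) (kern z) =
          s / (1 - cnj p * z) * (\<Sum>n<N. coef f n * blaschke p z ^ n)" for N
        by (simp add: cinner_sum_left cinner_kern z evu sum_distrib_left mult_ac)
      moreover have "(\<lambda>N. s / (1 - cnj p * z) * (\<Sum>n<N. coef f n * blaschke p z ^ n)) \<longlonglongrightarrow>
          s / (1 - cnj p * z) * ev f (blaschke p z)"
        using ev_sums[OF cmod_blaschke_less_1[OF p z], of f] unfolding sums_def
        by (rule tendsto_mult_left)
      ultimately show "(\<lambda>N. cinner (\<Sum>n<N. coef f n *\<^sub>C u n) (kern z)) \<longlonglongrightarrow>
          s / (1 - cnj p * z) * ev f (blaschke p z)" by simp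
    qed
    have WW: "W (W f) = f" for f
    proof (rule ev_eqI)
      fix z :: complex assume z: "cmod z < 1"
      have "ev (W (W f)) z = (s * s) / ((1 - cnj p * z) * (1 - cnj p * blaschke p z)) * ev f z"
        by (simp add: evW z cmod_blaschke_less_1 p)
      also have "\<dots> = ev f z"
        using one_minus_mult_blaschke[OF p z] one_minus_norm_nonzero[OF p] one_minus_cnj_mult_nonzero[OF p z]
        by (simp add: s2)
      finally show "ev (W (W f)) z = ev f z" .
    qed
    \<comment> \<open>A contraction that is its own inverse is isometric.\<close>
    have "norm (W f) = norm f" for f
      using W(2)[of f] W(2)[of "W f"] by (simp add: WW)
    from that[OF W(1) evW[unfolded s_def] isometry_cinner[OF W(1) this] WW] show thesis by simp
  qed
qed

subsection \<open>Composition operators\<close>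

text \<open>Littlewood subordination by Horner's scheme: a polynomial in \<phi> is a constant plus
  \<phi> times a polynomial in \<phi> of lower degree. Since \<phi> vanishes at \<open>0\<close>,
  the two parts are orthogonal, and multiplication by \<phi> is a contraction.\<close>

lemma subordination:
  assumes hol: "\<phi> holomorphic_on ball 0 1" and \<phi>: "\<And>z. cmod z < 1 \<Longrightarrow> cmod (\<phi> z) < 1"
    and 0: "\<phi> 0 = 0"
  obtains T where "bounded_clinear T" "composes_with T \<phi>"
proof -
  have \<phi>1: "cmod (\<phi> z) \<le> 1" if "cmod z < 1" for z using \<phi>[OF that] by simp
  show thesis
  proof (rule multiplication_operator[OF hol \<phi>1])
    fix M assume M: "bounded_clinear M" "\<And>f. norm (M f) \<le> 1 * norm f"
      "\<And>f z. cmod z < 1 \<Longrightarrow> ev (M f) z = \<phi> z * ev f z"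
    define u where "u n = (M ^^ n) (zpow 0)" for n
    have evu: "ev (u n) z = \<phi> z ^ n" if "cmod z < 1" for n z
      by (induction n) (simp_all add: u_def M that)
    have Msum: "M (sum g A) = (\<Sum>i\<in>A. M (g i))" for g :: "nat \<Rightarrow> ell2" and A
      by (induction A rule: infinite_finite_induct)
        (simp_all add: bounded_clinear_0[OF M(1)] bounded_clinear_add[OF M(1)])
    have le2: "(norm (\<Sum>n<N. c n *\<^sub>C u n))\<^sup>2 \<le> (\<Sum>n<N. (cmod (c n))\<^sup>2)" for N c
    proof (induction N arbitrary: c)
      case (Suc N)
      define y where "y = (\<Sum>n<N. c (Suc n) *\<^sub>C u n)"
      have split: "(\<Sum>n<Suc N. c n *\<^sub>C u n) = c 0 *\<^sub>C zpow 0 + M y"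
        unfolding y_def sum.lessThan_Suc_shift
        by (simp add: Msum bounded_clinear_scaleC[OF M(1)] u_def)
      have "cinner (M y) (zpow 0) = 0"
        using M(3)[of 0 y] by (simp add: 0)
      then have "cinner (c 0 *\<^sub>C zpow 0 + M y) (c 0 *\<^sub>C zpow 0 + M y) =
          c 0 * cnj (c 0) + cinner (M y) (M y)"
        by (simp add: cinner_add_left cinner_add_right cinner_commute[of "zpow 0" "M y"])
      then have "complex_of_real ((norm (c 0 *\<^sub>C zpow 0 + M y))\<^sup>2) =
          complex_of_real ((cmod (c 0))\<^sup>2 + (norm (M y))\<^sup>2)"
        unfolding cinner_self complex_norm_square[symmetric] by simp
      then have "(norm (\<Sum>n<Suc N. c n *\<^sub>C u n))\<^sup>2 = (cmod (c 0))\<^sup>2 + (norm (M y))\<^sup>2"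
        unfolding of_real_eq_iff split .
      moreover have "(norm (M y))\<^sup>2 \<le> (norm y)\<^sup>2"
        using M(2)[of y] by (intro power_mono) auto
      moreover have "(norm y)\<^sup>2 \<le> (\<Sum>n<N. (cmod (c (Suc n)))\<^sup>2)"
        unfolding y_def by (rule Suc.IH)
      moreover have "(\<Sum>n<Suc N. (cmod (c n))\<^sup>2) = (cmod (c 0))\<^sup>2 + (\<Sum>n<N. (cmod (c (Suc n)))\<^sup>2)"
        by (rule sum.lessThan_Suc_shift)
      ultimately show ?case by linarith
    qed simp
    have le: "norm (\<Sum>n<N. c n *\<^sub>C u n) \<le> 1 * norm (\<Sum>n<N. c n *\<^sub>C zpow n)" for N c
      by (rule power2_le_imp_le) (use le2[where N = N and c = c] in \<open>simp_all add: norm_sq_sum_zpow\<close>)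
    show thesis
    proof (rule bounded_clinear_extension[OF le])
      fix T assume T: "bounded_clinear T" "\<And>f. (\<lambda>N. \<Sum>n<N. coef f n *\<^sub>C u n) \<longlonglongrightarrow> T f"
      have "composes_with T \<phi>"
        unfolding composes_with_def
      proof (intro allI impI)
        fix f z assume z: "cmod (z::complex) < 1"
        have "(\<lambda>N. cinner (\<Sum>n<N. coef f n *\<^sub>C u n) (kern z)) \<longlonglongrightarrow> ev (T f) z"
          unfolding cinner_kern[OF z, symmetric] by (intro tendsto_cinner_left T)
        moreover have "cinner (\<Sum>n<N. coef f n *\<^sub>C u n) (kern z) = (\<Sum>n<N. coef f n * \<phi> z ^ n)" for N
          by (simp add: cinner_sum_left cinner_kern z evu)
        moreover have "(\<lambda>N. \<Sum>n<N. coef f n * \<phi> z ^ n) \<longlonglongrightarrow> ev f (\<phi> z)"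
          using ev_sums[OF \<phi>[OF z], of f] unfolding sums_def .
        ultimately show "ev (T f) z = ev f (\<phi> z)" using LIMSEQ_unique by simp
      qed
      then show thesis using that T by blast
    qed
  qed
qed

text \<open>The Blaschke involution at \<open>\<phi> 0\<close> reduces the symbol to one fixing
  \<open>0\<close>. Composition with the involution itself is bounded because it differs from the
  weighted unitary only by a bounded factor.\<close>

lemma bounded_composition_operator:
  assumes hol: "\<phi> holomorphic_on ball 0 1" and \<phi>: "\<And>z. cmod z < 1 \<Longrightarrow> cmod (\<phi> z) < 1"
  obtains T where "bounded_clinear T" "composes_with T \<phi>"
proof -
  define a where "a = \<phi> 0"
  have a: "cmod a < 1" using \<phi>[of 0] by (simp add: a_def)
  define s where "s = complex_of_real (sqrt (1 - (cmod a)\<^sup>2))"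
  obtain W where W: "bounded_clinear W"
    "\<And>f z. cmod z < 1 \<Longrightarrow> ev (W f) z = s / (1 - cnj a * z) * ev f (blaschke a z)"
    "\<And>f g. cinner (W f) (W g) = cinner f g" "\<And>f. W (W f) = f"
    unfolding s_def using weighted_blaschke_composition[OF a] by blast
  have s: "s \<noteq> 0" using a by (simp add: s_def abs_square_eq_1 power2_eq_1_iff)
  \<comment> \<open>Multiplication by \<open>(1 - cnj a * z) / s\<close> removes the weight from
    \<open>W\<close>.\<close>
  define Ta where "Ta f = (1 / s) *\<^sub>C (W f - cnj a *\<^sub>C shift (W f))" for f
  have evTa: "ev (Ta f) z = ev f (blaschke a z)" if "cmod z < 1" for f z
  proof -
    have "ev (Ta f) z = (1 / s) * ((1 - cnj a * z) * ev (W f) z)"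
      using that by (simp add: Ta_def algebra_simps)
    then show ?thesis
      using that s one_minus_cnj_mult_nonzero[OF a that] by (simp add: W(2))
  qed
  obtain \<psi> where \<psi>: "\<psi> = (\<lambda>z. blaschke a (\<phi> z))" by blast
  have "\<psi> holomorphic_on ball 0 1"
    unfolding \<psi> using \<phi>
    by (intro holomorphic_on_compose_gen[OF hol blaschke_holomorphic[OF a], unfolded o_def]) auto
  moreover have "cmod (\<psi> z) < 1" if "cmod z < 1" for z
    unfolding \<psi> by (intro cmod_blaschke_less_1 a \<phi> that)
  moreover have "\<psi> 0 = 0" by (simp add: \<psi> a_def)
  ultimately obtain S where S: "bounded_clinear S" "composes_with S \<psi>"
    by (rule subordination)
  have Ta: "bounded_clinear Ta"
  proof -
    obtain K where K: "\<And>f. norm (W f) \<le> K * norm f"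
      using W unfolding bounded_clinear_def by blast
    have "norm (Ta f) \<le> (cmod (1 / s) * (K + cmod a * K)) * norm f" for f
    proof -
      have "norm (W f - cnj a *\<^sub>C shift (W f)) \<le> norm (W f) + cmod a * norm (W f)"
        using norm_triangle_ineq4[of "W f" "cnj a *\<^sub>C shift (W f)"] by simp
      also have "\<dots> \<le> K * norm f + cmod a * (K * norm f)"
        by (intro add_mono mult_left_mono K) auto
      finally have "cmod (1 / s) * norm (W f - cnj a *\<^sub>C shift (W f)) \<le>
          cmod (1 / s) * (K * norm f + cmod a * (K * norm f))" by (rule mult_left_mono) simp
      then show ?thesis unfolding Ta_def norm_scaleC by (simp add: algebra_simps)
    qed
    moreover have "Ta (c *\<^sub>C f + d *\<^sub>C g) = c *\<^sub>C Ta f + d *\<^sub>C Ta g" for c f d g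
      by (rule ev_eqI) (simp add: evTa cmod_blaschke_less_1[OF a])
    ultimately show ?thesis unfolding bounded_clinear_def by blast
  qed
  show thesis
  proof
    show "bounded_clinear (\<lambda>f. S (Ta f))" by (rule bounded_clinear_compose[OF S(1) Ta])
    show "composes_with (\<lambda>f. S (Ta f)) \<phi>"
      unfolding composes_with_def
      by (auto simp: composes_withD[OF S(2)] evTa \<psi> cmod_blaschke_less_1 a \<phi>)
  qed
qed

subsection \<open>Antiholomorphic involutions\<close>

definition reflect :: "complex \<Rightarrow> ell2 \<Rightarrow> ell2" where
  "reflect \<nu> f = Abs_ell2 (\<lambda>n. cnj (coef f n * \<nu> ^ n))"

lemma coef_reflect: "cmod \<nu> = 1 \<Longrightarrow> coef (reflect \<nu> f) n = cnj (coef f n * \<nu> ^ n)"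
  using summable_coef_sq[of f] unfolding reflect_def
  by (subst coef_Abs) (simp_all add: norm_mult norm_power)

lemma unimodular_mult_cnj: "cmod \<nu> = 1 \<Longrightarrow> \<nu> * cnj \<nu> = 1"
  by (simp add: complex_norm_square[symmetric])

lemma conjugation_reflect:
  assumes \<nu>: "cmod \<nu> = 1"
  shows "conjugation (reflect \<nu>)"
proof -
  have n1: "\<nu> ^ n * cnj \<nu> ^ n = 1" for n
    unfolding power_mult_distrib[symmetric] unimodular_mult_cnj[OF \<nu>] by simp
  have "cnj (coef f n * \<nu> ^ n) * cnj (cnj (coef g n * \<nu> ^ n)) =
      coef g n * cnj (coef f n) * (\<nu> ^ n * cnj \<nu> ^ n)" for f g n
    by (simp add: mult_ac)
  then have "cinner (reflect \<nu> f) (reflect \<nu> g) = cinner g f" for f g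
    unfolding cinner_def coef_reflect[OF \<nu>] by (simp only: n1 mult_1_right)
  moreover have "reflect \<nu> (reflect \<nu> f) = f" for f
    by (rule ell2_eqI) (use n1 in \<open>simp add: coef_reflect[OF \<nu>] mult_ac\<close>)
  moreover have "reflect \<nu> (a *\<^sub>C f + b *\<^sub>C g) = cnj a *\<^sub>C reflect \<nu> f + cnj b *\<^sub>C reflect \<nu> g" for a f b g
    by (rule ell2_eqI) (simp add: coef_reflect[OF \<nu>] algebra_simps)
  ultimately show ?thesis unfolding conjugation_def by blast
qed

lemma ev_reflect:
  assumes \<nu>: "cmod \<nu> = 1" and z: "cmod z < 1"
  shows "ev (reflect \<nu> f) z = cnj (ev f (\<nu> * cnj z))"
proof -
  have "(\<lambda>n. cnj (coef f n * (\<nu> * cnj z) ^ n)) sums cnj (ev f (\<nu> * cnj z))"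
    unfolding sums_cnj by (rule ev_sums) (use assms in \<open>simp add: norm_mult\<close>)
  then have "(\<lambda>n. coef (reflect \<nu> f) n * z ^ n) sums cnj (ev f (\<nu> * cnj z))"
    by (simp add: coef_reflect[OF \<nu>] power_mult_distrib mult_ac)
  then show ?thesis by (simp add: ev_def sums_iff)
qed

lemma reflect_kern:
  assumes "cmod \<nu> = 1" "cmod w < 1"
  shows "reflect \<nu> (kern w) = kern (\<nu> * cnj w)"
  by (rule ell2_eqI) (use assms in \<open>simp add: coef_reflect norm_mult power_mult_distrib\<close>)

text \<open>With such a factor, \<open>z \<mapsto> \<nu> * cnj z\<close> is the reflection in the
  line through \<open>0\<close> and \<open>p\<close>; for \<open>p = 0\<close> any line through
  \<open>0\<close> will do.\<close>

lemma unimodular_reflection: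
  obtains \<nu> where "cmod \<nu> = 1" "\<nu> * cnj p = p"
proof (cases "p = 0")
  case False
  then show ?thesis using that[of "p / cnj p"] by (simp add: norm_divide)
qed (use that[of 1] in simp)

lemma blaschke_reflection:
  assumes "\<nu> * cnj p = p"
  shows "blaschke p (\<nu> * cnj z) = \<nu> * cnj (blaschke p z)"
proof -
  have "p - \<nu> * cnj z = \<nu> * (cnj p - cnj z)" using assms by (simp add: algebra_simps)
  moreover have "1 - cnj p * (\<nu> * cnj z) = 1 - p * cnj z" using assms by (simp add: mult_ac)
  ultimately show ?thesis by (simp add: blaschke_def)
qed

text \<open>
  The antiholomorphic involution of the disk that exchanges \<open>0\<close> and \<open>p\<close> is
  \<open>z \<mapsto> blaschke p (\<nu> * cnj z)\<close>, with \<open>\<nu> = p / cnj p\<close>.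
\<close>

lemma disk_conjugation:
  assumes p: "cmod p < 1" and \<nu>: "cmod \<nu> = 1" "\<nu> * cnj p = p"
  obtains C where "conjugation C"
    "\<And>v. cmod v < 1 \<Longrightarrow> C (kern v) =
       (complex_of_real (sqrt (1 - (cmod p)\<^sup>2)) / (1 - cnj p * v)) *\<^sub>C kern (blaschke p (\<nu> * cnj v))"
proof -
  define s where "s = complex_of_real (sqrt (1 - (cmod p)\<^sup>2))"
  obtain W where W: "bounded_clinear W"
    "\<And>f z. cmod z < 1 \<Longrightarrow> ev (W f) z = s / (1 - cnj p * z) * ev f (blaschke p z)"
    "\<And>f g. cinner (W f) (W g) = cinner f g" "\<And>f. W (W f) = f"
    unfolding s_def using weighted_blaschke_composition[OF p] by blast
  note J = conjugation_reflect[OF \<nu>(1)]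
  have \<nu>p: "cnj \<nu> * p = cnj p" using \<nu>(2) by (metis complex_cnj_cnj complex_cnj_mult)
  have n\<nu>: "cmod (\<nu> * cnj z) < 1" if "cmod z < 1" for z using that \<nu> by (simp add: norm_mult)
  note bl = blaschke_reflection[OF \<nu>(2)]
  \<comment> \<open>The reflection fixes \<open>p\<close>, so it commutes with the Blaschke factor
    and respects the weight; hence its product with \<open>W\<close> is again an involution.\<close>
  have JW: "reflect \<nu> (W f) = W (reflect \<nu> f)" for f
  proof (rule ev_eqI)
    fix z :: complex assume z: "cmod z < 1"
    have "p * (cnj \<nu> * z) = cnj p * z"
      using \<nu>p by (metis mult.assoc mult.commute)
    moreover have "cnj s = s" by (simp add: s_def)
    ultimately show "ev (reflect \<nu> (W f)) z = ev (W (reflect \<nu> f)) z"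
      using z by (simp add: ev_reflect[OF \<nu>(1)] W(2) n\<nu> bl cmod_blaschke_less_1[OF p])
  qed
  have "conjugation (\<lambda>f. W (reflect \<nu> f))"
    unfolding conjugation_def
    by (simp add: W(3,4) JW[symmetric] conjugation_cinner[OF J] conjugation_involution[OF J]
        conjugation_add[OF J] conjugation_scaleC[OF J] bounded_clinear_add[OF W(1)] bounded_clinear_scaleC[OF W(1)])
  moreover have "W (reflect \<nu> (kern v)) = (s / (1 - cnj p * v)) *\<^sub>C kern (blaschke p (\<nu> * cnj v))"
    if v: "cmod v < 1" for v
  proof (rule ev_eqI)
    fix z :: complex assume z: "cmod z < 1"
    let ?x = "\<nu> * cnj v"
    have nz1: "1 - cnj p * z \<noteq> 0" by (rule one_minus_cnj_mult_nonzero[OF p z])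
    have nz2: "1 - p * cnj ?x \<noteq> 0"
      using one_minus_cnj_mult_nonzero[OF n\<nu>[OF v] p] by (simp only: mult.commute not_False_eq_True)
    have nz3: "1 - cnj ?x * blaschke p z \<noteq> 0"
      by (rule one_minus_cnj_mult_nonzero[OF n\<nu>[OF v] cmod_blaschke_less_1[OF p z]])
    have nz4: "1 - cnj (blaschke p ?x) * z \<noteq> 0"
      by (rule one_minus_cnj_mult_nonzero[OF cmod_blaschke_less_1[OF p n\<nu>[OF v]] z])
    have "(1 - cnj p * z) * blaschke p z = p - z"
      using nz1 by (simp add: blaschke_def)
    moreover have "(1 - p * cnj ?x) * cnj (blaschke p ?x) = cnj p - cnj ?x"
      using nz2 by (simp add: blaschke_def)
    ultimately have e: "(1 - cnj p * z) * (1 - cnj ?x * blaschke p z) =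
        (1 - p * cnj ?x) * (1 - cnj (blaschke p ?x) * z)" by algebra
    have "ev (W (reflect \<nu> (kern v))) z = s / ((1 - cnj p * z) * (1 - cnj ?x * blaschke p z))"
      using z v by (simp add: reflect_kern \<nu> W(2) ev_kern n\<nu> cmod_blaschke_less_1[OF p])
    also have "\<dots> = ev ((s / (1 - p * cnj ?x)) *\<^sub>C kern (blaschke p ?x)) z"
      unfolding e using z v by (simp add: ev_kern n\<nu> cmod_blaschke_less_1[OF p])
    finally have "ev (W (reflect \<nu> (kern v))) z = \<dots>" .
    moreover have "p * cnj ?x = cnj p * v" using \<nu>p by (simp add: mult_ac)
    ultimately show "ev (W (reflect \<nu> (kern v))) z = ev ((s / (1 - cnj p * v)) *\<^sub>C kern (blaschke p ?x)) z"
      by (simp only:)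
  qed
  ultimately show thesis using that unfolding s_def by blast
qed

subsection \<open>Non-automorphic symbols with complex symmetric composition operators\<close>

text \<open>The parametrization says that the symbol fixes \<open>p\<close>. Pairing
  \<open>T (kern u)\<close> with \<open>C (kern v)\<close> gives a closed form that depends on
  \<open>u\<close> and \<open>v\<close> only through \<open>cnj u + cnj v\<close> and
  \<open>cnj u * cnj v\<close>, hence is symmetric.\<close>

lemma complex_symmetric_affine:
  assumes p: "cmod p < 1" and \<phi>: "\<And>z. cmod z < 1 \<Longrightarrow> \<phi> z = a * z + p * (1 - a)"
    and self: "\<And>z. cmod z < 1 \<Longrightarrow> cmod (\<phi> z) < 1"
  shows "complex_symmetric_on hardy_space hardy_inner (composition_operator \<phi>)"
proof -
  have "(\<lambda>z. a * z + p * (1 - a)) holomorphic_on ball 0 1" by (intro holomorphic_intros)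
  then have "\<phi> holomorphic_on ball 0 1"
    by (rule holomorphic_transform) (simp add: \<phi>)
  then obtain T where T: "bounded_clinear T" "composes_with T \<phi>"
    using bounded_composition_operator self by blast
  obtain \<nu> where \<nu>: "cmod \<nu> = 1" "\<nu> * cnj p = p" using unimodular_reflection .
  define s where "s = complex_of_real (sqrt (1 - (cmod p)\<^sup>2))"
  obtain C where C: "conjugation C"
    "\<And>v. cmod v < 1 \<Longrightarrow> C (kern v) = (s / (1 - cnj p * v)) *\<^sub>C kern (blaschke p (\<nu> * cnj v))"
    unfolding s_def using disk_conjugation[OF p \<nu>] by blast
  have form: "cinner (T (kern u)) (C (kern v)) =
      s / (1 - p * (cnj u + cnj v) + (a * \<nu> + p * (1 - a) * p) * (cnj u * cnj v))"
    if u: "cmod u < 1" and v: "cmod v < 1" for u v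
  proof -
    let ?x = "blaschke p (\<nu> * cnj v)"
    have x: "cmod ?x < 1" using v \<nu> by (intro cmod_blaschke_less_1 p) (simp add: norm_mult)
    have "1 - p * cnj v \<noteq> 0" using one_minus_mult_nonzero[of p "cnj v"] p v by simp
    moreover have "?x = (p - \<nu> * cnj v) / (1 - p * cnj v)"
    proof -
      have "cnj p * (\<nu> * cnj v) = p * cnj v" using \<nu>(2) by (metis mult.assoc mult.commute)
      then show ?thesis by (simp add: blaschke_def)
    qed
    ultimately have "(1 - p * cnj v) * ?x = p - \<nu> * cnj v" by simp
    then have e: "(1 - p * cnj v) * (1 - cnj u * (a * ?x + p * (1 - a))) =
        1 - p * (cnj u + cnj v) + (a * \<nu> + p * (1 - a) * p) * (cnj u * cnj v)"
      by algebra
    have "cinner (T (kern u)) (C (kern v)) = cnj (s / (1 - cnj p * v)) * ev (kern u) (\<phi> ?x)"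
      by (simp add: C v cinner_kern x composes_withD[OF T(2)])
    also have "\<dots> = s / ((1 - p * cnj v) * (1 - cnj u * (a * ?x + p * (1 - a))))"
      using self[OF x] by (simp add: ev_kern u \<phi>[OF x] s_def)
    finally show ?thesis unfolding e .
  qed
  have "cinner (T f) (C h) = cinner (T h) (C f)" for f h
    by (rule symmetric_if_symmetric_on_kernels[OF T(1) C(1)])
      (simp add: form add.commute mult.commute)
  from complex_symmetric_onI[OF T self C(1) this] show ?thesis .
qed

text \<open>Composition turns a kernel into a linear factor times a kernel whose parameter has the
  form \<open>c + v * a\<close> up to conjugation, so this point has to stay in the disk. Otherwise
  some disk point on the ray toward \<open>1 / (c + v * a)\<close> would satisfy |1 - c z| \<le> |a
  z|.\<close>

lemma kernel_parameter_bound: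
  assumes a: "a \<noteq> 0" and nz: "\<And>z. cmod z < 1 \<Longrightarrow> 1 - c * z \<noteq> 0"
    and self: "\<And>z. cmod z < 1 \<Longrightarrow> cmod (a * z / (1 - c * z)) < 1" and v: "cmod v < 1"
  shows "cmod (c + v * a) < 1"
proof (rule ccontr)
  assume "\<not> cmod (c + v * a) < 1"
  then have w1: "cmod (c + v * a) \<ge> 1" by simp
  define w where "w = c + v * a"
  have w: "w \<noteq> 0" "cmod w \<ge> 1" using w1 by (auto simp: w_def)
  \<comment> \<open>\<open>K\<close> and \<open>t\<close> are adjusted by
    \<open>1 - t = t * K\<close> so that the triangle inequality ends exactly in |a z|. The factor
    \<open>t < 1\<close> keeps \<open>z\<close> inside the disk even when \<open>w\<close> has
    modulus one.\<close>
  define K where "K = cmod a * (1 - cmod v) / cmod w"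
  have K: "K > 0" using a v w by (simp add: K_def)
  define t where "t = 1 / (1 + K)"
  have t: "0 < t" "t < 1" "1 - t = t * K" using K by (simp_all add: t_def field_simps)
  define z where "z = complex_of_real t / w"
  have cz: "cmod z = t / cmod w" using t by (simp add: z_def norm_divide)
  have "t / cmod w \<le> t / 1" using t w by (intro divide_left_mono) auto
  then have z: "cmod z < 1" unfolding cz using t by simp
  have "1 - c * z = (1 - complex_of_real t) + v * a * z"
    using w(1) by (simp add: z_def w_def field_simps)
  then have "cmod (1 - c * z) \<le> cmod (1 - complex_of_real t) + cmod (v * a * z)"
    using norm_triangle_ineq by metis
  also have "cmod (1 - complex_of_real t) = 1 - t"
    using t by (metis abs_of_pos diff_gt_0_iff_gt norm_of_real of_real_1 of_real_diff)
  also have "cmod (v * a * z) = cmod a * cmod z * cmod v" by (simp add: norm_mult)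
  finally have "cmod (1 - c * z) \<le> t * K + cmod a * cmod z * cmod v" using t(3) by simp
  also have "\<dots> = cmod a * cmod z" using w(1) unfolding K_def cz by (simp add: field_simps)
  finally have "cmod (1 - c * z) \<le> cmod (a * z)" by (simp add: norm_mult)
  moreover have "cmod (a * z) < cmod (1 - c * z)"
    using self[OF z] nz[OF z] by (simp add: norm_divide divide_less_eq)
  ultimately show False by simp
qed

text \<open>The hypothesis on \<open>c\<close> means that \<open>1 / cnj p\<close>, read as infinity
  for \<open>p = 0\<close>, is a fixed point besides \<open>0\<close>.\<close>

lemma complex_symmetric_fixing_zero:
  assumes p: "cmod p < 1" and a: "a \<noteq> 0" and c: "c = cnj p * (1 - a)"
    and nz: "\<And>z. cmod z < 1 \<Longrightarrow> 1 - c * z \<noteq> 0"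
    and \<phi>: "\<And>z. cmod z < 1 \<Longrightarrow> \<phi> z = a * z / (1 - c * z)"
    and self: "\<And>z. cmod z < 1 \<Longrightarrow> cmod (\<phi> z) < 1"
  shows "complex_symmetric_on hardy_space hardy_inner (composition_operator \<phi>)"
proof -
  have "(\<lambda>z. a * z / (1 - c * z)) holomorphic_on ball 0 1"
    using nz by (intro holomorphic_intros) auto
  then have "\<phi> holomorphic_on ball 0 1"
    by (rule holomorphic_transform) (simp add: \<phi>)
  then obtain T where T: "bounded_clinear T" "composes_with T \<phi>"
    using bounded_composition_operator self by blast
  have T0: "coef (T f) 0 = coef f 0" for f
    using composes_withD[OF T(2), of 0 f] by (simp add: \<phi>)
  obtain \<nu> where \<nu>: "cmod \<nu> = 1" "\<nu> * cnj p = p" using unimodular_reflection .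
  define s where "s = complex_of_real (sqrt (1 - (cmod p)\<^sup>2))"
  obtain C where C: "conjugation C"
    "\<And>v. cmod v < 1 \<Longrightarrow> C (kern v) = (s / (1 - cnj p * v)) *\<^sub>C kern (blaschke p (\<nu> * cnj v))"
    unfolding s_def using disk_conjugation[OF p \<nu>] by blast
  \<comment> \<open>The operator splits as \<open>1\<close> on the constants plus a multiple of the adjoint of an affine
    composition operator on \<open>z H\<^sup>2\<close>, so the conjugation is that of the affine case on \<open>z H\<^sup>2\<close>.\<close>
  define C' where "C' f = cnj (coef f 0) *\<^sub>C zpow 0 + shift (C (backshift f))" for f
  have c0: "coef (C' f) 0 = cnj (coef f 0)" and bs: "backshift (C' f) = C (backshift f)" for f
    by (auto simp: C'_def intro: ell2_eqI)
  have C': "conjugation C'"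
    unfolding conjugation_def
  proof (intro conjI allI)
    show "C' (x *\<^sub>C f + y *\<^sub>C g) = cnj x *\<^sub>C C' f + cnj y *\<^sub>C C' g" for x f y g
      by (rule ell2_eqI) (simp add: C'_def backshift_add backshift_scaleC shift_add shift_scaleC
          conjugation_add[OF C(1)] conjugation_scaleC[OF C(1)] algebra_simps split: nat.split)
    show "cinner (C' f) (C' g) = cinner g f" for f g
      unfolding cinner_split[of "C' f"] cinner_split[of g] bs c0
      by (simp add: conjugation_cinner[OF C(1)])
    show "C' (C' f) = f" for f
      unfolding C'_def[of "C' f"] bs c0 conjugation_involution[OF C(1)]
      by (simp add: shift_backshift[symmetric])
  qed
  have form: "cinner (T (kern v)) (C' (kern u)) =
      1 + cnj u * cnj v * a * (s / (1 - p * c - p * a * (cnj u + cnj v) + \<nu> * a * (cnj u * cnj v)))"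
    if u: "cmod u < 1" and v: "cmod v < 1" for u v
  proof -
    define w where "w = cnj (c + cnj v * a)"
    have w: "cmod w < 1"
      using kernel_parameter_bound[OF a nz, of "cnj v"] self \<phi> v
      unfolding w_def complex_mod_cnj by simp
    have Tk: "T (kern v) = zpow 0 + (cnj v * a) *\<^sub>C shift (kern w)"
    proof (rule ev_eqI)
      fix z :: complex assume z: "cmod z < 1"
      have n1: "1 - c * z \<noteq> 0" by (rule nz[OF z])
      have n2: "1 - cnj w * z \<noteq> 0" by (rule one_minus_cnj_mult_nonzero[OF w z])
      have "1 - cnj v * \<phi> z = (1 - cnj w * z) / (1 - c * z)"
        using n1 by (simp add: \<phi>[OF z] w_def field_simps)
      then have "ev (T (kern v)) z = (1 - c * z) / (1 - cnj w * z)"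
        using self[OF z] by (simp add: composes_withD[OF T(2) z] ev_kern v)
      also have "1 - c * z = (1 - cnj w * z) + cnj v * a * z"
        by (simp add: w_def algebra_simps)
      also have "\<dots> / (1 - cnj w * z) = 1 + cnj v * a * (z * (1 / (1 - cnj w * z)))"
        using n2 by (simp add: add_divide_distrib)
      finally show "ev (T (kern v)) z = ev (zpow 0 + (cnj v * a) *\<^sub>C shift (kern w)) z"
        using z by (simp add: ev_kern w)
    qed
    have "backshift (kern u) = cnj u *\<^sub>C kern u"
      by (rule ell2_eqI) (simp add: u)
    then have Ck: "C' (kern u) = zpow 0 + u *\<^sub>C shift (C (kern u))"
      by (simp add: C'_def u conjugation_scaleC[OF C(1)] shift_scaleC)
    have "cinner (zpow 0) (shift f) = 0" for f
      by (subst cinner_commute) simp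
    then have 1: "cinner (T (kern v)) (C' (kern u)) = 1 + cnj v * a * (cnj u * cinner (kern w) (C (kern u)))"
      unfolding Tk Ck by (simp add: cinner_add_left cinner_add_right)
    let ?x = "blaschke p (\<nu> * cnj u)"
    have x: "cmod ?x < 1" using u \<nu> by (intro cmod_blaschke_less_1 p) (simp add: norm_mult)
    have "1 - p * cnj u \<noteq> 0" using one_minus_mult_nonzero[of p "cnj u"] p u by simp
    moreover have "?x = (p - \<nu> * cnj u) / (1 - p * cnj u)"
    proof -
      have "cnj p * (\<nu> * cnj u) = p * cnj u" using \<nu>(2) by (metis mult.assoc mult.commute)
      then show ?thesis by (simp add: blaschke_def)
    qed
    ultimately have "(1 - p * cnj u) * ?x = p - \<nu> * cnj u" by simp
    moreover have "\<nu> * c = p * (1 - a)" unfolding c using \<nu>(2) by (metis mult.assoc)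
    ultimately have e: "(1 - p * cnj u) * (1 - (c + cnj v * a) * ?x) =
        1 - p * c - p * a * (cnj u + cnj v) + \<nu> * a * (cnj u * cnj v)"
      by algebra
    have "cinner (kern w) (C (kern u)) = cnj (s / (1 - cnj p * u)) * ev (kern w) ?x"
      by (simp add: C u cinner_kern x)
    also have "\<dots> = s / ((1 - p * cnj u) * (1 - (c + cnj v * a) * ?x))"
      by (simp add: ev_kern w x s_def) (simp add: w_def)
    finally show ?thesis unfolding 1 e by (simp add: mult_ac)
  qed
  have "cinner (T f) (C' h) = cinner (T h) (C' f)" for f h
    by (rule symmetric_if_symmetric_on_kernels[OF T(1) C'])
      (simp add: form add.commute mult.commute)
  from complex_symmetric_onI[OF T self C' this] show ?thesis .
qed

subsection \<open>Involutive operators\<close>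

text \<open>
  The partial isometry in the polar decomposition of an involution \<open>T\<close> is the sign of the
  self-adjoint operator \<open>X = T + T\<^sup>*\<close>, because \<open>X T = T\<^sup>* X\<close> and \<open>X\<^sup>2 \<ge> 2\<close>. The square root of
  \<open>X\<^sup>2 / c\<^sup>2\<close> is \<open>1 - E\<close> with \<open>E = (Y + E\<^sup>2) / 2\<close> and \<open>Y = 1 - X\<^sup>2 / c\<^sup>2\<close>, a fixed point of
  a contraction; so is its inverse \<open>G = 1 + E G\<close>.
\<close>

lemma involution_intertwined_with_adjoint:
  fixes T Ts :: "'a :: {real_inner, banach} \<Rightarrow>\<^sub>L 'a"
  assumes adj: "\<And>f g. inner (T f) g = inner f (Ts g)" and inv: "\<And>f. T (T f) = f"
  obtains U :: "'a \<Rightarrow>\<^sub>L 'a" where "\<And>f. U (U f) = f" "\<And>f g. inner (U f) g = inner f (U g)"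
    "\<And>f. U (T f) = Ts (U f)"
    "\<And>S f. bounded_linear S \<Longrightarrow> (\<And>f. S (T f) = T (S f)) \<Longrightarrow> (\<And>f. S (Ts f) = Ts (S f)) \<Longrightarrow> S (U f) = U (S f)"
proof -
  have adj': "inner (Ts f) g = inner f (T g)" for f g
    using adj[of g f] by (simp add: inner_commute)
  have ext: "f = g" if "\<And>h :: 'a. inner f h = inner g h" for f g
    using that[of "f - g"] by (metis inner_diff_left inner_eq_zero_iff right_minus_eq)
  have invs: "Ts (Ts f) = f" for f
    by (rule ext) (simp add: adj' inv)
  define X where "X = T + Ts"
  have X: "X f = T f + Ts f" for f by (simp add: X_def plus_blinfun.rep_eq)
  have X_adj: "inner (X f) g = inner f (X g)" for f g
    by (simp add: X inner_add_left inner_add_right adj adj')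
  have XT: "X (T f) = Ts (X f)" for f
    by (simp add: X inv invs blinfun.add_right add.commute)
  have TX: "T (X f) = X (Ts f)" for f
    by (simp add: X inv invs blinfun.add_right add.commute)
  \<comment> \<open>The norm of \<open>X\<close> keeps \<open>X\<^sup>2 / c\<^sup>2\<close> at norm
    at most one; the added \<open>2\<close> gives \<open>c \<ge> 2\<close>, so that the number under
    the root in \<open>\<rho>\<close> is positive.\<close>
  define c where "c = norm X + 2"
  have c: "c \<ge> 2" by (simp add: c_def)
  have Xc: "norm (X f) \<le> c * norm f" for f
    using norm_blinfun[of X f] norm_ge_zero[of f] unfolding c_def distrib_right by linarith
  define Y where "Y = id_blinfun - (1 / c\<^sup>2) *\<^sub>R (X o\<^sub>L X)"
  have Y: "Y f = f - (1 / c\<^sup>2) *\<^sub>R X (X f)" for f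
    by (simp add: Y_def minus_blinfun.rep_eq scaleR_blinfun.rep_eq)
  define \<rho> where "\<rho> = sqrt (1 - 2 / c\<^sup>2)"
  have c2: "c\<^sup>2 \<ge> 4" using c power_mono[of 2 c 2] by simp
  have "2 / c\<^sup>2 \<le> 1" "2 / c\<^sup>2 > 0" using c c2 by (simp_all add: divide_le_eq)
  then have \<rho>: "0 \<le> \<rho>" "\<rho> < 1" "\<rho>\<^sup>2 = 1 - 2 / c\<^sup>2" by (simp_all add: \<rho>_def)
  \<comment> \<open>Both \<open>T\<close> and \<open>Ts\<close> are involutions, so
    \<open>X\<^sup>2 = 2 + T Ts + Ts T\<close>. This lower bound is what keeps the norm of
    \<open>Y\<close> strictly below one.\<close>
  have X2: "2 * (norm f)\<^sup>2 \<le> (norm (X f))\<^sup>2" for f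
  proof -
    have "(norm (X f))\<^sup>2 = (norm (T f))\<^sup>2 + (norm (Ts f))\<^sup>2 + 2 * (norm f)\<^sup>2"
      unfolding power2_norm_eq_inner X
      by (simp add: inner_add_left inner_add_right adj adj' inv invs inner_commute)
    then show ?thesis by simp
  qed
  have nY: "norm Y \<le> \<rho>"
  proof (rule norm_blinfun_bound[OF \<rho>(1)])
    fix f
    have "(norm (Y f))\<^sup>2 = (norm f)\<^sup>2 - 2 / c\<^sup>2 * (norm (X f))\<^sup>2 + (norm (X (X f)))\<^sup>2 / (c\<^sup>2 * c\<^sup>2)"
      unfolding power2_norm_eq_inner Y
      by (simp add: inner_diff_left inner_diff_right X_adj inner_commute)
    also have "(norm (X (X f)))\<^sup>2 \<le> (c * norm (X f))\<^sup>2" by (intro power_mono Xc) auto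
    then have "(norm (X (X f)))\<^sup>2 / (c\<^sup>2 * c\<^sup>2) \<le> (c * norm (X f))\<^sup>2 / (c\<^sup>2 * c\<^sup>2)"
      by (intro divide_right_mono) auto
    also have "\<dots> = (norm (X f))\<^sup>2 / c\<^sup>2" using c unfolding power_mult_distrib by (subst mult_divide_mult_cancel_left) simp_all
    finally have "(norm (Y f))\<^sup>2 \<le> (norm f)\<^sup>2 - 1 / c\<^sup>2 * (norm (X f))\<^sup>2" by simp
    also have "\<dots> \<le> (norm f)\<^sup>2 - 1 / c\<^sup>2 * (2 * (norm f)\<^sup>2)"
      by (intro diff_left_mono mult_left_mono X2) auto
    also have "\<dots> = (\<rho> * norm f)\<^sup>2" unfolding power_mult_distrib \<rho>(3) by (simp add: algebra_simps)
    finally show "norm (Y f) \<le> \<rho> * norm f"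
      by (rule power2_le_imp_le) (use \<rho> in simp)
  qed
  \<comment> \<open>The fixed points are sought among the self-adjoint operators that commute with
    everything bounded commuting with \<open>X\<^sup>2\<close>. This set is closed and stable under
    the iterations, so self-adjointness and commutation pass to the limits.\<close>
  define commutant where
    "commutant = {S :: 'a \<Rightarrow> 'a. bounded_linear S \<and> (\<forall>f. S (X (X f)) = X (X (S f)))}"
  define \<S> where "\<S> = {E :: 'a \<Rightarrow>\<^sub>L 'a. (\<forall>f g. inner (E f) g = inner f (E g)) \<and>
      (\<forall>S\<in>commutant. \<forall>f. S (E f) = E (S f))}"
  have SA: "inner (E f) g = inner f (E g)" if "E \<in> \<S>" for E f g using that by (simp add: \<S>_def)
  have SC: "S (E f) = E (S f)" if "E \<in> \<S>" "S \<in> commutant" for E S f using that by (simp add: \<S>_def)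
  have Scomm: "blinfun_apply E \<in> commutant" if "E \<in> \<S>" for E
  proof -
    have "(\<lambda>f. X (X f)) \<in> commutant"
      unfolding commutant_def by (simp add: bounded_linear_compose blinfun.bounded_linear_right)
    then show ?thesis using SC[OF that] by (auto simp: commutant_def blinfun.bounded_linear_right)
  qed
  have S_lin: "bounded_linear S" if "S \<in> commutant" for S using that by (simp add: commutant_def)
  note S_rules = linear_diff[OF bounded_linear.linear[OF S_lin]] linear_add[OF bounded_linear.linear[OF S_lin]]
    linear_scale[OF bounded_linear.linear[OF S_lin]]
  have S_id: "id_blinfun \<in> \<S>" by (simp add: \<S>_def)
  have S_Y: "Y \<in> \<S>"
    unfolding \<S>_def by (auto simp: Y S_rules inner_diff_left inner_diff_right X_adj)
      (simp add: commutant_def)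
  have S_add: "E + F \<in> \<S>" if "E \<in> \<S>" "F \<in> \<S>" for E F
    using that unfolding \<S>_def by (auto simp: plus_blinfun.rep_eq S_rules inner_add_left inner_add_right)
  have S_scale: "r *\<^sub>R E \<in> \<S>" if "E \<in> \<S>" for r E
    using that unfolding \<S>_def by (auto simp: scaleR_blinfun.rep_eq S_rules)
  have S_comp: "E o\<^sub>L F \<in> \<S>" if "E \<in> \<S>" "F \<in> \<S>" for E F
    using SC[OF that(2) Scomm[OF that(1)]] that unfolding \<S>_def by simp
  have S_closed: "closed \<S>"
    unfolding closed_sequential_limits
  proof (intro allI impI, elim conjE)
    fix E :: "nat \<Rightarrow> 'a \<Rightarrow>\<^sub>L 'a" and E'
    assume E: "\<forall>n. E n \<in> \<S>" and lim: "E \<longlonglongrightarrow> E'"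
    have lim': "(\<lambda>n. E n f) \<longlonglongrightarrow> E' f" for f
      by (intro blinfun.tendsto lim tendsto_const)
    have "inner (E' f) g = inner f (E' g)" for f g
    proof (rule LIMSEQ_unique)
      show "(\<lambda>n. inner (E n f) g) \<longlonglongrightarrow> inner (E' f) g" by (intro tendsto_intros lim')
      show "(\<lambda>n. inner (E n f) g) \<longlonglongrightarrow> inner f (E' g)"
        using E by (simp add: SA tendsto_intros lim')
    qed
    moreover have "S (E' f) = E' (S f)" if "S \<in> commutant" for S f
    proof (rule LIMSEQ_unique)
      show "(\<lambda>n. S (E n f)) \<longlonglongrightarrow> S (E' f)" by (intro bounded_linear.tendsto[OF S_lin[OF that]] lim')
      show "(\<lambda>n. S (E n f)) \<longlonglongrightarrow> E' (S f)" using E that by (simp add: SC lim')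
    qed
    ultimately show "E' \<in> \<S>" by (simp add: \<S>_def)
  qed
  \<comment> \<open>The smaller root of \<open>b = (\<rho> + b\<^sup>2) / 2\<close>: the ball of
    this radius is mapped into itself, and \<open>b < 1\<close> is a Lipschitz constant on
    it.\<close>
  define b where "b = 1 - sqrt (1 - \<rho>)"
  have b: "0 \<le> b" "b < 1" using \<rho> by (auto simp: b_def)
  have b2: "(\<rho> + b * b) / 2 = b"
  proof -
    have "sqrt (1 - \<rho>) * sqrt (1 - \<rho>) = 1 - \<rho>"
      unfolding real_sqrt_mult_self using \<rho> by simp
    then have "\<rho> + b * b = 2 * b" unfolding b_def by (simp add: algebra_simps)
    then show ?thesis by simp
  qed
  have "\<exists>!E\<in>\<S> \<inter> cball 0 b. (1/2) *\<^sub>R (Y + (E o\<^sub>L E)) = E"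
  proof (rule Banach_fix[OF _ _ b])
    show "complete (\<S> \<inter> cball 0 b)"
      unfolding complete_eq_closed by (intro closed_Int S_closed closed_cball)
    have "0 \<in> \<S>" using S_scale[OF S_id, of 0] by simp
    then show "\<S> \<inter> cball 0 b \<noteq> {}" using b by auto
    show "(\<lambda>E. (1/2) *\<^sub>R (Y + (E o\<^sub>L E))) ` (\<S> \<inter> cball 0 b) \<subseteq> \<S> \<inter> cball 0 b"
    proof (intro image_subsetI IntI)
      fix E assume E: "E \<in> \<S> \<inter> cball 0 b"
      then show "(1/2) *\<^sub>R (Y + (E o\<^sub>L E)) \<in> \<S>" by (intro S_scale S_add S_Y S_comp) auto
      have "norm (Y + (E o\<^sub>L E)) \<le> \<rho> + b * b"
        by (intro norm_triangle_le add_mono nY order_trans[OF norm_blinfun_compose] mult_mono)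
          (use E b in auto)
      then show "(1/2) *\<^sub>R (Y + (E o\<^sub>L E)) \<in> cball 0 b" using b2 by simp
    qed
    fix E F assume EF: "E \<in> \<S> \<inter> cball 0 b" "F \<in> \<S> \<inter> cball 0 b"
    have "(E o\<^sub>L E) - (F o\<^sub>L F) = (E o\<^sub>L (E - F)) + ((E - F) o\<^sub>L F)"
      by (rule blinfun_eqI) (simp add: blinfun.diff_left blinfun.diff_right blinfun.add_left)
    then have "norm ((E o\<^sub>L E) - (F o\<^sub>L F)) \<le> norm E * norm (E - F) + norm (E - F) * norm F"
      by (simp add: norm_triangle_le add_mono norm_blinfun_compose)
    also have "\<dots> \<le> b * norm (E - F) + norm (E - F) * b"
      using EF by (intro add_mono mult_left_mono mult_right_mono) auto
    finally show "dist ((1/2) *\<^sub>R (Y + (E o\<^sub>L E))) ((1/2) *\<^sub>R (Y + (F o\<^sub>L F))) \<le> b * dist E F"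
      by (simp add: dist_norm scaleR_diff_right[symmetric])
  qed
  then obtain E where E: "E \<in> \<S>" "norm E \<le> b" "(1/2) *\<^sub>R (Y + (E o\<^sub>L E)) = E" by auto
  have "\<exists>!G\<in>\<S>. id_blinfun + (E o\<^sub>L G) = G"
  proof (rule Banach_fix[OF _ _ b])
    show "complete \<S>" unfolding complete_eq_closed by (rule S_closed)
    show "\<S> \<noteq> {}" using S_id by blast
    show "(\<lambda>G. id_blinfun + (E o\<^sub>L G)) ` \<S> \<subseteq> \<S>" using S_id S_add S_comp E(1) by blast
    fix F G :: "'a \<Rightarrow>\<^sub>L 'a"
    have "(E o\<^sub>L F) - (E o\<^sub>L G) = E o\<^sub>L (F - G)"
      by (rule blinfun_eqI) (simp add: blinfun.diff_left blinfun.diff_right)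
    then have "norm ((E o\<^sub>L F) - (E o\<^sub>L G)) \<le> b * norm (F - G)"
      using norm_blinfun_compose[of E "F - G"] mult_right_mono[OF E(2), of "norm (F - G)"] by simp
    then show "dist (id_blinfun + (E o\<^sub>L F)) (id_blinfun + (E o\<^sub>L G)) \<le> b * dist F G"
      by (simp add: dist_norm)
  qed
  then obtain G where G: "G \<in> \<S>" "id_blinfun + (E o\<^sub>L G) = G" by blast
  have EE: "E (E f) = 2 *\<^sub>R E f - Y f" for f
  proof -
    have "2 *\<^sub>R E f = 2 *\<^sub>R ((1/2) *\<^sub>R (Y + (E o\<^sub>L E))) f" by (simp add: E(3))
    then show ?thesis by (simp add: scaleR_blinfun.rep_eq plus_blinfun.rep_eq)
  qed
  have EG: "E (G f) = G f - f" for f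
  proof -
    have "G f = (id_blinfun + (E o\<^sub>L G)) f" by (simp add: G(2))
    then have "G f = f + E (G f)" by (simp add: plus_blinfun.rep_eq)
    then show ?thesis by (metis add_diff_cancel_left')
  qed
  have GE: "G (E f) = G f - f" for f
    using SC[OF G(1) Scomm[OF E(1)], of f] EG by simp
  have YG: "Y (G (G f)) = G (G f) - f" for f
  proof -
    have "E (E (G (G f))) = (G (G f) - G f) - (G f - f)"
      by (simp only: EG blinfun.diff_right)
    moreover have "E (E (G (G f))) = 2 *\<^sub>R (G (G f) - G f) - Y (G (G f))"
      using EE[of "G (G f)"] EG[of "G f"] by simp
    ultimately show ?thesis by (simp add: algebra_simps scaleR_2)
  qed
  \<comment> \<open>The square of \<open>1 - E\<close> is \<open>X\<^sup>2 / c\<^sup>2\<close>, so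
    its inverse \<open>G\<close> satisfies \<open>X\<^sup>2 G\<^sup>2 = c\<^sup>2\<close>; this
    makes \<open>X G / c\<close> an involution, the sign of \<open>X\<close>.\<close>
  have XXGG: "X (X (G (G f))) = c\<^sup>2 *\<^sub>R f" for f
  proof -
    have "(1 / c\<^sup>2) *\<^sub>R X (X (G (G f))) = f" using YG[of f] Y[of "G (G f)"] by simp
    then have "c\<^sup>2 *\<^sub>R (1 / c\<^sup>2) *\<^sub>R X (X (G (G f))) = c\<^sup>2 *\<^sub>R f" by simp
    then show ?thesis using c by simp
  qed
  have Xc: "blinfun_apply X \<in> commutant"
    by (simp add: commutant_def blinfun.bounded_linear_right)
  have comm: "S \<in> commutant"
    if "bounded_linear S" "\<And>f. S (T f) = T (S f)" "\<And>f. S (Ts f) = Ts (S f)" for S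
    using that linear_add[OF bounded_linear.linear[OF that(1)]] by (simp add: commutant_def X)
  \<comment> \<open>From \<open>T X = X Ts\<close> and \<open>X T = Ts X\<close> it follows that
    \<open>T\<close> commutes with \<open>X\<^sup>2\<close>, though not necessarily with
    \<open>X\<close>.\<close>
  have Tc: "blinfun_apply T \<in> commutant"
    by (simp add: commutant_def blinfun.bounded_linear_right TX XT[symmetric])
  define U where "U = (1 / c) *\<^sub>R (X o\<^sub>L G)"
  have U: "U f = (1 / c) *\<^sub>R X (G f)" for f by (simp add: U_def scaleR_blinfun.rep_eq)
  have XG: "X (G f) = G (X f)" for f by (rule SC[OF G(1) Xc])
  show thesis
  proof
    show "U (U f) = f" for f
    proof -
      have "U (U f) = (1 / c\<^sup>2) *\<^sub>R X (X (G (G f)))"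
        by (simp add: U blinfun.scaleR_right XG power2_eq_square)
      then show ?thesis using c by (simp add: XXGG)
    qed
    show "inner (U f) g = inner f (U g)" for f g
      by (simp add: U X_adj SA[OF G(1)]) (simp add: XG)
    show "U (T f) = Ts (U f)" for f
      by (simp add: U SC[OF G(1) Tc, symmetric] XT blinfun.scaleR_right)
    show "S (U f) = U (S f)"
      if "bounded_linear S" "\<And>f. S (T f) = T (S f)" "\<And>f. S (Ts f) = Ts (S f)" for S f
      using SC[OF G(1) comm[OF that], of f] linear_scale[OF bounded_linear.linear[OF that(1)]]
        linear_add[OF bounded_linear.linear[OF that(1)]] that
      by (simp add: U X blinfun.add_right)
  qed
qed

text \<open>The reflection \<open>J\<close> commutes with \<open>T\<close>, therefore with the
  adjoint, and therefore with the self-adjoint unitary \<open>U\<close>; so \<open>J U\<close> is a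
  conjugation. Since \<open>U\<close> intertwines \<open>T\<close> with its adjoint, the form built
  from \<open>J U\<close> is symmetric.\<close>

lemma complex_symmetric_involution:
  assumes hol: "\<phi> holomorphic_on ball 0 1" and self: "\<And>z. cmod z < 1 \<Longrightarrow> cmod (\<phi> z) < 1"
    and inv: "\<And>z. cmod z < 1 \<Longrightarrow> \<phi> (\<phi> z) = z"
    and \<nu>: "cmod \<nu> = 1" and refl: "\<And>z. cmod z < 1 \<Longrightarrow> \<phi> (\<nu> * cnj z) = \<nu> * cnj (\<phi> z)"
  shows "complex_symmetric_on hardy_space hardy_inner (composition_operator \<phi>)"
proof -
  obtain T where T: "bounded_clinear T" "composes_with T \<phi>"
    using bounded_composition_operator[OF hol self] by blast
  note evT = composes_withD[OF T(2)]
  obtain Ts where Ts: "bounded_clinear Ts" "\<And>f g. cinner (T f) g = cinner f (Ts g)"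
    using adjoint_exists[OF T(1)] by blast
  have Ts': "cinner (Ts f) g = cinner f (T g)" for f g
    by (metis Ts(2) cinner_commute)
  have TT: "T (T f) = f" for f
    by (rule ev_eqI) (simp add: evT self inv)
  define J where "J = reflect \<nu>"
  have J: "conjugation J" unfolding J_def by (rule conjugation_reflect[OF \<nu>])
  have JT: "J (T f) = T (J f)" for f
    by (rule ev_eqI) (simp add: J_def ev_reflect[OF \<nu>] evT self norm_mult \<nu> refl)
  have Jswap: "cinner f (J g) = cinner g (J f)" for f g
    by (metis J cinner_commute conjugation_cinner_swap)
  have JTs: "J (Ts f) = Ts (J f)" for f
    by (rule cinner_ext) (metis JT Jswap Ts(2) Ts')
  have bl: "bounded_linear J"
    by (rule bounded_linear_intro[of J 1])
      (simp_all add: conjugation_add[OF J] scaleR_scaleC conjugation_scaleC[OF J] conjugation_norm[OF J])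
  have bi: "bounded_linear (\<lambda>f. \<i> *\<^sub>C f)"
    by (rule bounded_linear_intro[of _ 1]) (simp_all add: scaleC_add_right scaleR_scaleC mult.commute)
  note blT = bounded_linear_Blinfun_apply[OF bounded_clinear_imp_bounded_linear[OF T(1)]]
    bounded_linear_Blinfun_apply[OF bounded_clinear_imp_bounded_linear[OF Ts(1)]]
  obtain V :: "ell2 \<Rightarrow>\<^sub>L ell2" where V: "\<And>f. V (V f) = f" "\<And>f g. inner (V f) g = inner f (V g)"
    "\<And>f. V (Blinfun T f) = Blinfun Ts (V f)"
    "\<And>S f. bounded_linear S \<Longrightarrow> (\<And>f. S (Blinfun T f) = Blinfun T (S f)) \<Longrightarrow>
       (\<And>f. S (Blinfun Ts f) = Blinfun Ts (S f)) \<Longrightarrow> S (V f) = V (S f)"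
    using involution_intertwined_with_adjoint[of "Blinfun T" "Blinfun Ts"]
    unfolding blT by (auto simp: TT inner_eq_Re_cinner Ts(2))
  define U where "U = blinfun_apply V"
  have U: "U (U f) = f" "U (T f) = Ts (U f)" "U (f + g) = U f + U g" "U (r *\<^sub>R f) = r *\<^sub>R U f" for f g r
    using V(1) V(3)[unfolded blT] by (simp_all add: U_def blinfun.add_right blinfun.scaleR_right)
  have UJ: "J (U f) = U (J f)" for f
    unfolding U_def by (rule V(4)[unfolded blT]) (rule bl JT JTs)+
  \<comment> \<open>\<open>U\<close> was obtained as a real-linear operator; commuting with
    multiplication by \<open>\<i>\<close> makes it complex linear.\<close>
  have Ui: "\<i> *\<^sub>C U f = U (\<i> *\<^sub>C f)" for f
    unfolding U_def
    by (rule V(4)[unfolded blT]) (simp_all add: bi bounded_clinear_scaleC[OF T(1)] bounded_clinear_scaleC[OF Ts(1)])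
  have Uc: "U (c *\<^sub>C f) = c *\<^sub>C U f" for c f
  proof -
    have dec: "c *\<^sub>C g = Re c *\<^sub>R g + Im c *\<^sub>R (\<i> *\<^sub>C g)" for g
      by (rule ell2_eqI) (simp add: complex_eq_iff)
    show ?thesis unfolding dec U(3,4) Ui ..
  qed
  have Usa: "cinner (U f) g = cinner f (U g)" for f g
  proof (rule complex_eqI)
    have re: "Re (cinner (U f) g) = Re (cinner f (U g))" for f g
      using V(2) by (simp add: U_def inner_eq_Re_cinner)
    then show "Re (cinner (U f) g) = Re (cinner f (U g))" .
    show "Im (cinner (U f) g) = Im (cinner f (U g))"
      using re[of f "\<i> *\<^sub>C g"] by (simp add: Ui[symmetric])
  qed
  have C: "conjugation (\<lambda>f. J (U f))"
    unfolding conjugation_def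
    by (simp add: U Uc conjugation_add[OF J] conjugation_scaleC[OF J] conjugation_cinner[OF J]
        Usa UJ[symmetric] conjugation_involution[OF J])
  have "cinner (T f) (J (U h)) = cinner (T h) (J (U f))" for f h
  proof -
    have "cinner (T f) (J (U h)) = cinner (U (T f)) (J h)" by (simp add: UJ Usa)
    also have "\<dots> = cinner (U f) (T (J h))" by (simp add: U(2) Ts')
    also have "\<dots> = cinner (T h) (J (U f))" by (simp add: JT[symmetric] Jswap)
    finally show ?thesis .
  qed
  from complex_symmetric_onI[OF T self C this] show ?thesis .
qed

text \<open>The Schwarz lemma, applied to \<open>blaschke a \<circ> \<phi>\<close> and to its
  inverse, shows that this map preserves moduli, so
  \<open>\<phi> z = blaschke a (\<eta> * z)\<close>. Being an involution other than the identity
  then forces \<open>\<eta> = 1\<close>.\<close>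

lemma involution_is_blaschke:
  assumes hol: "\<phi> holomorphic_on ball 0 1" and self: "\<And>z. cmod z < 1 \<Longrightarrow> cmod (\<phi> z) < 1"
    and inv: "\<And>z. cmod z < 1 \<Longrightarrow> \<phi> (\<phi> z) = z" and nid: "\<not> (\<forall>z. cmod z < 1 \<longrightarrow> \<phi> z = z)"
  obtains a where "cmod a < 1" "\<And>z. cmod z < 1 \<Longrightarrow> \<phi> z = blaschke a z"
proof -
  define a where "a = \<phi> 0"
  have a: "cmod a < 1" using self[of 0] by (simp add: a_def)
  have h1: "(\<lambda>z. blaschke a (\<phi> z)) holomorphic_on ball 0 1"
    using self by (intro holomorphic_on_compose_gen[OF hol blaschke_holomorphic[OF a], unfolded o_def]) auto
  have h2: "(\<lambda>z. \<phi> (blaschke a z)) holomorphic_on ball 0 1"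
    using cmod_blaschke_less_1[OF a]
    by (intro holomorphic_on_compose_gen[OF blaschke_holomorphic[OF a] hol, unfolded o_def]) auto
  have 01: "blaschke a (\<phi> 0) = 0" by (simp add: a_def)
  have 02: "\<phi> (blaschke a 0) = 0" using inv[of 0] by (simp add: a_def)
  have n1: "cmod (blaschke a (\<phi> z)) < 1" and n2: "cmod (\<phi> (blaschke a z)) < 1" if "cmod z < 1" for z
    by (intro cmod_blaschke_less_1 a self that)+
  have S1: "cmod (blaschke a (\<phi> z)) \<le> cmod z" if "cmod z < 1" for z
    by (rule Schwarz_Lemma(1)[OF h1 01 n1 that])
  have S2: "cmod (\<phi> (blaschke a z)) \<le> cmod z" if "cmod z < 1" for z
    by (rule Schwarz_Lemma(1)[OF h2 02 n2 that])
  have "cmod (blaschke a (\<phi> z)) = cmod z" if z: "cmod z < 1" for z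
  proof (rule antisym[OF S1[OF z]])
    show "cmod z \<le> cmod (blaschke a (\<phi> z))"
      using S2[OF n1[OF z]] blaschke_blaschke[OF a self[OF z]] inv[OF z] by simp
  qed
  from this[of "1/2"] have "cmod (1/2 :: complex) < 1 \<and> (1/2 :: complex) \<noteq> 0 \<and>
      cmod (blaschke a (\<phi> (1/2))) = cmod (1/2 :: complex)"
    by (simp add: norm_divide)
  then have ex: "\<exists>z. cmod z < 1 \<and> z \<noteq> 0 \<and> cmod (blaschke a (\<phi> z)) = cmod z" by blast
  obtain \<eta> where \<eta>: "\<And>z. cmod z < 1 \<Longrightarrow> blaschke a (\<phi> z) = \<eta> * z" "cmod \<eta> = 1"
    using Schwarz_Lemma(3)[OF h1 01 n1 _ disjI1[OF ex], of 0] by auto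
  have \<phi>: "\<phi> z = blaschke a (\<eta> * z)" if "cmod z < 1" for z
    using \<eta>(1)[OF that] blaschke_blaschke[OF a self[OF that]] by simp
  \<comment> \<open>Evaluation at \<open>a\<close>, where
    \<open>\<phi> a = \<phi> (\<phi> 0) = 0\<close>.\<close>
  have "\<eta> * a = a"
    using \<eta>(1)[of a] inv[of 0] a by (simp add: a_def)
  then consider "\<eta> = 1" | "a = 0" by auto
  then show thesis
  proof cases
    case 1
    then show thesis using that[OF a] \<phi> by simp
  next
    case 2
    then have p: "\<phi> z = - (\<eta> * z)" if "cmod z < 1" for z
      using \<phi>[OF that] by (simp add: blaschke_def)
    have "\<phi> (\<phi> (1/2)) = \<eta>\<^sup>2 / 2"
      using p[of "1/2"] p[of "\<phi> (1/2)"] self[of "1/2"] by (simp add: norm_divide power2_eq_square)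
    then have "\<eta>\<^sup>2 = 1" using inv[of "1/2"] by (simp add: norm_divide)
    moreover have "\<eta> \<noteq> -1" using nid p by auto
    ultimately have "\<eta> = 1" by (simp add: power2_eq_1_iff)
    then show thesis using that[OF a] \<phi> by simp
  qed
qed

subsection \<open>Derivative kernels\<close>

text \<open>Representing vector of the derivative at \<open>w\<close>. The truncated exponent at
  \<open>n = 0\<close> is harmless because its factor is zero.\<close>

definition dkern :: "complex \<Rightarrow> ell2" where
  "dkern w = Abs_ell2 (\<lambda>n. of_nat n * cnj w ^ (n - 1))"

text \<open>Representing vector of half the second derivative at \<open>w\<close>, the second Taylor
  coefficient there. The binomial coefficient vanishes wherever the exponent is truncated.\<close>

definition ddkern :: "complex \<Rightarrow> ell2" where
  "ddkern w = Abs_ell2 (\<lambda>n. of_nat (n choose 2) * cnj w ^ (n - 2))"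

lemma derivative_kernels:
  assumes w: "cmod w < 1"
  shows coef_dkern: "coef (dkern w) n = of_nat n * cnj w ^ (n - 1)"
    and coef_ddkern: "coef (ddkern w) n = of_nat (n choose 2) * cnj w ^ (n - 2)"
    and ev_dkern: "cmod z < 1 \<Longrightarrow> ev (dkern w) z = z / (1 - cnj w * z)\<^sup>2"
    and ev_ddkern: "cmod z < 1 \<Longrightarrow> ev (ddkern w) z = z\<^sup>2 / (1 - cnj w * z) ^ 3"
proof -
  obtain N where N: "bounded_clinear N" "\<And>f z. cmod z < 1 \<Longrightarrow> ev (N f) z = ev f z / (1 - cnj w * z)"
    using multiplication_by_inverse_linear[OF w] by blast
  have rec: "N f = f + cnj w *\<^sub>C shift (N f)" for f
  proof (rule ev_eqI)
    fix z :: complex assume z: "cmod z < 1"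
    define q where "q = ev f z / (1 - cnj w * z)"
    have "q * (1 - cnj w * z) = ev f z"
      using one_minus_cnj_mult_nonzero[OF w z] by (simp add: q_def)
    then have "q = ev f z + cnj w * (z * q)"
      by (simp add: algebra_simps)
    moreover have "ev (N f) z = q" "ev (f + cnj w *\<^sub>C shift (N f)) z = ev f z + cnj w * (z * q)"
      using z by (simp_all add: N q_def)
    ultimately show "ev (N f) z = ev (f + cnj w *\<^sub>C shift (N f)) z" by metis
  qed
  define d where "d = shift (N (kern w))"
  define dd where "dd = shift (N d)"
  have d0: "coef d 0 = 0" and dN: "coef d (Suc n) = coef (N (kern w)) n" for n
    by (simp_all add: d_def)
  have dS: "coef d (Suc n) = cnj w ^ n + cnj w * coef d n" for n
    unfolding dN using arg_cong[OF rec[of "kern w"], of "\<lambda>f. coef f n"] w by (simp add: d_def)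
  have d: "coef d n = of_nat n * cnj w ^ (n - 1)" for n
  proof (induction n)
    case (Suc n)
    then show ?case unfolding dS by (cases n) (simp_all add: algebra_simps)
  qed (simp add: d0)
  have dd0: "coef dd 0 = 0" and ddN: "coef dd (Suc n) = coef (N d) n" for n
    by (simp_all add: dd_def)
  have ddS: "coef dd (Suc n) = coef d n + cnj w * coef dd n" for n
    unfolding ddN using arg_cong[OF rec[of d], of "\<lambda>f. coef f n"] by (simp add: dd_def)
  have dd: "coef dd n = of_nat (n choose 2) * cnj w ^ (n - 2)" for n
  proof (induction n)
    case (Suc n)
    have "Suc n choose 2 = n + (n choose 2)" by (simp add: numeral_2_eq_2)
    moreover have "cnj w * (of_nat (n choose 2) * cnj w ^ (n - 2)) = of_nat (n choose 2) * cnj w ^ (n - 1)"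
    proof (cases "n \<ge> 2")
      case True
      then have "n - 1 = Suc (n - 2)" by simp
      then show ?thesis by simp
    qed (simp add: binomial_eq_0)
    ultimately show ?case
      unfolding ddS Suc.IH d by (simp add: algebra_simps)
  qed (simp add: dd0)
  \<comment> \<open>Both sequences already occur as the coefficients of elements of
    \<open>ell2\<close>, which replaces an estimate of square-summability.\<close>
  have "dkern w = Abs_ell2 (coef d)" "ddkern w = Abs_ell2 (coef dd)"
    unfolding dkern_def ddkern_def by (auto simp: d dd intro!: arg_cong[of _ _ Abs_ell2])
  then have eq: "dkern w = d" "ddkern w = dd" by (simp_all add: coef_inverse)
  show "coef (dkern w) n = of_nat n * cnj w ^ (n - 1)"
    "coef (ddkern w) n = of_nat (n choose 2) * cnj w ^ (n - 2)" unfolding eq by (rule d dd)+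
  show "ev (dkern w) z = z / (1 - cnj w * z)\<^sup>2" if "cmod z < 1"
    unfolding eq d_def using that w by (simp add: N ev_kern power2_eq_square)
  then show "ev (ddkern w) z = z\<^sup>2 / (1 - cnj w * z) ^ 3" if "cmod z < 1"
    using that unfolding eq dd_def by (simp add: N power2_eq_square power3_eq_cube)
qed

lemma cinner_dkern:
  assumes w: "cmod w < 1"
  shows "cinner f (dkern w) = deriv (ev f) w"
    and "cinner f (ddkern w) = deriv (deriv (ev f)) w / 2"
proof -
  have sm: "summable (\<lambda>n. coef f n * z ^ n)" if "cmod z < 1" for z
    using ev_sums[OF that, of f] by (rule sums_summable)
  have sm1: "summable (\<lambda>n. diffs (coef f) n * z ^ n)" if "cmod z < 1" for z
    by (rule termdiff_converges[OF that sm])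
  have D: "deriv (ev f) z = (\<Sum>n. diffs (coef f) n * z ^ n)" if "cmod z < 1" for z
    unfolding ev_def[abs_def] by (rule DERIV_imp_deriv) (rule termdiffs_strong'[OF sm that])
  have "\<forall>\<^sub>F z in nhds w. deriv (ev f) z = (\<Sum>n. diffs (coef f) n * z ^ n)"
    using eventually_nhds_in_open[of "ball 0 1" w] w D by (auto elim: eventually_mono)
  then have "deriv (deriv (ev f)) w = deriv (\<lambda>z. \<Sum>n. diffs (coef f) n * z ^ n) w"
    by (rule deriv_cong_ev) simp
  also have "\<dots> = (\<Sum>n. diffs (diffs (coef f)) n * w ^ n)"
    by (rule DERIV_imp_deriv) (rule termdiffs_strong'[OF sm1 w])
  finally have DD: "deriv (deriv (ev f)) w = (\<Sum>n. diffs (diffs (coef f)) n * w ^ n)" .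
  have sm2: "summable (\<lambda>n. diffs (diffs (coef f)) n * w ^ n)"
    by (rule termdiff_converges[OF w sm1])
  have "cinner f (dkern w) = (\<Sum>n. coef f (Suc n) * cnj (coef (dkern w) (Suc n)))"
    unfolding cinner_def using suminf_split_head[OF summable_cinner[of f "dkern w"]]
    by (simp add: coef_dkern[OF w])
  then show "cinner f (dkern w) = deriv (ev f) w"
    unfolding D[OF w] by (simp add: coef_dkern[OF w] diffs_def mult_ac)
  have c2: "of_nat (Suc (Suc n) choose 2) = (of_nat (Suc (Suc n)) * of_nat (Suc n) / 2 :: complex)" for n
  proof -
    have "2 * (Suc (Suc n) choose 2) = Suc (Suc n) * Suc n"
      using Suc_times_binomial_eq[of "Suc n" 1] by (simp add: numeral_2_eq_2)
    then have "2 * of_nat (Suc (Suc n) choose 2) = (of_nat (Suc (Suc n) * Suc n) :: complex)"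
      by (metis of_nat_mult of_nat_numeral)
    then have "of_nat (Suc (Suc n) choose 2) = (of_nat (Suc (Suc n) * Suc n) :: complex) / 2"
      by (metis nonzero_mult_div_cancel_left zero_neq_numeral)
    then show ?thesis by (simp only: of_nat_mult)
  qed
  have "cinner f (ddkern w) = (\<Sum>n. coef f (n + 2) * cnj (coef (ddkern w) (n + 2)))"
    unfolding cinner_def using suminf_split_initial_segment[OF summable_cinner[of f "ddkern w"], of 2]
    by (simp add: coef_ddkern[OF w] eval_nat_numeral)
  also have "\<dots> = (\<Sum>n. diffs (diffs (coef f)) n * w ^ n / 2)"
    by (intro suminf_cong) (simp add: coef_ddkern[OF w] c2 diffs_def mult_ac del: of_nat_Suc)
  also have "\<dots> = deriv (deriv (ev f)) w / 2"
    unfolding DD by (rule suminf_divide[OF sm2])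
  finally show "cinner f (ddkern w) = deriv (deriv (ev f)) w / 2" .
qed

subsection \<open>Eigenfunctions at an attracting fixed point\<close>

text \<open>With \<open>f z = g z * (z - p) ^ m\<close> near \<open>p\<close>, comparing
  \<open>f \<circ> \<phi>\<close> with \<open>f\<close> in the limit gives
  \<open>\<mu> ^ m = \<mu> ^ j\<close>, and 0 < |\<mu>| < 1 determines the order. The weight
  \<open>r\<close>, of value one at \<open>p\<close>, makes this applicable after denominators have
  been cleared.\<close>

lemma order_of_eigenfunction:
  fixes \<mu> :: complex
  assumes f: "f holomorphic_on ball 0 1" and \<phi>: "\<phi> holomorphic_on ball 0 1"
    and self: "\<And>z. cmod z < 1 \<Longrightarrow> cmod (\<phi> z) < 1"
    and p: "cmod p < 1" "\<phi> p = p" and \<mu>: "deriv \<phi> p = \<mu>" "\<mu> \<noteq> 0" "cmod \<mu> < 1"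
    and r: "isCont r p" "r p = 1"
    and eq: "\<And>z. cmod z < 1 \<Longrightarrow> f (\<phi> z) = \<mu> ^ j * r z * f z"
    and nz: "\<exists>z. cmod z < 1 \<and> f z \<noteq> 0"
  obtains g where "isCont g p" "g p \<noteq> 0" "\<forall>\<^sub>F z in nhds p. f z = g z * (z - p) ^ j"
proof -
  define n where "n = zorder f p"
  define g where "g = zor_poly f p"
  have "(if f p = 0 then n > 0 else n = 0) \<and> (\<exists>r. r > 0 \<and> cball p r \<subseteq> ball 0 1 \<and> g holomorphic_on cball p r
      \<and> (\<forall>w\<in>cball p r. f w = g w * (w - p) ^ nat n \<and> g w \<noteq> 0))"
    unfolding n_def g_def using p(1) nz
    by (intro zorder_exist_zero[OF f, unfolded Let_def]) auto
  then obtain R where R: "R > 0" "g holomorphic_on cball p R"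
    "\<And>w. w \<in> cball p R \<Longrightarrow> f w = g w * (w - p) ^ nat n" "\<And>w. w \<in> cball p R \<Longrightarrow> g w \<noteq> 0"
    by blast
  define m where "m = nat n"
  have gc: "isCont g p"
    using holomorphic_on_imp_continuous_on[OF R(2)] R(1)
    by (simp add: continuous_on_interior)
  have near: "\<forall>\<^sub>F z in nhds p. z \<in> ball p R \<and> cmod z < 1"
    using eventually_nhds_in_open[of "ball p R \<inter> ball 0 1" p] R(1) p by (auto elim: eventually_mono)
  have D: "(\<phi> has_field_derivative \<mu>) (at p)"
    using holomorphic_derivI[OF \<phi>, of p] p \<mu>(1) by simp
  then have \<phi>c: "isCont \<phi> p" by (rule DERIV_isCont)
  then have \<phi>p: "(\<phi> \<longlongrightarrow> p) (at p)" by (simp add: isCont_def p)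
  have quot: "((\<lambda>z. (\<phi> z - p) / (z - p)) \<longlongrightarrow> \<mu>) (at p)"
    using D p(2) by (simp add: has_field_derivative_iff)
  have 1: "((\<lambda>z. g (\<phi> z) * ((\<phi> z - p) / (z - p)) ^ m) \<longlongrightarrow> g p * \<mu> ^ m) (at p)"
  proof (intro tendsto_intros quot)
    show "((\<lambda>z. g (\<phi> z)) \<longlongrightarrow> g p) (at p)" by (rule isCont_tendsto_compose[OF gc \<phi>p])
  qed
  have 2: "((\<lambda>z. \<mu> ^ j * r z * g z) \<longlongrightarrow> \<mu> ^ j * 1 * g p) (at p)"
    using r gc by (intro tendsto_intros) (simp_all add: isCont_def)
  have "\<forall>\<^sub>F z in at p. \<phi> z \<in> ball p R"
    using \<phi>p R(1) by (auto dest: tendstoD[where e = R] simp: dist_commute)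
  moreover have "\<forall>\<^sub>F z in at p. (z \<in> ball p R \<and> cmod z < 1) \<and> z \<noteq> p"
    using near unfolding eventually_at_filter by (auto elim: eventually_mono)
  ultimately have "\<forall>\<^sub>F z in at p. g (\<phi> z) * ((\<phi> z - p) / (z - p)) ^ m = \<mu> ^ j * r z * g z"
  proof eventually_elim
    case (elim z)
    then have "g (\<phi> z) * (\<phi> z - p) ^ m = \<mu> ^ j * r z * (g z * (z - p) ^ m)"
      using eq[of z] R(3)[of z] R(3)[of "\<phi> z"] by (simp add: m_def)
    then show ?case using elim by (simp add: power_divide field_simps)
  qed
  from tendsto_unique[OF _ Lim_transform_eventually[OF 1 this] 2]
  have "g p * \<mu> ^ m = \<mu> ^ j * g p" by simp
  then have "\<mu> ^ m = \<mu> ^ j" using R by simp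
  then have "cmod \<mu> ^ m = cmod \<mu> ^ j" by (metis norm_power)
  then have "m = j" using \<mu> by (simp add: power_inject_exp')
  show thesis
  proof (rule that[OF gc])
    show "g p \<noteq> 0" using R by simp
    show "\<forall>\<^sub>F z in nhds p. f z = g z * (z - p) ^ j"
      using near by (rule eventually_mono) (use R(3) \<open>m = j\<close> m_def in auto)
  qed
qed

text \<open>Uniqueness up to a scalar: once the right multiple of \<open>(z - p) ^ j\<close> is
  subtracted, the remainder solves the same equation with a weight but vanishes to order above
  \<open>j\<close>, hence is zero. The conclusion is multiplied out because \<open>1 - t * z\<close>
  may still have a zero in the disk.\<close>

lemma koenigs_eigenfunction:
  fixes \<mu> :: complex
  assumes x: "x holomorphic_on ball 0 1" and \<phi>: "\<phi> holomorphic_on ball 0 1"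
    and self: "\<And>z. cmod z < 1 \<Longrightarrow> cmod (\<phi> z) < 1"
    and p: "cmod p < 1" "\<phi> p = p" and \<mu>: "deriv \<phi> p = \<mu>" "\<mu> \<noteq> 0" "cmod \<mu> < 1"
    and r: "isCont r p" "r p = 1"
    and B: "\<And>z. cmod z < 1 \<Longrightarrow> \<phi> z - p = \<mu> * r z * (z - p)"
    and A: "\<And>z. cmod z < 1 \<Longrightarrow> 1 - t * \<phi> z = r z * (1 - t * z)"
    and eq: "\<And>z. cmod z < 1 \<Longrightarrow> x (\<phi> z) = \<mu> ^ j * x z"
  shows "\<exists>c. \<forall>z. cmod z < 1 \<longrightarrow> x z * (1 - t * z) ^ j = c * (z - p) ^ j"
proof (cases "\<exists>z. cmod z < 1 \<and> x z \<noteq> 0")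
  case True
  obtain g where g: "isCont g p" "g p \<noteq> 0" "\<forall>\<^sub>F z in nhds p. x z = g z * (z - p) ^ j"
    using order_of_eigenfunction[OF x \<phi> self p \<mu>, of "\<lambda>_. 1" j] eq True by auto
  define c where "c = g p * (1 - t * p) ^ j"
  define f where "f z = x z * (1 - t * z) ^ j - c * (z - p) ^ j" for z
  have fh: "f holomorphic_on ball 0 1"
    unfolding f_def[abs_def] by (intro holomorphic_intros x)
  have feq: "f (\<phi> z) = \<mu> ^ j * (r z ^ j) * f z" if "cmod z < 1" for z
    unfolding f_def eq[OF that] B[OF that] A[OF that] power_mult_distrib
    by (simp add: right_diff_distrib mult_ac)
  have "f z = 0" if z: "cmod z < 1" for z
  proof (rule ccontr)
    assume "f z \<noteq> 0"
    then obtain h where h: "isCont h p" "h p \<noteq> 0" "\<forall>\<^sub>F z in nhds p. f z = h z * (z - p) ^ j"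
      using order_of_eigenfunction[OF fh \<phi> self p \<mu>, of "\<lambda>z. r z ^ j" j] feq z r
      by (auto intro: continuous_intros)
    have "\<forall>\<^sub>F z in at p. f z = h z * (z - p) ^ j \<and> x z = g z * (z - p) ^ j \<and> z \<noteq> p"
      using h(3) g(3) unfolding eventually_at_filter by eventually_elim auto
    then have "\<forall>\<^sub>F z in at p. g z * (1 - t * z) ^ j - c = h z"
    proof eventually_elim
      case (elim z)
      have "(g z * (1 - t * z) ^ j - c) * (z - p) ^ j =
          (g z * (z - p) ^ j) * (1 - t * z) ^ j - c * (z - p) ^ j"
        by (simp add: algebra_simps)
      also have "\<dots> = f z" using elim unfolding f_def by metis
      also have "\<dots> = h z * (z - p) ^ j" using elim by simp
      finally show ?case using elim by simp
    qed
    moreover have "((\<lambda>z. g z * (1 - t * z) ^ j - c) \<longlongrightarrow> g p * (1 - t * p) ^ j - c) (at p)"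
      using g(1) by (intro tendsto_intros) (simp add: isCont_def)
    ultimately have "(h \<longlongrightarrow> 0) (at p)"
      using Lim_transform_eventually by (fastforce simp: c_def)
    then show False using h(1,2) tendsto_unique[of "at p" h] by (auto simp: isCont_def)
  qed
  then show ?thesis unfolding f_def by (intro exI[of _ c]) simp
qed (intro exI[of _ 0], auto)

subsection \<open>A complex symmetric symbol fixes a point of the disk\<close>

lemma intertwining_on_adjoint:
  assumes C: "conjugation C" and TC: "\<And>f. T f = C (Ts (C f))"
  shows "T (C f) = C (Ts f)" "C (T f) = Ts (C f)"
  by (simp_all add: TC conjugation_involution[OF C])

lemma conjugation_of_adjoint_eigenvector:
  assumes T: "composes_with T \<phi>" and C: "conjugation C"
    and adj: "\<And>f g. cinner (T f) g = cinner f (Ts g)" and TC: "\<And>f. T f = C (Ts (C f))"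
    and v: "\<And>f. cinner (T f) v = \<mu> * cinner f v"
  shows "cmod z < 1 \<Longrightarrow> ev (C v) (\<phi> z) = \<mu> * ev (C v) z"
proof -
  have "Ts v = cnj \<mu> *\<^sub>C v"
    by (rule cinner_ext) (simp add: adj[symmetric] v)
  then have "T (C v) = \<mu> *\<^sub>C C v"
    by (simp add: intertwining_on_adjoint(1)[of C T Ts, OF C TC] conjugation_scaleC[OF C])
  then show "cmod z < 1 \<Longrightarrow> ev (C v) (\<phi> z) = \<mu> * ev (C v) z"
    using composes_withD[OF T, of z "C v"] by simp
qed

lemma conjugation_of_eigenvector:
  assumes C: "conjugation C" and adj: "\<And>f g. cinner (T f) g = cinner f (Ts g)"
    and TC: "\<And>f. T f = C (Ts (C f))" and v: "T v = \<mu> *\<^sub>C v"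
  shows "cinner (T f) (C v) = \<mu> * cinner f (C v)"
  by (simp add: adj intertwining_on_adjoint(2)[of C T Ts, OF C TC, symmetric] v conjugation_scaleC[OF C])

section \<open>Weak convergence and attraction to a boundary point\<close>

lemma weak_null_sequence:
  assumes bd: "\<And>n. norm (Y n) \<le> M" and co: "\<And>k. (\<lambda>n. coef (Y n) k) \<longlonglongrightarrow> 0"
  shows "(\<lambda>n. cinner (Y n) g) \<longlonglongrightarrow> 0"
proof (rule LIMSEQ_I)
  fix e :: real assume e: "e > 0"
  have M: "M \<ge> 0" using order_trans[OF norm_ge_zero bd] .
  define gN where "gN N = (\<Sum>k<N. coef g k *\<^sub>C zpow k)" for N
  have "(\<lambda>N. gN N) \<longlonglongrightarrow> g" unfolding gN_def by (rule tendsto_truncation)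
  then obtain N where N: "norm (gN N - g) < e / (2 * (M + 1))"
    using LIMSEQ_D[of gN g "e / (2 * (M + 1))"] e M by auto
  have fin: "cinner (Y n) (gN N) = (\<Sum>k<N. cnj (coef g k) * coef (Y n) k)" for n
    unfolding gN_def by (subst cinner_commute) (simp add: cinner_sum_left cinner_commute[of "zpow _"])
  have "(\<lambda>n. \<Sum>k<N. cnj (coef g k) * coef (Y n) k) \<longlonglongrightarrow> (\<Sum>k<N. cnj (coef g k) * 0)"
    by (intro tendsto_intros co)
  then obtain n0 where n0: "\<And>n. n \<ge> n0 \<Longrightarrow> cmod (cinner (Y n) (gN N)) < e / 2"
    using LIMSEQ_D[of "\<lambda>n. cinner (Y n) (gN N)" 0 "e/2"] e unfolding fin by auto
  have "norm (cinner (Y n) g - 0) < e" if "n \<ge> n0" for n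
  proof -
    have "cinner (Y n) g = cinner (Y n) (gN N) - cinner (Y n) (gN N - g)"
      by (simp add: cinner_minus_right)
    then have "cmod (cinner (Y n) g) \<le> cmod (cinner (Y n) (gN N)) + cmod (cinner (Y n) (gN N - g))"
      by (simp add: norm_triangle_ineq4)
    also have "cmod (cinner (Y n) (gN N - g)) \<le> norm (Y n) * norm (gN N - g)" by (rule cmod_cinner_le)
    also have "\<dots> \<le> M * (e / (2 * (M + 1)))"
      using bd N M by (intro mult_mono) auto
    also have "\<dots> \<le> e / 2" using M e by (simp add: field_simps)
    finally show ?thesis using n0[OF that] by simp
  qed
  then show "\<exists>n0. \<forall>n\<ge>n0. norm (cinner (Y n) g - 0) < e" by blast
qed

text \<open>Bounded pointwise convergence makes the means of the difference over a fixed circle,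
  here of radius 1/2, tend to zero. These means control every Taylor coefficient.\<close>

lemma weak_convergence_to_constant:
  assumes bd: "\<And>n z. cmod z < 1 \<Longrightarrow> cmod (ev (X n) z) \<le> 1"
    and lim: "\<And>z. cmod z < 1 \<Longrightarrow> (\<lambda>n. ev (X n) z) \<longlonglongrightarrow> l"
  shows "(\<lambda>n. cinner (X n) g) \<longlonglongrightarrow> l * cinner (zpow 0) g"
proof -
  define Y where "Y n = X n - l *\<^sub>C zpow 0" for n
  have evY: "ev (Y n) z = ev (X n) z - l" if "cmod z < 1" for n z
    using that by (simp add: Y_def)
  have l: "cmod l \<le> 1"
    by (rule LIMSEQ_le_const2[OF tendsto_norm[OF lim[of 0]]]) (use bd[of 0] in simp_all)
  have Ybd: "cmod (ev (Y n) z) \<le> 2" if "cmod z < 1" for n z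
    using norm_triangle_ineq4[of "ev (X n) z" l] bd[OF that, of n] l evY[OF that] by simp
  have "norm (Y n) \<le> 2" for n
  proof -
    obtain f where f: "\<And>z. cmod z < 1 \<Longrightarrow> ev f z = ev (Y n) z" "norm f \<le> 2"
      using bounded_holomorphic_in_hardy[OF ev_holomorphic Ybd] by blast
    from ev_eqI[of f "Y n", OF f(1)] f(2) show ?thesis by simp
  qed
  moreover have "(\<lambda>n. coef (Y n) k) \<longlonglongrightarrow> 0" for k
  proof -
    have hm: "hardy_mean (ev (Y n)) (1/2) =
        integral {0..2*pi} (\<lambda>\<theta>. (cmod (ev (Y n) ((1/2) * cis \<theta>)))\<^sup>2) / (2 * pi)" for n
      by (simp add: hardy_mean_def)
    have in_disk: "cmod ((1/2) * cis \<theta>) < 1" for \<theta> by (simp add: norm_mult norm_divide)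
    have "(\<lambda>n. integral {0..2*pi} (\<lambda>\<theta>. (cmod (ev (Y n) ((1/2) * cis \<theta>)))\<^sup>2)) \<longlonglongrightarrow>
        integral {0..2*pi} (\<lambda>\<theta>. 0)"
    proof (rule dominated_convergence(2)[where h = "\<lambda>_. 4"])
      show "(\<lambda>\<theta>. (cmod (ev (Y n) ((1/2) * cis \<theta>)))\<^sup>2) integrable_on {0..2*pi}" for n
      proof (intro integrable_continuous_real continuous_intros)
        show "continuous_on {0..2*pi} (\<lambda>\<theta>. ev (Y n) ((1/2) * cis \<theta>))"
          by (rule continuous_on_compose2[OF holomorphic_on_imp_continuous_on[OF ev_holomorphic]])
            (use in_disk in \<open>auto intro!: continuous_intros\<close>)
      qed
      show "norm ((cmod (ev (Y n) ((1/2) * cis \<theta>)))\<^sup>2) \<le> 4" for n \<theta>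
        using power_mono[OF Ybd[OF in_disk[of \<theta>], of n], of 2] by simp
      show "(\<lambda>n. (cmod (ev (Y n) ((1/2) * cis \<theta>)))\<^sup>2) \<longlonglongrightarrow> 0" for \<theta>
      proof -
        have "(\<lambda>n. (cmod (ev (X n) ((1/2) * cis \<theta>) - l))\<^sup>2) \<longlonglongrightarrow> (cmod (l - l))\<^sup>2"
          by (intro tendsto_intros lim in_disk)
        then show ?thesis unfolding evY[OF in_disk] by simp
      qed
    qed auto
    then have "(\<lambda>n. hardy_mean (ev (Y n)) (1/2)) \<longlonglongrightarrow> 0"
      unfolding hm using tendsto_divide[of _ 0 sequentially "\<lambda>_. 2 * pi" "2 * pi"] by simp
    then have lim0: "(\<lambda>n. 2 ^ (2 * k) * hardy_mean (ev (Y n)) (1/2)) \<longlonglongrightarrow> 2 ^ (2 * k) * 0"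
      by (rule tendsto_mult_left)
    have le: "(cmod (coef (Y n) k))\<^sup>2 \<le> 2 ^ (2 * k) * hardy_mean (ev (Y n)) (1/2)" for n
    proof -
      have hm: "(\<lambda>j. (cmod (coef (Y n) j))\<^sup>2 * (1/2) ^ (2 * j)) sums hardy_mean (ev (Y n)) (1/2)"
        by (rule hardy_mean_ev) simp_all
      have "(\<Sum>j\<in>{k}. (cmod (coef (Y n) j))\<^sup>2 * (1/2) ^ (2 * j)) \<le> hardy_mean (ev (Y n)) (1/2)"
        unfolding sums_unique[OF hm] by (rule sum_le_suminf[OF sums_summable[OF hm]]) auto
      then show ?thesis by (simp add: power_divide field_simps)
    qed
    have "(\<lambda>n. (cmod (coef (Y n) k))\<^sup>2) \<longlonglongrightarrow> 0"
      by (rule tendsto_sandwich[OF always_eventually always_eventually tendsto_const lim0[unfolded mult_zero_right]])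
        (use le in simp_all)
    then have "(\<lambda>n. sqrt ((cmod (coef (Y n) k))\<^sup>2)) \<longlonglongrightarrow> sqrt 0" by (rule tendsto_real_sqrt)
    then show ?thesis by (simp add: tendsto_norm_zero_iff)
  qed
  ultimately have "(\<lambda>n. cinner (Y n) g) \<longlonglongrightarrow> 0" by (rule weak_null_sequence)
  then have "(\<lambda>n. cinner (Y n) g + l * cinner (zpow 0) g) \<longlonglongrightarrow> 0 + l * cinner (zpow 0) g"
    by (intro tendsto_intros)
  then show ?thesis by (simp add: Y_def cinner_minus_left)
qed

text \<open>The adjoint fixes \<open>g = C 1\<close>, so pairing with \<open>g\<close> is invariant
  under composition. The iterated images of \<open>z ^ k\<close> tend weakly to the constant
  \<open>\<omega> ^ k\<close>; hence all coefficients of \<open>g\<close> have the same modulus,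
  which square-summability allows only for \<open>g = 0\<close>.\<close>

lemma no_boundary_attraction:
  assumes T: "composes_with T \<phi>" and C: "conjugation C"
    and adj: "\<And>f g. cinner (T f) g = cinner f (Ts g)" and TC: "\<And>f. T f = C (Ts (C f))"
    and self: "\<And>z. cmod z < 1 \<Longrightarrow> cmod (\<phi> z) < 1"
    and lim: "\<And>z. cmod z < 1 \<Longrightarrow> (\<lambda>n. (\<phi> ^^ n) z) \<longlonglongrightarrow> \<omega>" and \<omega>: "cmod \<omega> = 1"
  shows False
proof -
  define g where "g = C (zpow 0)"
  have "T (zpow 0) = 1 *\<^sub>C zpow 0"
    by (rule ev_eqI) (simp add: composes_withD[OF T])
  from conjugation_of_eigenvector[OF C adj TC this]
  have step: "cinner (T f) g = cinner f g" for f by (simp add: g_def)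
  have inv: "cinner ((T ^^ n) f) g = cinner f g" for n f
    by (induction n) (simp_all add: step)
  have iter: "cmod ((\<phi> ^^ n) z) < 1" if "cmod z < 1" for n z
    by (induction n) (simp_all add: that self)
  have evT: "ev ((T ^^ n) f) z = ev f ((\<phi> ^^ n) z)" if "cmod z < 1" for n f z
    using that by (induction n arbitrary: z) (simp_all add: composes_withD[OF T] self funpow_swap1[of \<phi>])
  have "cinner (zpow k) g = \<omega> ^ k * cinner (zpow 0) g" for k
  proof (rule LIMSEQ_unique)
    show "(\<lambda>n. cinner ((T ^^ n) (zpow k)) g) \<longlonglongrightarrow> cinner (zpow k) g" by (simp add: inv)
    show "(\<lambda>n. cinner ((T ^^ n) (zpow k)) g) \<longlonglongrightarrow> \<omega> ^ k * cinner (zpow 0) g"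
    proof (rule weak_convergence_to_constant)
      show "cmod (ev ((T ^^ n) (zpow k)) z) \<le> 1" if "cmod z < 1" for n z
        using iter[OF that, of n] by (simp add: evT that norm_power power_le_one)
      show "(\<lambda>n. ev ((T ^^ n) (zpow k)) z) \<longlonglongrightarrow> \<omega> ^ k" if "cmod z < 1" for z
        unfolding evT[OF that] ev_zpow by (intro tendsto_intros lim that)
    qed
  qed
  then have eq: "cmod (cinner (zpow k) g) = cmod (\<omega> ^ k * cinner (zpow 0) g)" for k
    by (rule arg_cong)
  have n: "cmod (cinner (zpow k) g) = cmod (coef g k)" for k
    by (subst cinner_commute) simp
  have const: "cmod (coef g k) = cmod (coef g 0)" for k
    using eq[of k] unfolding norm_mult norm_power n \<omega> by simp
  have "(\<lambda>k. (cmod (coef g k))\<^sup>2) = (\<lambda>k. (cmod (coef g 0))\<^sup>2)"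
    by (rule ext) (metis const)
  then have "(\<lambda>k. (cmod (coef g 0))\<^sup>2) \<longlonglongrightarrow> 0"
    using summable_LIMSEQ_zero[OF summable_coef_sq[of g]] by metis
  then have "cmod (coef g 0) = 0" by (simp add: LIMSEQ_const_iff)
  then have "coef g k = 0" for k using const[of k] by simp
  then have "g = 0" by (intro ell2_eqI) simp
  moreover have "norm g = 1" by (simp add: g_def conjugation_norm[OF C])
  ultimately show False by simp
qed

text \<open>Invariance of the half plane forces \<open>A\<close> to be a positive real
  \<open>a\<close>. For \<open>a < 1\<close> the fixed point lies in the closed half plane and
  attracts, for \<open>a > 1\<close> it is not in the open half plane and repels, and for
  \<open>a = 1\<close> the map is a translation.\<close>

lemma affine_half_plane_dynamics:
  assumes A: "A \<noteq> 0" and nid: "\<not> (A = 1 \<and> B = 0)"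
    and map: "\<And>U. Re U > 1/2 \<Longrightarrow> Re (A * U + B) > 1/2"
  shows "(\<exists>V. Re V > 1/2 \<and> A * V + B = V) \<or>
    (\<exists>V. Re V = 1/2 \<and> (\<forall>U. Re U > 1/2 \<longrightarrow> (\<lambda>n. ((\<lambda>U. A * U + B) ^^ n) U) \<longlonglongrightarrow> V)) \<or>
    (\<forall>U. Re U > 1/2 \<longrightarrow> filterlim (\<lambda>n. ((\<lambda>U. A * U + B) ^^ n) U) at_infinity sequentially)"
proof -
  have "Im A = 0"
  proof (rule ccontr)
    assume im: "Im A \<noteq> 0"
    \<comment> \<open>Chosen so that the image of \<open>Complex 1 y\<close> has real part
      \<open>0\<close>.\<close>
    define y where "y = (Re A + Re B) / Im A"
    have "Re (A * Complex 1 y + B) > 1/2" by (rule map) simp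
    then show False using im by (simp add: y_def)
  qed
  then obtain a where a: "A = complex_of_real a" by (metis complex_is_Real_iff Reals_cases)
  have "a > 0"
  proof (rule ccontr)
    assume "\<not> a > 0"
    then have neg: "a < 0" using A a by (cases "a = 0") auto
    \<comment> \<open>Large enough for \<open>a * x + Re B \<le> 0\<close>, and at least
      \<open>1\<close>, hence in the half plane.\<close>
    define x where "x = 1 + \<bar>Re B / a\<bar>"
    have x: "x > 1/2" "- Re B / a \<le> x" unfolding x_def by linarith+
    then have "Re (A * complex_of_real x + B) > 1/2" by (intro map) simp
    then have "a * x + Re B > 1/2" by (simp add: a)
    moreover have "a * x \<le> a * (- Re B / a)" using neg x by (intro mult_left_mono_neg) auto
    ultimately show False using neg by simp
  qed
  have bdry: "a / 2 + Re B \<ge> 1/2"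
  proof (rule ccontr)
    assume *: "\<not> ?thesis"
    \<comment> \<open>The solution of \<open>a * x + Re B = 1/2\<close>: an interior point that
      would be sent to the boundary.\<close>
    define x where "x = (1/2 - Re B) / a"
    have "x > 1/2" using * \<open>a > 0\<close> by (simp add: x_def field_simps)
    then have "Re (A * complex_of_real x + B) > 1/2" by (intro map) simp
    then show False using \<open>a > 0\<close> by (simp add: a x_def)
  qed
  show ?thesis
  proof (cases "a = 1")
    case True
    then have B: "B \<noteq> 0" using nid a by auto
    have "((\<lambda>U. A * U + B) ^^ n) U = U + of_nat n * B" for n U
      by (induction n) (simp_all add: a True algebra_simps)
    moreover have "filterlim (\<lambda>n. U + of_nat n * B) at_infinity sequentially" for U
    proof (rule tendsto_add_filterlim_at_infinity[OF tendsto_const])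
      have "filterlim (\<lambda>n. of_nat n :: complex) at_infinity sequentially"
        by (rule tendsto_of_nat)
      then show "filterlim (\<lambda>n. of_nat n * B) at_infinity sequentially"
        by (rule tendsto_mult_filterlim_at_infinity[OF tendsto_const B, of _ , simplified mult.commute[of B]])
    qed
    ultimately show ?thesis by simp
  next
    case False
    define V where "V = B / (1 - A)"
    have nz: "1 - A \<noteq> 0" using False a by (metis eq_iff_diff_eq_0 of_real_eq_1_iff)
    have V: "A * V + B = V" using nz by (simp add: V_def field_simps)
    have ReV: "Re V = Re B / (1 - a)"
      unfolding V_def a by (metis Re_divide_of_real of_real_1 of_real_diff)
    have iter: "((\<lambda>U. A * U + B) ^^ n) U = V + A ^ n * (U - V)" for n U
    proof (induction n)
      case (Suc n)
      have "A * (V + A ^ n * (U - V)) + B = (A * V + B) + A ^ Suc n * (U - V)"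
        by (simp add: algebra_simps)
      then show ?case by (simp add: Suc V)
    qed simp
    show ?thesis
    proof (cases "a < 1")
      case True
      have "Re V \<ge> 1/2" using bdry True unfolding ReV by (simp add: field_simps)
      then consider "Re V > 1/2" | "Re V = 1/2" by linarith
      then show ?thesis
      proof cases
        case 2
        have "cmod A < 1" using True \<open>a > 0\<close> by (simp add: a)
        then have pow: "(\<lambda>n. A ^ n) \<longlonglongrightarrow> 0" by (rule LIMSEQ_power_zero)
        have "(\<lambda>n. V + A ^ n * (U - V)) \<longlonglongrightarrow> V + 0 * (U - V)" for U
          by (rule tendsto_add[OF tendsto_const tendsto_mult_right[OF pow]])
        then show ?thesis unfolding iter using 2 by auto
      qed (use V in blast)
    next
      case False
      then have "a > 1" using \<open>a \<noteq> 1\<close> by simp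
      then have ReV2: "Re V \<le> 1/2" using bdry unfolding ReV by (simp add: field_simps)
      have "filterlim (\<lambda>n. V + A ^ n * (U - V)) at_infinity sequentially" if "Re U > 1/2" for U
      proof (rule tendsto_add_filterlim_at_infinity[OF tendsto_const])
        have nz: "U - V \<noteq> 0" using that ReV2 by auto
        have pow: "filterlim (\<lambda>n. A ^ n) at_infinity sequentially"
          by (rule filterlim_realpow_sequentially_gt1) (use \<open>a > 1\<close> a in simp)
        show "filterlim (\<lambda>n. A ^ n * (U - V)) at_infinity sequentially"
          unfolding mult.commute[of _ "U - V"]
          by (rule tendsto_mult_filterlim_at_infinity[OF tendsto_const nz pow])
      qed
      then show ?thesis unfolding iter by blast
    qed
  qed
qed

text \<open>Both statements compare |U - 1| with |U|, whose squares differ by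
  \<open>1 - 2 * Re U\<close>.\<close>

lemma half_plane_iff:
  assumes "U \<noteq> 0"
  shows "cmod (1 - 1 / U) < 1 \<longleftrightarrow> Re U > 1/2" "cmod (1 - 1 / U) = 1 \<longleftrightarrow> Re U = 1/2"
proof -
  have "1 - 1 / U = (U - 1) / U" using assms by (simp add: field_simps)
  then have "cmod (1 - 1 / U) = cmod (U - 1) / cmod U" by (simp add: norm_divide)
  moreover have "(cmod (U - 1))\<^sup>2 = (cmod U)\<^sup>2 - 2 * Re U + 1"
    unfolding cmod_power2 by (simp add: power2_eq_square algebra_simps)
  moreover have "cmod (U - 1) < cmod U \<longleftrightarrow> (cmod (U - 1))\<^sup>2 < (cmod U)\<^sup>2"
    by (metis norm_ge_zero power2_less_imp_less power_strict_mono zero_less_numeral)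
  moreover have "cmod (U - 1) = cmod U \<longleftrightarrow> (cmod (U - 1))\<^sup>2 = (cmod U)\<^sup>2"
    by (metis norm_ge_zero power2_eq_imp_eq)
  ultimately show "cmod (1 - 1 / U) < 1 \<longleftrightarrow> Re U > 1/2" "cmod (1 - 1 / U) = 1 \<longleftrightarrow> Re U = 1/2"
    using assms by (simp_all add: divide_less_eq divide_eq_eq) linarith+
qed

section \<open>Linear fractional self-maps without a fixed point in the disk\<close>

lemma linfrac_self_mapD:
  assumes "linfrac_self_map \<alpha> \<beta> \<gamma> \<delta>"
  shows "\<alpha> * \<delta> - \<beta> * \<gamma> \<noteq> 0"
    and "cmod z < 1 \<Longrightarrow> \<gamma> * z + \<delta> \<noteq> 0" and "cmod z < 1 \<Longrightarrow> cmod (linfrac \<alpha> \<beta> \<gamma> \<delta> z) < 1"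
proof -
  show "\<alpha> * \<delta> - \<beta> * \<gamma> \<noteq> 0" using assms by (simp add: linfrac_self_map_def)
  have "linfrac_sphere \<alpha> \<beta> \<gamma> \<delta> (Fin z) \<in> Fin ` unit_disk" if "cmod z < 1"
    using assms that unfolding linfrac_self_map_def by (metis image_eqI image_subset_iff mem_ball_0)
  then show "cmod z < 1 \<Longrightarrow> \<gamma> * z + \<delta> \<noteq> 0" "cmod z < 1 \<Longrightarrow> cmod (linfrac \<alpha> \<beta> \<gamma> \<delta> z) < 1"
    by (auto split: if_splits)
qed

lemma linfrac_self_map_holomorphic:
  assumes "linfrac_self_map \<alpha> \<beta> \<gamma> \<delta>"
  shows "linfrac \<alpha> \<beta> \<gamma> \<delta> holomorphic_on ball 0 1"
  unfolding linfrac_def[abs_def]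
  by (intro holomorphic_intros) (use linfrac_self_mapD(2)[OF assms] in auto)

text \<open>In the open disk the denominator dominates the numerator. The inequality persists on the
  boundary, so a pole there would be a common zero of both, contrary to the determinant
  condition.\<close>

lemma linfrac_self_map_no_boundary_pole:
  assumes lf: "linfrac_self_map \<alpha> \<beta> \<gamma> \<delta>" and z: "cmod z \<le> 1"
  shows "\<gamma> * z + \<delta> \<noteq> 0"
proof
  assume pole: "\<gamma> * z + \<delta> = 0"
  have lim: "((\<lambda>r. \<alpha> * (of_real r * z) + \<beta>) \<longlongrightarrow> \<alpha> * (of_real 1 * z) + \<beta>) (at_left 1)"
    "((\<lambda>r. \<gamma> * (of_real r * z) + \<delta>) \<longlongrightarrow> \<gamma> * (of_real 1 * z) + \<delta>) (at_left (1::real))"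
    by (intro tendsto_intros)+
  have ev: "\<forall>\<^sub>F r in at_left (1::real). cmod (\<alpha> * (of_real r * z) + \<beta>) \<le> cmod (\<gamma> * (of_real r * z) + \<delta>)"
    using eventually_at_left_real[of 0 "1::real", OF zero_less_one]
  proof (rule eventually_mono)
    fix r :: real assume "r \<in> {0<..<1}"
    then have r: "0 < r" "r < 1" by simp_all
    have "r * cmod z \<le> r" using mult_left_mono[OF z, of r] r by simp
    moreover have "cmod (of_real r * z) = r * cmod z" using r by (simp add: norm_mult)
    ultimately have "cmod (of_real r * z) < 1" using r by linarith
    from linfrac_self_mapD(2,3)[OF lf this] show
      "cmod (\<alpha> * (of_real r * z) + \<beta>) \<le> cmod (\<gamma> * (of_real r * z) + \<delta>)"
      by (simp add: linfrac_def norm_divide)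
  qed
  have "cmod (\<alpha> * z + \<beta>) \<le> cmod (\<gamma> * z + \<delta>)"
    using tendsto_le[OF _ tendsto_norm[OF lim(2)] tendsto_norm[OF lim(1)] ev] by simp
  then have "\<alpha> * z + \<beta> = 0" using pole by simp
  then have "\<alpha> * \<delta> - \<beta> * \<gamma> = 0" using pole by algebra
  then show False using linfrac_self_mapD(1)[OF lf] by simp
qed

lemma linfrac_diff:
  assumes "\<gamma> * z + \<delta> \<noteq> 0" "\<gamma> * w + \<delta> \<noteq> 0"
  shows "linfrac \<alpha> \<beta> \<gamma> \<delta> z - linfrac \<alpha> \<beta> \<gamma> \<delta> w =
    (\<alpha> * \<delta> - \<beta> * \<gamma>) * (z - w) / ((\<gamma> * z + \<delta>) * (\<gamma> * w + \<delta>))"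
proof -
  define x y where "x = \<gamma> * z + \<delta>" and "y = \<gamma> * w + \<delta>"
  have "(\<alpha> * z + \<beta>) / x - (\<alpha> * w + \<beta>) / y = ((\<alpha> * z + \<beta>) * y - (\<alpha> * w + \<beta>) * x) / (x * y)"
  proof -
    have "x \<noteq> 0" "y \<noteq> 0" using assms by (simp_all add: x_def y_def)
    then show ?thesis by (simp add: field_simps)
  qed
  also have "(\<alpha> * z + \<beta>) * y - (\<alpha> * w + \<beta>) * x = (\<alpha> * \<delta> - \<beta> * \<gamma>) * (z - w)"
    unfolding x_def y_def by (simp add: algebra_simps)
  finally show ?thesis by (simp add: linfrac_def x_def y_def)
qed

lemma linfrac_continuous_fixed_point:
  assumes lf: "linfrac_self_map \<alpha> \<beta> \<gamma> \<delta>"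
  obtains \<omega> where "cmod \<omega> \<le> 1" "linfrac \<alpha> \<beta> \<gamma> \<delta> \<omega> = \<omega>"
proof -
  have cont: "continuous_on (cball 0 1) (linfrac \<alpha> \<beta> \<gamma> \<delta>)"
    unfolding linfrac_def[abs_def]
    by (intro continuous_intros) (use linfrac_self_map_no_boundary_pole[OF lf] in auto)
  have "linfrac \<alpha> \<beta> \<gamma> \<delta> ` closure (ball 0 1) \<subseteq> cball 0 1"
  proof (rule image_closure_subset)
    show "continuous_on (closure (ball 0 1)) (linfrac \<alpha> \<beta> \<gamma> \<delta>)" using cont by simp
    show "linfrac \<alpha> \<beta> \<gamma> \<delta> ` ball 0 1 \<subseteq> cball 0 1"
      using linfrac_self_mapD(3)[OF lf] by (force intro: less_imp_le)
  qed simp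
  then have "linfrac \<alpha> \<beta> \<gamma> \<delta> \<in> cball 0 1 \<rightarrow> cball 0 1" by auto
  from brouwer_ball[OF zero_less_one cont this] that show thesis by auto
qed

text \<open>
  At a boundary fixed point \<open>\<omega>\<close> the coordinate \<open>u = 1 / (1 - cnj \<omega> z)\<close> maps the disk onto the
  half plane \<open>Re u > 1/2\<close> and turns the symbol into an affine map.
\<close>

lemma linfrac_boundary_dynamics:
  assumes lf: "linfrac_self_map \<alpha> \<beta> \<gamma> \<delta>"
    and no_fix: "\<And>z. cmod z < 1 \<Longrightarrow> linfrac \<alpha> \<beta> \<gamma> \<delta> z \<noteq> z"
  obtains \<omega> where "cmod \<omega> = 1" "\<And>z. cmod z < 1 \<Longrightarrow> (\<lambda>n. (linfrac \<alpha> \<beta> \<gamma> \<delta> ^^ n) z) \<longlonglongrightarrow> \<omega>"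
proof -
  let ?\<phi> = "linfrac \<alpha> \<beta> \<gamma> \<delta>"
  obtain \<omega> where \<omega>': "cmod \<omega> \<le> 1" "?\<phi> \<omega> = \<omega>" using linfrac_continuous_fixed_point[OF lf] .
  then have \<omega>: "cmod \<omega> = 1" using no_fix[of \<omega>] by fastforce
  have \<omega>\<omega>: "\<omega> * cnj \<omega> = 1" by (rule unimodular_mult_cnj[OF \<omega>])
  define d where "d = \<alpha> * \<delta> - \<beta> * \<gamma>"
  define a0 where "a0 = \<gamma> * \<omega> + \<delta>"
  have d: "d \<noteq> 0" using linfrac_self_mapD(1)[OF lf] by (simp add: d_def)
  have a0: "a0 \<noteq> 0" using linfrac_self_map_no_boundary_pole[OF lf \<omega>'(1)] by (simp add: a0_def)
  \<comment> \<open>\<open>A\<close> is the reciprocal of the derivative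
    \<open>d / a0\<^sup>2\<close> of the symbol at \<open>\<omega>\<close>, because the coordinate
    \<open>u\<close> has a simple pole there.\<close>
  define A where "A = a0\<^sup>2 / d"
  define B where "B = - (\<gamma> * \<omega> * a0 / d)"
  define u where "u z = 1 / (1 - cnj \<omega> * z)" for z
  define v where "v U = \<omega> * (1 - 1 / U)" for U
  have nz: "1 - cnj \<omega> * z \<noteq> 0" if "cmod z < 1" for z
  proof
    assume "1 - cnj \<omega> * z = 0"
    then have "cmod (cnj \<omega> * z) = 1" by simp
    then show False using that \<omega> by (simp add: norm_mult)
  qed
  have u0: "u z \<noteq> 0" if "cmod z < 1" for z using nz[OF that] by (simp add: u_def)
  have vu: "v (u z) = z" if "cmod z < 1" for z
  proof -
    have "v (u z) = (\<omega> * cnj \<omega>) * z" by (simp add: v_def u_def)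
    then show ?thesis by (simp add: \<omega>\<omega>)
  qed
  have uv: "u (v U) = U" if "U \<noteq> 0" for U
  proof -
    have "1 - cnj \<omega> * v U = 1 - (\<omega> * cnj \<omega>) * (1 - 1 / U)" by (simp add: v_def mult_ac)
    then show ?thesis by (simp add: u_def \<omega>\<omega>)
  qed
  have nv: "cmod (v U) = cmod (1 - 1 / U)" for U by (simp add: v_def norm_mult \<omega>)
  have Re_u: "Re (u z) > 1/2" if "cmod z < 1" for z
    using half_plane_iff(1)[OF u0[OF that]] nv[of "u z"] vu[OF that] that by simp
  have v_disk: "cmod (v U) < 1" if "Re U > 1/2" for U
    using half_plane_iff(1)[of U] nv[of U] that by force
  have conj_affine: "u (?\<phi> z) = A * u z + B" if z: "cmod z < 1" for z
  proof -
    have p: "\<gamma> * z + \<delta> \<noteq> 0" by (rule linfrac_self_mapD(2)[OF lf z])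
    have "\<omega> - ?\<phi> z = d * (\<omega> - z) / (a0 * (\<gamma> * z + \<delta>))"
      using linfrac_diff[of \<gamma> \<omega> \<delta> z \<alpha> \<beta>] a0 p \<omega>'(2) by (simp add: d_def a0_def)
    moreover have "1 - cnj \<omega> * w = cnj \<omega> * (\<omega> - w)" for w
      using \<omega>\<omega> by (simp add: algebra_simps)
    ultimately have "1 - cnj \<omega> * ?\<phi> z = d * (1 - cnj \<omega> * z) / (a0 * (\<gamma> * z + \<delta>))" by simp
    then have "u (?\<phi> z) = (\<gamma> * z + \<delta>) * a0 / d * u z"
      by (simp add: u_def)
    also have "(\<gamma> * z + \<delta>) * u z = a0 * u z - \<gamma> * \<omega>"
    proof -
      have "(\<gamma> * z + \<delta>) = a0 - \<gamma> * \<omega> * (1 - cnj \<omega> * z)"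
        using \<omega>\<omega> unfolding a0_def by algebra
      then show ?thesis using nz[OF z] by (simp add: u_def diff_divide_distrib)
    qed
    then have "(\<gamma> * z + \<delta>) * a0 / d * u z = (a0 * u z - \<gamma> * \<omega>) * (a0 / d)"
      by (simp add: mult_ac)
    finally show ?thesis by (simp add: A_def B_def power2_eq_square algebra_simps)
  qed
  have map: "Re (A * U + B) > 1/2" if "Re U > 1/2" for U
  proof -
    have "U \<noteq> 0" using that by auto
    then show ?thesis
      using conj_affine[OF v_disk[OF that]] Re_u[OF linfrac_self_mapD(3)[OF lf v_disk[OF that]]] by (simp add: uv)
  qed
  have A: "A \<noteq> 0" using a0 d by (simp add: A_def)
  have no_fix': "A * V + B \<noteq> V" if "Re V > 1/2" for V
  proof
    assume "A * V + B = V"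
    moreover have "V \<noteq> 0" using that by auto
    ultimately have "u (?\<phi> (v V)) = u (v V)" using conj_affine[OF v_disk[OF that]] by (simp add: uv)
    then have "?\<phi> (v V) = v V"
      using vu[OF v_disk[OF that]] vu[OF linfrac_self_mapD(3)[OF lf v_disk[OF that]]] by metis
    then show False using no_fix[OF v_disk[OF that]] by simp
  qed
  have nid: "\<not> (A = 1 \<and> B = 0)" using no_fix'[of 1] by auto
  have iter_disk: "cmod ((?\<phi> ^^ n) z) < 1" if "cmod z < 1" for n z
    by (induction n) (simp_all add: that linfrac_self_mapD(3)[OF lf])
  have iter: "u ((?\<phi> ^^ n) z) = ((\<lambda>U. A * U + B) ^^ n) (u z)" if "cmod z < 1" for n z
    by (induction n) (simp_all add: conj_affine iter_disk that)
  have iter': "(?\<phi> ^^ n) z = \<omega> * (1 - 1 / ((\<lambda>U. A * U + B) ^^ n) (u z))" if "cmod z < 1" for n z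
    using vu[OF iter_disk[OF that, of n]] by (simp add: v_def iter[OF that])
  consider V where "Re V = 1/2" "\<And>U. Re U > 1/2 \<Longrightarrow> (\<lambda>n. ((\<lambda>U. A * U + B) ^^ n) U) \<longlonglongrightarrow> V"
    | "\<And>U. Re U > 1/2 \<Longrightarrow> filterlim (\<lambda>n. ((\<lambda>U. A * U + B) ^^ n) U) at_infinity sequentially"
    using affine_half_plane_dynamics[OF A nid map] no_fix' by blast
  then show thesis
  proof cases
    case 1
    have V: "V \<noteq> 0" using 1(1) by auto
    show thesis
    proof
      show "cmod (\<omega> * (1 - 1 / V)) = 1"
        using half_plane_iff(2)[OF V] 1(1) \<omega> by (simp add: norm_mult)
      show "(\<lambda>n. (?\<phi> ^^ n) z) \<longlonglongrightarrow> \<omega> * (1 - 1 / V)" if "cmod z < 1" for z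
        unfolding iter'[OF that] by (intro tendsto_intros 1(2) Re_u that V)
    qed
  next
    case 2
    show thesis
    proof
      show "(\<lambda>n. (?\<phi> ^^ n) z) \<longlonglongrightarrow> \<omega>" if "cmod z < 1" for z
      proof -
        have "(\<lambda>n. 1 / ((\<lambda>U. A * U + B) ^^ n) (u z)) \<longlonglongrightarrow> 0"
          using tendsto_divide_0[OF tendsto_const 2[OF Re_u[OF that]]] .
        then have "(\<lambda>n. \<omega> * (1 - 1 / ((\<lambda>U. A * U + B) ^^ n) (u z))) \<longlonglongrightarrow> \<omega> * (1 - 0)"
          by (intro tendsto_mult tendsto_diff tendsto_const)
        then show ?thesis unfolding iter'[OF that] by simp
      qed
    qed (rule \<omega>)
  qed
qed

subsection \<open>Elliptic automorphisms\<close>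

lemma deriv_ev_eq:
  assumes "\<And>z. cmod z < 1 \<Longrightarrow> ev f z = F z" "cmod z < 1" "(F has_field_derivative D) (at z)"
  shows "deriv (ev f) z = D"
  by (rule DERIV_imp_deriv, rule has_field_derivative_transform_within_open[OF assms(3), of "ball 0 1"])
    (use assms in auto)

section \<open>Gram matrix of the kernels at one point\<close>

lemma kernel_inner_products:
  assumes w: "cmod w < 1" and c: "c = 1 - w * cnj w"
  shows "cinner (kern w) (kern w) = 1 / c"
    and "cinner (dkern w) (kern w) = w / c\<^sup>2"
    and "cinner (dkern w) (dkern w) = (1 + w * cnj w) / c ^ 3"
    and "cinner (ddkern w) (kern w) = w\<^sup>2 / c ^ 3"
    and "cinner (ddkern w) (dkern w) = w * (2 + w * cnj w) / c ^ 4"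
    and "cinner (ddkern w) (ddkern w) = (1 + 4 * (w * cnj w) + (w * cnj w)\<^sup>2) / c ^ 5"
proof -
  have c': "1 - cnj w * w = c" by (simp add: c mult.commute)
  have nz: "1 - cnj w * z \<noteq> 0" if "cmod z < 1" for z
    using one_minus_cnj_mult_nonzero[OF w that] .
  show "cinner (kern w) (kern w) = 1 / c" "cinner (dkern w) (kern w) = w / c\<^sup>2"
    "cinner (ddkern w) (kern w) = w\<^sup>2 / c ^ 3"
    using w by (simp_all add: cinner_kern ev_kern ev_dkern ev_ddkern c')
  have D1: "((\<lambda>z. z / (1 - cnj w * z)\<^sup>2) has_field_derivative (1 + cnj w * z) / (1 - cnj w * z) ^ 3) (at z)"
    if "cmod z < 1" for z
  proof -
    have "((\<lambda>z. z / (1 - cnj w * z)\<^sup>2) has_field_derivative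
        ((1 - cnj w * z)\<^sup>2 + z * (2 * (1 - cnj w * z) * cnj w)) / ((1 - cnj w * z)\<^sup>2 * (1 - cnj w * z)\<^sup>2)) (at z)"
      by (rule derivative_eq_intros refl)+ (use nz[OF that] in \<open>simp_all add: mult_ac\<close>)
    also have "((1 - cnj w * z)\<^sup>2 + z * (2 * (1 - cnj w * z) * cnj w)) / ((1 - cnj w * z)\<^sup>2 * (1 - cnj w * z)\<^sup>2) =
        (1 + cnj w * z) / (1 - cnj w * z) ^ 3"
      using nz[OF that] by (subst frac_eq_eq) (simp_all, algebra)
    finally show ?thesis .
  qed
  have "deriv (ev (dkern w)) w = (1 + cnj w * w) / (1 - cnj w * w) ^ 3"
    by (rule deriv_ev_eq[OF ev_dkern[OF w] w D1[OF w]])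
  then show "cinner (dkern w) (dkern w) = (1 + w * cnj w) / c ^ 3"
    unfolding cinner_dkern(1)[OF w] c' by (simp add: mult.commute)
  have D2: "((\<lambda>z. z\<^sup>2 / (1 - cnj w * z) ^ 3) has_field_derivative
      (2 * z + cnj w * z\<^sup>2) / (1 - cnj w * z) ^ 4) (at z)"
    if "cmod z < 1" for z
  proof -
    have "((\<lambda>z. z\<^sup>2 / (1 - cnj w * z) ^ 3) has_field_derivative
        (2 * z * (1 - cnj w * z) ^ 3 + z\<^sup>2 * (3 * (1 - cnj w * z)\<^sup>2 * cnj w)) /
          ((1 - cnj w * z) ^ 3 * (1 - cnj w * z) ^ 3)) (at z)"
      by (rule derivative_eq_intros refl)+ (use nz[OF that] in \<open>simp_all add: mult_ac\<close>)
    also have "(2 * z * (1 - cnj w * z) ^ 3 + z\<^sup>2 * (3 * (1 - cnj w * z)\<^sup>2 * cnj w)) /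
          ((1 - cnj w * z) ^ 3 * (1 - cnj w * z) ^ 3) = (2 * z + cnj w * z\<^sup>2) / (1 - cnj w * z) ^ 4"
      using nz[OF that] by (subst frac_eq_eq) (simp_all, algebra)
    finally show ?thesis .
  qed
  have dd: "deriv (ev (ddkern w)) z = (2 * z + cnj w * z\<^sup>2) / (1 - cnj w * z) ^ 4" if "cmod z < 1" for z
    by (rule deriv_ev_eq[OF ev_ddkern[OF w] that D2[OF that]])
  show "cinner (ddkern w) (dkern w) = w * (2 + w * cnj w) / c ^ 4"
    unfolding cinner_dkern(1)[OF w] dd[OF w] c' by (simp add: power2_eq_square algebra_simps)
  have "((\<lambda>z. (2 * z + cnj w * z\<^sup>2) / (1 - cnj w * z) ^ 4) has_field_derivative
      ((2 + cnj w * (2 * w)) * (1 - cnj w * w) ^ 4 + (2 * w + cnj w * w\<^sup>2) * (4 * (1 - cnj w * w) ^ 3 * cnj w)) /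
        ((1 - cnj w * w) ^ 4 * (1 - cnj w * w) ^ 4)) (at w)"
    by (rule derivative_eq_intros refl)+ (use nz[OF w] in \<open>simp_all add: mult_ac\<close>)
  also have "((2 + cnj w * (2 * w)) * (1 - cnj w * w) ^ 4 + (2 * w + cnj w * w\<^sup>2) * (4 * (1 - cnj w * w) ^ 3 * cnj w)) /
        ((1 - cnj w * w) ^ 4 * (1 - cnj w * w) ^ 4) =
      (2 * (1 + 4 * (w * cnj w) + (w * cnj w)\<^sup>2)) / (1 - cnj w * w) ^ 5"
    using nz[OF w] by (subst frac_eq_eq) (simp_all, algebra)
  finally have D3: "((\<lambda>z. (2 * z + cnj w * z\<^sup>2) / (1 - cnj w * z) ^ 4) has_field_derivative
      (2 * (1 + 4 * (w * cnj w) + (w * cnj w)\<^sup>2)) / c ^ 5) (at w)" unfolding c' .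
  have half: "2 * x / y / 2 = x / y" for x y :: complex by simp
  have "deriv (deriv (ev (ddkern w))) w = (2 * (1 + 4 * (w * cnj w) + (w * cnj w)\<^sup>2)) / c ^ 5"
    by (rule DERIV_imp_deriv, rule has_field_derivative_transform_within_open[OF D3, of "ball 0 1"])
      (use w dd in auto)
  then show "cinner (ddkern w) (ddkern w) = (1 + 4 * (w * cnj w) + (w * cnj w)\<^sup>2) / c ^ 5"
    by (simp only: cinner_dkern(2)[OF w] half)
qed

lemma kernel_norms:
  assumes w: "cmod w < 1"
  shows "(norm (kern w))\<^sup>2 = 1 / (1 - (cmod w)\<^sup>2)"
    and "(norm (dkern w))\<^sup>2 = (1 + (cmod w)\<^sup>2) / (1 - (cmod w)\<^sup>2) ^ 3"
    and "(norm (ddkern w))\<^sup>2 = (1 + 4 * (cmod w)\<^sup>2 + ((cmod w)\<^sup>2)\<^sup>2) / (1 - (cmod w)\<^sup>2) ^ 5"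
proof -
  note ip = kernel_inner_products[OF w refl, folded complex_norm_square]
  have "complex_of_real ((norm (kern w))\<^sup>2) = complex_of_real (1 / (1 - (cmod w)\<^sup>2))"
    using ip(1) unfolding cinner_self by simp
  then show "(norm (kern w))\<^sup>2 = 1 / (1 - (cmod w)\<^sup>2)" unfolding of_real_eq_iff .
  have "complex_of_real ((norm (dkern w))\<^sup>2) = complex_of_real ((1 + (cmod w)\<^sup>2) / (1 - (cmod w)\<^sup>2) ^ 3)"
    using ip(3) unfolding cinner_self by simp
  then show "(norm (dkern w))\<^sup>2 = (1 + (cmod w)\<^sup>2) / (1 - (cmod w)\<^sup>2) ^ 3" unfolding of_real_eq_iff .
  have "complex_of_real ((norm (ddkern w))\<^sup>2) =
      complex_of_real ((1 + 4 * (cmod w)\<^sup>2 + ((cmod w)\<^sup>2)\<^sup>2) / (1 - (cmod w)\<^sup>2) ^ 5)"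
    using ip(6) unfolding cinner_self by simp
  then show "(norm (ddkern w))\<^sup>2 = (1 + 4 * (cmod w)\<^sup>2 + ((cmod w)\<^sup>2)\<^sup>2) / (1 - (cmod w)\<^sup>2) ^ 5"
    unfolding of_real_eq_iff .
qed

lemma norm_sq_minus_orthogonal:
  assumes "cinner a b = 0"
  shows "(norm (a - c *\<^sub>C b))\<^sup>2 = (norm a)\<^sup>2 + (cmod c)\<^sup>2 * (norm b)\<^sup>2"
proof -
  have "cinner (a - c *\<^sub>C b) (a - c *\<^sub>C b) = cinner a a + c * cnj c * cinner b b"
    using assms cinner_commute[of b a] by (simp add: cinner_minus_left cinner_minus_right)
  then have "complex_of_real ((norm (a - c *\<^sub>C b))\<^sup>2) =
      complex_of_real ((norm a)\<^sup>2 + (cmod c)\<^sup>2 * (norm b)\<^sup>2)"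
    unfolding cinner_self complex_norm_square[symmetric] by simp
  then show ?thesis unfolding of_real_eq_iff .
qed

lemma norm_sq_backshift: "(norm (backshift f))\<^sup>2 = (norm f)\<^sup>2 - (cmod (coef f 0))\<^sup>2"
proof -
  have "complex_of_real ((norm f)\<^sup>2) = complex_of_real ((cmod (coef f 0))\<^sup>2 + (norm (backshift f))\<^sup>2)"
    unfolding cinner_self[symmetric] of_real_add complex_norm_square by (rule cinner_split)
  then show ?thesis unfolding of_real_eq_iff by simp
qed

text \<open>
  In the basis \<open>W z\<^sup>n\<close> an eigenvector of the adjoint of an elliptic automorphism is \<open>a - p B a\<close>
  up to a scalar, where \<open>B\<close> is the backward shift and \<open>a\<close> is supported on the exponents \<open>n\<close> with
  \<open>\<eta>\<^sup>n = \<mu>\<close>.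
\<close>

lemma elliptic_adjoint_eigenvector:
  assumes p: "cmod p < 1" and T: "composes_with T \<phi>" and self: "\<And>z. cmod z < 1 \<Longrightarrow> cmod (\<phi> z) < 1"
    and \<phi>: "\<And>z. cmod z < 1 \<Longrightarrow> blaschke p (\<phi> z) = \<eta> * blaschke p z"
    and W: "bounded_clinear W"
    "\<And>f z. cmod z < 1 \<Longrightarrow>
       ev (W f) z = complex_of_real (sqrt (1 - (cmod p)\<^sup>2)) / (1 - cnj p * z) * ev f (blaschke p z)"
    "\<And>f g. cinner (W f) (W g) = cinner f g" "\<And>f. W (W f) = f"
    and v: "\<And>f. cinner (T f) v = \<mu> * cinner f v"
  obtains a where "W v = (1 / complex_of_real (sqrt (1 - (cmod p)\<^sup>2))) *\<^sub>C (a - p *\<^sub>C backshift a)"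
    "\<And>n. \<eta> ^ n \<noteq> \<mu> \<Longrightarrow> coef a n = 0"
proof -
  define s where "s = complex_of_real (sqrt (1 - (cmod p)\<^sup>2))"
  have p2: "(cmod p)\<^sup>2 < 1" using p by (simp add: power_less_one_iff)
  have s0: "s \<noteq> 0" using p2 by (simp add: s_def)
  have "s * s = complex_of_real (1 - (cmod p)\<^sup>2)"
    using p2 unfolding s_def of_real_mult[symmetric] by simp
  then have s2: "s * s = 1 - p * cnj p"
    by (simp only: of_real_diff of_real_1 complex_norm_square)
  obtain R where R: "bounded_clinear R" "composes_with R (blaschke p)"
    using bounded_composition_operator[OF blaschke_holomorphic[OF p]] cmod_blaschke_less_1[OF p] by blast
  obtain Rs where Rs: "bounded_clinear Rs" "\<And>f g. cinner (R f) g = cinner f (Rs g)"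
    using adjoint_exists[OF R(1)] by blast
  \<comment> \<open>The coefficients of \<open>a\<close> pair \<open>v\<close> with the powers of
    the Blaschke factor, which are eigenvectors of \<open>T\<close> for the eigenvalues
    \<open>\<eta> ^ n\<close>; this confines the support of \<open>a\<close>.\<close>
  define a where "a = Rs v"
  have coa: "coef a n = cnj (cinner (R (zpow n)) v)" for n
  proof -
    have "coef a n = cinner a (zpow n)" by simp
    also have "\<dots> = cnj (cinner (zpow n) a)" by (rule cinner_commute)
    finally show ?thesis by (simp add: a_def Rs(2))
  qed
  have "T (R (zpow n)) = \<eta> ^ n *\<^sub>C R (zpow n)" for n
  proof (rule ev_eqI)
    fix z :: complex assume z: "cmod z < 1"
    show "ev (T (R (zpow n))) z = ev (\<eta> ^ n *\<^sub>C R (zpow n)) z"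
      using z by (simp add: composes_withD[OF T] composes_withD[OF R(2)] self \<phi> power_mult_distrib)
  qed
  then have "(\<eta> ^ n - \<mu>) * cinner (R (zpow n)) v = 0" for n
    using v[of "R (zpow n)"] by (simp add: left_diff_distrib)
  then have supp: "coef a n = 0" if "\<eta> ^ n \<noteq> \<mu>" for n
    using that unfolding coa by (metis complex_cnj_zero mult_eq_0_iff right_minus_eq)
  \<comment> \<open>The weight of \<open>W\<close> is affine in the Blaschke factor, so each
    monomial goes to a combination of two consecutive powers. This is where the backward shift comes
    from.\<close>
  have Wz: "W (zpow n) = (1 / s) *\<^sub>C (R (zpow n) - cnj p *\<^sub>C R (zpow (Suc n)))" for n
  proof (rule ev_eqI)
    fix z :: complex assume z: "cmod z < 1"
    have e: "s / (1 - cnj p * z) = (1 / s) * (1 - cnj p * blaschke p z)"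
      unfolding one_minus_mult_blaschke[OF p z] s2[symmetric] using s0 by simp
    have "ev (W (zpow n)) z = s / (1 - cnj p * z) * blaschke p z ^ n"
      using z by (simp add: W(2)[folded s_def])
    also have "\<dots> = (1 / s) * (blaschke p z ^ n - cnj p * blaschke p z ^ Suc n)"
      unfolding e by (simp add: algebra_simps)
    also have "\<dots> = ev ((1 / s) *\<^sub>C (R (zpow n) - cnj p *\<^sub>C R (zpow (Suc n)))) z"
      using z by (simp add: composes_withD[OF R(2)])
    finally show "ev (W (zpow n)) z = ev ((1 / s) *\<^sub>C (R (zpow n) - cnj p *\<^sub>C R (zpow (Suc n)))) z" .
  qed
  have "W v = (1 / s) *\<^sub>C (a - p *\<^sub>C backshift a)"
  proof (rule ell2_eqI)
    fix n
    have "coef (W v) n = cinner (W v) (zpow n)" by simp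
    also have "\<dots> = cinner v (W (zpow n))" using W(3)[of "W v" "zpow n"] by (simp add: W(4))
    also have "\<dots> = cnj (cinner (W (zpow n)) v)" by (rule cinner_commute)
    also have "\<dots> = (1 / s) * (coef a n - p * coef a (Suc n))"
      unfolding Wz by (simp add: cinner_minus_left coa) (simp add: s_def)
    finally show "coef (W v) n = coef ((1 / s) *\<^sub>C (a - p *\<^sub>C backshift a)) n" by simp
  qed
  then show thesis using that supp unfolding s_def by blast
qed

text \<open>\<open>C M C\<close> is a linear isometry carrying \<open>kern p\<close> and
  \<open>dkern p\<close> to \<open>g1\<close> and \<open>g2\<close>, which are eigenvectors of the
  adjoint for \<open>\<eta>\<close> and \<open>\<eta>\<^sup>2\<close>; so their norms and the
  modulus of their inner product are known. In their expansions a single cross term survives, and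
  Cauchy-Schwarz for it, squared, contradicts the known values by the factor
  \<open>1 + P\<close>.\<close>

lemma elliptic_not_complex_symmetric:
  assumes p: "cmod p < 1" "p \<noteq> 0" and T: "composes_with T \<phi>" and C: "conjugation C"
    and adj: "\<And>f g. cinner (T f) g = cinner f (Ts g)" and TC: "\<And>f. T f = C (Ts (C f))"
    and hol: "\<phi> holomorphic_on ball 0 1" and self: "\<And>z. cmod z < 1 \<Longrightarrow> cmod (\<phi> z) < 1"
    and \<phi>: "\<And>z. cmod z < 1 \<Longrightarrow> blaschke p (\<phi> z) = \<eta> * blaschke p z"
    and fixp: "\<phi> p = p" "deriv \<phi> p = \<eta>" and \<eta>: "\<eta> \<noteq> 0" "\<eta>\<^sup>2 \<noteq> 1"
  shows False
proof -
  define P where "P = (cmod p)\<^sup>2"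
  have P: "0 < P" "P < 1" using p by (simp_all add: P_def power_less_one_iff)
  have Pc: "complex_of_real P = p * cnj p" unfolding P_def by (rule complex_norm_square)
  have \<eta>1: "\<eta> \<noteq> 1" using \<eta> by auto
  obtain M where M: "bounded_clinear M" "\<And>f z. cmod z < 1 \<Longrightarrow> ev (M f) z = blaschke p z * ev f z"
    "\<And>f g. cinner (M f) (M g) = cinner f g" using multiplication_by_blaschke[OF p(1)] by blast
  define s where "s = complex_of_real (sqrt (1 - (cmod p)\<^sup>2))"
  obtain W where W: "bounded_clinear W"
    "\<And>f z. cmod z < 1 \<Longrightarrow> ev (W f) z = s / (1 - cnj p * z) * ev f (blaschke p z)"
    "\<And>f g. cinner (W f) (W g) = cinner f g" "\<And>f. W (W f) = f"
    unfolding s_def using weighted_blaschke_composition[OF p(1)] by blast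
  have s2: "(cmod s)\<^sup>2 = 1 - P" using P by (simp add: s_def P_def)
  have k: "cinner (T f) (kern p) = 1 * cinner f (kern p)" for f
    by (simp add: cinner_kern p composes_withD[OF T] fixp)
  have d: "cinner (T f) (dkern p) = \<eta> * cinner f (dkern p)" for f
  proof -
    have "deriv (ev (T f)) p = deriv (\<lambda>z. ev f (\<phi> z)) p"
      by (rule deriv_cong_ev[OF _ refl])
        (use eventually_nhds_in_open[of "ball 0 1" p] p in \<open>auto elim!: eventually_mono simp: composes_withD[OF T]\<close>)
    also have "\<dots> = deriv (ev f) (\<phi> p) * deriv \<phi> p"
      using hol ev_holomorphic[of f] p fixp
      by (intro deriv_chain[unfolded o_def]) (auto simp: holomorphic_on_imp_differentiable_at)
    finally show ?thesis by (simp add: cinner_dkern p fixp)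
  qed
  have T1: "T (M (C v)) = (\<eta> * \<mu>) *\<^sub>C M (C v)"
    if v: "\<And>f. cinner (T f) v = \<mu> * cinner f v" for v \<mu>
    by (rule ev_eqI) (simp add: composes_withD[OF T] M self \<phi>
        conjugation_of_adjoint_eigenvector[OF T C adj TC v])
  define g1 where "g1 = C (M (C (kern p)))"
  define g2 where "g2 = C (M (C (dkern p)))"
  have g1: "cinner (T f) g1 = \<eta> * cinner f g1" for f
    unfolding g1_def using conjugation_of_eigenvector[OF C adj TC T1[OF k]] by simp
  have g2: "cinner (T f) g2 = \<eta>\<^sup>2 * cinner f g2" for f
    unfolding g2_def using conjugation_of_eigenvector[OF C adj TC T1[OF d]] by (simp add: power2_eq_square)
  obtain a where a: "W g1 = (1 / s) *\<^sub>C (a - p *\<^sub>C backshift a)" "\<And>n. \<eta> ^ n \<noteq> \<eta> \<Longrightarrow> coef a n = 0"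
    unfolding s_def using elliptic_adjoint_eigenvector[OF p(1) T self \<phi> W[unfolded s_def] g1] by blast
  obtain b where b: "W g2 = (1 / s) *\<^sub>C (b - p *\<^sub>C backshift b)" "\<And>n. \<eta> ^ n \<noteq> \<eta>\<^sup>2 \<Longrightarrow> coef b n = 0"
    unfolding s_def using elliptic_adjoint_eigenvector[OF p(1) T self \<phi> W[unfolded s_def] g2] by blast
  have orth: "cinner x y = 0" if "\<And>n. coef x n = 0 \<or> coef y n = 0" for x y
  proof -
    have "coef x n * cnj (coef y n) = 0" for n using that[of n] by auto
    then show ?thesis unfolding cinner_def by (simp only: suminf_zero)
  qed
  have supp: "\<eta> ^ n = \<eta>" if "coef a n \<noteq> 0" for n using a(2) that by blast
  have supp': "\<eta> ^ n = \<eta>\<^sup>2" if "coef b n \<noteq> 0" for n using b(2) that by blast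
  have aa: "cinner a (backshift a) = 0"
  proof (rule orth, rule ccontr)
    fix n assume "\<not> (coef a n = 0 \<or> coef (backshift a) n = 0)"
    then have "\<eta> ^ n = \<eta>" "\<eta> * \<eta> ^ n = \<eta>" using supp[of n] supp[of "Suc n"] supp'[of n] supp'[of "Suc n"] by simp_all
    then show False using \<eta> \<eta>1 by (auto simp: power2_eq_square)
  qed
  have bb: "cinner b (backshift b) = 0"
  proof (rule orth, rule ccontr)
    fix n assume "\<not> (coef b n = 0 \<or> coef (backshift b) n = 0)"
    then have "\<eta> ^ n = \<eta>\<^sup>2" "\<eta> * \<eta> ^ n = \<eta>\<^sup>2" using supp[of n] supp[of "Suc n"] supp'[of n] supp'[of "Suc n"] by simp_all
    then show False using \<eta> \<eta>1 by (auto simp: power2_eq_square)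
  qed
  have ab: "cinner a b = 0"
  proof (rule orth, rule ccontr)
    fix n assume "\<not> (coef a n = 0 \<or> coef b n = 0)"
    then have "\<eta> ^ n = \<eta>" "\<eta> ^ n = \<eta>\<^sup>2" using supp[of n] supp[of "Suc n"] supp'[of n] supp'[of "Suc n"] by simp_all
    then show False using \<eta> \<eta>1 by (auto simp: power2_eq_square)
  qed
  \<comment> \<open>A common exponent would satisfy \<open>\<eta> ^ n = 1\<close> and
    \<open>\<eta> ^ n = \<eta>\<^sup>2\<close>. This is where the multiplier \<open>-1\<close> is
    excluded.\<close>
  have Bab: "cinner (backshift a) b = 0"
  proof (rule orth, rule ccontr)
    fix n assume "\<not> (coef (backshift a) n = 0 \<or> coef b n = 0)"
    then have "\<eta> * \<eta> ^ n = \<eta>" "\<eta> ^ n = \<eta>\<^sup>2" using supp[of n] supp[of "Suc n"] supp'[of n] supp'[of "Suc n"] by simp_all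
    then show False using \<eta> \<eta>1 by (auto simp: power2_eq_square)
  qed
  have BaBb: "cinner (backshift a) (backshift b) = 0"
  proof (rule orth, rule ccontr)
    fix n assume "\<not> (coef (backshift a) n = 0 \<or> coef (backshift b) n = 0)"
    then have "\<eta> ^ Suc n = \<eta>" "\<eta> ^ Suc n = \<eta>\<^sup>2" using supp[of "Suc n"] supp'[of "Suc n"] by auto
    then have "\<eta> = \<eta>\<^sup>2" by metis
    then show False using \<eta> \<eta>1 by (simp add: power2_eq_square)
  qed
  have a0: "coef a 0 = 0" and b0: "coef b 0 = 0" using a(2)[of 0] b(2)[of 0] \<eta> \<eta>1 by auto
  have nW: "norm (W f) = norm f" for f
    using W(3)[of f f] unfolding cinner_self of_real_eq_iff by (simp add: power2_eq_iff_nonneg)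
  have nv: "(norm v)\<^sup>2 * (1 - P) = (1 + P) * (norm c)\<^sup>2"
    if Wv: "W v = (1 / s) *\<^sub>C (c - p *\<^sub>C backshift c)" and c: "cinner c (backshift c) = 0" "coef c 0 = 0" for v c
  proof -
    have "(norm v)\<^sup>2 = (norm ((1 / s) *\<^sub>C (c - p *\<^sub>C backshift c)))\<^sup>2"
      unfolding Wv[symmetric] nW ..
    also have "\<dots> = (1 / (cmod s)\<^sup>2) * (norm (c - p *\<^sub>C backshift c))\<^sup>2"
      unfolding norm_scaleC power_mult_distrib by (simp add: norm_divide power_divide)
    also have "(norm (c - p *\<^sub>C backshift c))\<^sup>2 = (1 + P) * (norm c)\<^sup>2"
      unfolding norm_sq_minus_orthogonal[OF c(1)] norm_sq_backshift c(2) P_def by (simp add: algebra_simps)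
    finally show ?thesis unfolding s2 using P by simp
  qed
  note na = nv[OF a(1) aa a0] and nb = nv[OF b(1) bb b0]
  have "cmod (cinner g1 g2) * (1 - P) = cmod p * cmod (cinner a (backshift b))"
  proof -
    have "cinner g1 g2 = cinner (W g1) (W g2)" by (simp add: W(3))
    \<comment> \<open>The exponents of \<open>a\<close> and of \<open>backshift b\<close> both
      satisfy \<open>\<eta> ^ n = \<eta>\<close>, so this is the one term that need not
      vanish.\<close>
    also have "\<dots> = (1 / s) * cnj (1 / s) * (- (cnj p * cinner a (backshift b)))"
      unfolding a(1) b(1) by (simp add: cinner_minus_left cinner_minus_right ab Bab BaBb)
    finally have "cmod (cinner g1 g2) = (1 / (cmod s)\<^sup>2) * (cmod p * cmod (cinner a (backshift b)))"
      by (simp add: norm_mult norm_divide power2_eq_square)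
    then show ?thesis unfolding s2 using P by simp
  qed
  moreover have "cmod (cinner a (backshift b)) \<le> norm a * norm b"
  proof -
    have "norm (backshift b) = norm b"
      by (rule power2_eq_imp_eq) (simp_all add: norm_sq_backshift b0)
    then show ?thesis using cmod_cinner_le[of a "backshift b"] by simp
  qed
  ultimately have "cmod (cinner g1 g2) * (1 - P) \<le> cmod p * (norm a * norm b)"
    by (simp add: mult_left_mono)
  then have "(cmod (cinner g1 g2) * (1 - P))\<^sup>2 \<le> (cmod p * (norm a * norm b))\<^sup>2"
    using P by (intro power_mono) auto
  then have le: "(cmod (cinner g1 g2))\<^sup>2 * (1 - P)\<^sup>2 \<le> P * ((norm a)\<^sup>2 * (norm b)\<^sup>2)"
    by (simp add: power_mult_distrib P_def)
  have "cmod (cinner g1 g2) = cmod (cinner (dkern p) (kern p))"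
    unfolding g1_def g2_def by (simp add: conjugation_cinner[OF C] M(3)) (metis cinner_commute complex_mod_cnj)
  also have "cinner (dkern p) (kern p) = p / (complex_of_real (1 - P))\<^sup>2"
    by (simp add: cinner_kern p ev_dkern Pc mult.commute)
  finally have "cmod (cinner g1 g2) = cmod p / (1 - P)\<^sup>2"
    unfolding norm_divide norm_power norm_of_real using P by simp
  then have G: "(cmod (cinner g1 g2))\<^sup>2 = P / (1 - P) ^ 4"
    by (simp only: power_divide P_def[symmetric]) (simp flip: power_mult)
  have nM: "norm (M f) = norm f" for f
    using M(3)[of f f] unfolding cinner_self of_real_eq_iff by (simp add: power2_eq_iff_nonneg)
  have "norm g1 = norm (kern p)" "norm g2 = norm (dkern p)"
    by (simp_all add: g1_def g2_def conjugation_norm[OF C] nM)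
  then have N: "(norm g1)\<^sup>2 = 1 / (1 - P)" "(norm g2)\<^sup>2 = (1 + P) / (1 - P) ^ 3"
    using kernel_norms[OF p(1)] by (simp_all add: P_def)
  have "(norm a)\<^sup>2 = 1 / (1 + P)" using na P unfolding N by (simp add: field_simps)
  moreover have "(norm b)\<^sup>2 = 1 / (1 - P)\<^sup>2"
  proof -
    have "(1 + P) / (1 - P) ^ 3 * (1 - P) = (1 + P) * (1 / (1 - P)\<^sup>2)"
      using P by (simp add: power3_eq_cube power2_eq_square)
    then have "(1 + P) * (norm b)\<^sup>2 = (1 + P) * (1 / (1 - P)\<^sup>2)" using nb unfolding N by simp
    moreover have "1 + P \<noteq> 0" using P by simp
    ultimately show ?thesis using mult_left_cancel by blast
  qed
  moreover have "P / (1 - P) ^ 4 * (1 - P)\<^sup>2 = P * (1 / (1 - P)\<^sup>2)"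
    using P by (simp add: power4_eq_xxxx power2_eq_square)
  ultimately have "P * (1 / (1 - P)\<^sup>2) \<le> P * (1 / (1 - P)\<^sup>2) * (1 / (1 + P))"
    using le unfolding G by (simp add: mult_ac)
  moreover have "P * (1 / (1 - P)\<^sup>2) > 0" using P by simp
  ultimately have "1 \<le> 1 / (1 + P)" by (metis mult.right_neutral mult_le_cancel_left_pos)
  then show False using P by (simp add: field_simps)
qed

subsection \<open>Attracting fixed points\<close>

lemma deriv_deriv_compose:
  assumes f: "f holomorphic_on ball 0 1" and \<phi>: "\<phi> holomorphic_on ball 0 1"
    and self: "\<And>z. cmod z < 1 \<Longrightarrow> cmod (\<phi> z) < 1" and p: "cmod p < 1"
  shows "deriv (\<lambda>z. f (\<phi> z)) p = deriv f (\<phi> p) * deriv \<phi> p"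
    and "deriv (deriv (\<lambda>z. f (\<phi> z))) p =
      deriv (deriv f) (\<phi> p) * (deriv \<phi> p)\<^sup>2 + deriv f (\<phi> p) * deriv (deriv \<phi>) p"
proof -
  have D: "(g has_field_derivative deriv g z) (at z)" if "g holomorphic_on ball 0 1" "cmod z < 1" for g z
    by (rule holomorphic_derivI[OF that(1) open_ball]) (use that in simp)
  have D1: "deriv (\<lambda>z. f (\<phi> z)) z = deriv f (\<phi> z) * deriv \<phi> z" if "cmod z < 1" for z
    by (rule DERIV_imp_deriv, rule DERIV_chain2[OF D[OF f self[OF that]] D[OF \<phi> that]])
  then show "deriv (\<lambda>z. f (\<phi> z)) p = deriv f (\<phi> p) * deriv \<phi> p" using p by blast
  have f': "deriv f holomorphic_on ball 0 1" and \<phi>': "deriv \<phi> holomorphic_on ball 0 1"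
    by (rule holomorphic_deriv[OF f open_ball] holomorphic_deriv[OF \<phi> open_ball])+
  have D2: "((\<lambda>z. deriv f (\<phi> z) * deriv \<phi> z) has_field_derivative
      deriv f (\<phi> p) * deriv (deriv \<phi>) p + (deriv (deriv f) (\<phi> p) * deriv \<phi> p) * deriv \<phi> p) (at p)"
    by (rule DERIV_mult'[OF DERIV_chain2[OF D[OF f' self[OF p]] D[OF \<phi> p]] D[OF \<phi>' p]])
  have "deriv (deriv (\<lambda>z. f (\<phi> z))) p =
      deriv f (\<phi> p) * deriv (deriv \<phi>) p + (deriv (deriv f) (\<phi> p) * deriv \<phi> p) * deriv \<phi> p"
    by (rule DERIV_imp_deriv[OF has_field_derivative_transform_within_open[OF D2, of "ball 0 1"]])
      (use D1 p in auto)
  then show "deriv (deriv (\<lambda>z. f (\<phi> z))) p =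
      deriv (deriv f) (\<phi> p) * (deriv \<phi> p)\<^sup>2 + deriv f (\<phi> p) * deriv (deriv \<phi>) p"
    by (simp add: power2_eq_square)
qed

text \<open>The second derivative of \<open>f \<circ> \<phi>\<close> at \<open>p\<close> involves
  both the second and the first derivative of \<open>f\<close>, so the adjoint acts on the last two
  kernels by a triangular matrix with diagonal entries from \<open>\<mu>\<^sup>2\<close> and
  \<open>\<mu>\<close>. The combination \<open>v\<close> diagonalizes it.\<close>

lemma adjoint_eigenvectors_at_fixed_point:
  assumes T: "composes_with T \<phi>" and hol: "\<phi> holomorphic_on ball 0 1"
    and self: "\<And>z. cmod z < 1 \<Longrightarrow> cmod (\<phi> z) < 1"
    and p: "cmod p < 1" "\<phi> p = p" and \<mu>: "deriv \<phi> p = \<mu>"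
    and r: "r holomorphic_on ball 0 1" "r p = 1"
    and B: "\<And>z. cmod z < 1 \<Longrightarrow> \<phi> z - p = \<mu> * r z * (z - p)"
    and A: "\<And>z. cmod z < 1 \<Longrightarrow> 1 - t * \<phi> z = r z * (1 - t * z)"
  shows "cinner (T f) (kern p) = cinner f (kern p)"
    and "cinner (T f) (dkern p) = \<mu> * cinner f (dkern p)"
    and "v = cnj (1 - t * p) *\<^sub>C ddkern p - cnj t *\<^sub>C dkern p \<Longrightarrow> cinner (T f) v = \<mu>\<^sup>2 * cinner f v"
proof -
  have near: "\<forall>\<^sub>F z in nhds p. cmod z < 1"
    using eventually_nhds_in_open[of "ball 0 1" p] p by (auto elim: eventually_mono)
  have evT: "\<forall>\<^sub>F z in nhds p. ev (T f) z = ev f (\<phi> z)" for f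
    using near by (rule eventually_mono) (simp add: composes_withD[OF T])
  have d1: "deriv (ev (T f)) p = deriv (ev f) p * \<mu>" for f
    using deriv_deriv_compose(1)[OF ev_holomorphic hol self p(1), of f] deriv_cong_ev[OF evT refl, of f] p \<mu>
    by simp
  have "(deriv ^^ 2) (ev (T f)) p = (deriv ^^ 2) (\<lambda>z. ev f (\<phi> z)) p" for f
    by (rule higher_deriv_cong_ev[OF evT refl])
  then have d2: "deriv (deriv (ev (T f))) p =
      deriv (deriv (ev f)) p * \<mu>\<^sup>2 + deriv (ev f) p * deriv (deriv \<phi>) p" for f
    using deriv_deriv_compose(2)[OF ev_holomorphic hol self p(1), of f] p \<mu>
    by (simp add: numeral_2_eq_2)
  have D: "(g has_field_derivative deriv g z) (at z)" if "g holomorphic_on ball 0 1" "cmod z < 1" for g z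
    by (rule holomorphic_derivI[OF that(1) open_ball]) (use that in simp)
  have r': "deriv r holomorphic_on ball 0 1" by (rule holomorphic_deriv[OF r(1) open_ball])
  have \<phi>': "deriv \<phi> z = \<mu> * (deriv r z * (z - p) + r z)" if z: "cmod z < 1" for z
  proof (rule DERIV_imp_deriv, rule has_field_derivative_transform_within_open[of _ _ z "ball 0 1"])
    show "((\<lambda>z. p + \<mu> * (r z * (z - p))) has_field_derivative \<mu> * (deriv r z * (z - p) + r z)) (at z)"
      by (auto intro!: derivative_eq_intros D[OF r(1) z])
    show "p + \<mu> * (r z * (z - p)) = \<phi> z" if "z \<in> ball 0 1" for z
      using B[of z] that by (simp add: algebra_simps)
  qed (use z in auto)
  have "deriv (deriv \<phi>) p = \<mu> * (deriv r p + deriv r p)"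
  proof (rule DERIV_imp_deriv, rule has_field_derivative_transform_within_open[of _ _ p "ball 0 1"])
    show "((\<lambda>z. \<mu> * (deriv r z * (z - p) + r z)) has_field_derivative \<mu> * (deriv r p + deriv r p)) (at p)"
      by (auto intro!: derivative_eq_intros D[OF r(1) p(1)] D[OF r' p(1)])
    show "\<mu> * (deriv r z * (z - p) + r z) = deriv \<phi> z" if "z \<in> ball 0 1" for z
      using \<phi>'[of z] that by simp
  qed (use p in auto)
  moreover have "deriv r p * (1 - t * p) - t = - (t * \<mu>)"
  proof -
    have "((\<lambda>z. r z * (1 - t * z)) has_field_derivative deriv r p * (1 - t * p) - t) (at p)"
      by (auto intro!: derivative_eq_intros D[OF r(1) p(1)] simp: r(2))
    moreover have "((\<lambda>z. r z * (1 - t * z)) has_field_derivative - (t * \<mu>)) (at p)"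
    proof (rule has_field_derivative_transform_within_open[of _ _ p "ball 0 1"])
      show "((\<lambda>z. 1 - t * \<phi> z) has_field_derivative - (t * \<mu>)) (at p)"
        using D[OF hol p(1)] \<mu> by (auto intro!: derivative_eq_intros)
    qed (use A p in auto)
    ultimately show ?thesis by (rule DERIV_unique)
  qed
  \<comment> \<open>Eliminating \<open>deriv r p\<close> from the differentiated relations for
    \<open>\<phi> z - p\<close> and \<open>1 - t * \<phi> z\<close> expresses the second derivative
    of the symbol through \<open>\<mu>\<close> and \<open>t\<close>.\<close>
  ultimately have eq: "(1 - t * p) * deriv (deriv \<phi>) p = 2 * \<mu> * (t - t * \<mu>)" by algebra
  show "cinner (T f) (kern p) = cinner f (kern p)"
    by (simp add: cinner_kern p composes_withD[OF T])
  show "cinner (T f) (dkern p) = \<mu> * cinner f (dkern p)"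
    by (simp add: cinner_dkern p d1)
  show "cinner (T f) v = \<mu>\<^sup>2 * cinner f v" if v: "v = cnj (1 - t * p) *\<^sub>C ddkern p - cnj t *\<^sub>C dkern p"
  proof -
    have c: "cinner g v = ((1 - t * p) * deriv (deriv (ev g)) p - 2 * t * deriv (ev g) p) / 2" for g
      unfolding v cinner_minus_right cinner_scaleC_right cinner_dkern[OF p(1)] by (simp add: field_simps)
    have "(1 - t * p) * deriv (deriv (ev (T f))) p - 2 * t * deriv (ev (T f)) p =
        \<mu>\<^sup>2 * ((1 - t * p) * deriv (deriv (ev f)) p - 2 * t * deriv (ev f) p)"
      unfolding d1 d2 using eq by algebra
    then show ?thesis unfolding c by simp
  qed
qed

text \<open>The eigenfunction \<open>C (dkern p)\<close> is a multiple of
  \<open>(z - p) / (1 - t * z)\<close>, whose Taylor coefficients from the first on are geometric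
  with ratio \<open>t\<close>. A nonzero element of \<open>ell2\<close> can have this form only if
  |t| < 1.\<close>

lemma koenigs_pole_outside_closed_disk:
  assumes T: "composes_with T \<phi>" and C: "conjugation C"
    and adj: "\<And>f g. cinner (T f) g = cinner f (Ts g)" and TC: "\<And>f. T f = C (Ts (C f))"
    and hol: "\<phi> holomorphic_on ball 0 1" and self: "\<And>z. cmod z < 1 \<Longrightarrow> cmod (\<phi> z) < 1"
    and p: "cmod p < 1" "\<phi> p = p" and \<mu>: "deriv \<phi> p = \<mu>" "\<mu> \<noteq> 0" "cmod \<mu> < 1"
    and r: "r holomorphic_on ball 0 1" "r p = 1"
    and B: "\<And>z. cmod z < 1 \<Longrightarrow> \<phi> z - p = \<mu> * r z * (z - p)"
    and A: "\<And>z. cmod z < 1 \<Longrightarrow> 1 - t * \<phi> z = r z * (1 - t * z)"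
    and tp: "t * p \<noteq> 1"
  shows "cmod t < 1"
proof -
  have rc: "isCont r p"
    using holomorphic_on_imp_continuous_on[OF r(1)] p by (simp add: continuous_on_eq_continuous_at)
  define x where "x = C (dkern p)"
  have "ev x (\<phi> z) = \<mu> ^ 1 * ev x z" if "cmod z < 1" for z
    unfolding x_def using conjugation_of_adjoint_eigenvector[OF T C adj TC
        adjoint_eigenvectors_at_fixed_point(2)[OF T hol self p \<mu>(1) r B A] that] by simp
  from koenigs_eigenfunction[OF ev_holomorphic hol self p \<mu> rc r(2) B A this]
  obtain c where c: "\<And>z. cmod z < 1 \<Longrightarrow> ev x z * (1 - t * z) = c * (z - p)" by auto
  have "x - t *\<^sub>C shift x = c *\<^sub>C (zpow 1 - p *\<^sub>C zpow 0)"
    by (rule ev_eqI) (use c in \<open>simp add: algebra_simps\<close>)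
  then have co: "coef (x - t *\<^sub>C shift x) n = coef (c *\<^sub>C (zpow 1 - p *\<^sub>C zpow 0)) n" for n by simp
  have x0: "coef x 0 = - (c * p)" using co[of 0] by simp
  have x1: "coef x (Suc 0) = c * (1 - t * p)" using co[of "Suc 0"] x0 by (simp add: algebra_simps)
  have xS: "coef x (Suc n) = t ^ n * (c * (1 - t * p))" for n
  proof (induction n)
    case (Suc n)
    have "coef x (Suc (Suc n)) = t * coef x (Suc n)" using co[of "Suc (Suc n)"] by simp
    then show ?case unfolding Suc.IH by simp
  qed (simp add: x1)
  have "c \<noteq> 0"
  proof
    assume "c = 0"
    then have "coef x n = 0" for n using x0 xS by (cases n) auto
    then have "x = 0" by (intro ell2_eqI) simp
    then have "norm (dkern p) = 0" using conjugation_norm[OF C, of "dkern p"] by (simp add: x_def)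
    then have "(1 + (cmod p)\<^sup>2) / (1 - (cmod p)\<^sup>2) ^ 3 = 0" using kernel_norms(2)[OF p(1)] by simp
    moreover have "1 + (cmod p)\<^sup>2 > 0" by (simp add: add_pos_nonneg)
    moreover have "1 - (cmod p)\<^sup>2 > 0" using p by (simp add: power_less_one_iff)
    ultimately show False by simp
  qed
  then have nz: "cmod (c * (1 - t * p)) \<noteq> 0" using tp by simp
  have "(\<lambda>n. (cmod (coef x (Suc n)))\<^sup>2) \<longlonglongrightarrow> 0"
    by (intro LIMSEQ_Suc summable_LIMSEQ_zero summable_coef_sq)
  then have lim: "(\<lambda>n. (cmod t ^ n * cmod (c * (1 - t * p)))\<^sup>2) \<longlonglongrightarrow> 0"
    by (simp add: xS norm_mult norm_power)
  show ?thesis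
  proof (rule ccontr)
    assume "\<not> cmod t < 1"
    then have "(cmod (c * (1 - t * p)))\<^sup>2 \<le> (cmod t ^ n * cmod (c * (1 - t * p)))\<^sup>2" for n
      using one_le_power[of "cmod t" n] mult_right_mono[of 1 "cmod t ^ n" "cmod (c * (1 - t * p))"]
      by (intro power_mono) auto
    then have "(cmod (c * (1 - t * p)))\<^sup>2 \<le> 0"
      by (intro LIMSEQ_le_const[OF lim]) auto
    then show False using nz by simp
  qed
qed

lemma norm_sq_add:
  "(norm (f + g :: ell2))\<^sup>2 = (norm f)\<^sup>2 + (norm g)\<^sup>2 + 2 * Re (cinner f g)"
  unfolding power2_norm_eq_inner inner_eq_Re_cinner[symmetric] inner_add_left inner_add_right
  using inner_commute[of f g] by simp

text \<open>A conjugation preserves the squared cosine of the angle between two vectors. In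
  cross-multiplied form the unknown scalars \<open>c\<close> and \<open>d\<close> cancel, and no
  norm has to be nonzero.\<close>

lemma gram_ratio:
  assumes C: "conjugation C" and v: "C v = c *\<^sub>C x" and w: "C w = d *\<^sub>C y"
  shows "(cmod (cinner v w))\<^sup>2 * ((norm x)\<^sup>2 * (norm y)\<^sup>2) = (cmod (cinner x y))\<^sup>2 * ((norm v)\<^sup>2 * (norm w)\<^sup>2)"
proof -
  have "cinner w v = c * cnj d * cinner x y"
    using conjugation_cinner[OF C, of v w] unfolding v w by (simp add: mult_ac)
  then have "cmod (cinner v w) = cmod c * cmod d * cmod (cinner x y)"
    using cinner_commute[of v w] by (metis complex_mod_cnj norm_mult)
  moreover have "norm v = cmod c * norm x" "norm w = cmod d * norm y"
    using conjugation_norm[OF C, of v] conjugation_norm[OF C, of w] by (simp_all add: v w)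
  ultimately show ?thesis by (simp add: power_mult_distrib)
qed

text \<open>Let \<open>P\<close>, \<open>\<tau>\<close> and \<open>R\<close> stand for |p|^2, |t|^2
  and \<open>Re (t * p)\<close>. The Gram ratio for the exponents 0 and 1 yields
  \<open>e = 1 - \<tau>\<close>, a linear relation for \<open>R\<close>. Substituted into the ratio
  for 0 and 2, it leaves \<open>\<tau> * (1 + P\<^sup>2) = 0\<close>.\<close>

lemma attracting_fixed_point_pole_at_infinity:
  assumes T: "composes_with T \<phi>" and C: "conjugation C"
    and adj: "\<And>f g. cinner (T f) g = cinner f (Ts g)" and TC: "\<And>f. T f = C (Ts (C f))"
    and hol: "\<phi> holomorphic_on ball 0 1" and self: "\<And>z. cmod z < 1 \<Longrightarrow> cmod (\<phi> z) < 1"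
    and p: "cmod p < 1" "\<phi> p = p" and \<mu>: "deriv \<phi> p = \<mu>" "\<mu> \<noteq> 0" "cmod \<mu> < 1"
    and r: "r holomorphic_on ball 0 1" "r p = 1"
    and B: "\<And>z. cmod z < 1 \<Longrightarrow> \<phi> z - p = \<mu> * r z * (z - p)"
    and A: "\<And>z. cmod z < 1 \<Longrightarrow> 1 - t * \<phi> z = r z * (1 - t * z)"
    and tp: "t * p \<noteq> 1" and p0: "p \<noteq> 0"
  shows "t = 0"
proof -
  have t: "cmod t < 1"
    by (rule koenigs_pole_outside_closed_disk[OF T C adj TC hol self p \<mu> r B A tp])
  have t': "cmod (cnj t) < 1" using t by simp
  have rc: "isCont r p"
    using holomorphic_on_imp_continuous_on[OF r(1)] p by (simp add: continuous_on_eq_continuous_at)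
  define \<epsilon> where "\<epsilon> = 1 - t * p"
  define P where "P = (cmod p)\<^sup>2"
  define \<tau> where "\<tau> = (cmod t)\<^sup>2"
  define e where "e = (cmod \<epsilon>)\<^sup>2"
  define R where "R = Re (t * p)"
  have P: "0 < P" "P < 1" using p p0 by (simp_all add: P_def power_less_one_iff)
  have \<tau>: "0 \<le> \<tau>" "\<tau> < 1" using t by (simp_all add: \<tau>_def power_less_one_iff)
  have Pc: "complex_of_real P = p * cnj p" unfolding P_def by (rule complex_norm_square)
  have tpn: "(cmod (t * p))\<^sup>2 = \<tau> * P" by (simp add: norm_mult power_mult_distrib \<tau>_def P_def)
  have eR: "e = 1 - 2 * R + \<tau> * P"
    unfolding tpn[symmetric] by (simp add: e_def \<epsilon>_def R_def cmod_power2) (simp add: power2_eq_square algebra_simps)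
  have \<kappa>: "Re (t * p * cnj \<epsilon>) = R - \<tau> * P"
    unfolding tpn[symmetric] by (simp add: \<epsilon>_def R_def cmod_power2) (simp add: power2_eq_square algebra_simps)
  define k d dd where "k = kern p" and "d = dkern p" and "dd = ddkern p"
  define v where "v = cnj (1 - t * p) *\<^sub>C dd - cnj t *\<^sub>C d"
  note eig = adjoint_eigenvectors_at_fixed_point[OF T hol self p \<mu>(1) r B A]
  have eig0: "cinner (T f) k = 1 * cinner f k" for f using eig(1) by (simp add: k_def)
  have eig1: "cinner (T f) d = \<mu> * cinner f d" for f using eig(2) by (simp add: d_def)
  have eig2: "cinner (T f) v = \<mu>\<^sup>2 * cinner f v" for f
    by (rule eig(3)[OF _ _ _ v_def[unfolded d_def dd_def]])
  define K D where "K = kern (cnj t)" and "D = dkern (cnj t)"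
  \<comment> \<open>The Koenigs function \<open>(z - p) / (1 - t * z)\<close> with its constant term
    split off, so that its norm is computed from orthogonal parts; \<open>x2\<close> is its square,
    written in the same way.\<close>
  define x1 where "x1 = (- p) *\<^sub>C zpow 0 + \<epsilon> *\<^sub>C shift K"
  define y where "y = (- 2 * p * \<epsilon>) *\<^sub>C K + \<epsilon>\<^sup>2 *\<^sub>C D"
  define x2 where "x2 = p\<^sup>2 *\<^sub>C zpow 0 + shift y"
  have nz: "1 - t * z \<noteq> 0" if "cmod z < 1" for z by (rule one_minus_mult_nonzero[OF t that])
  have ev_x1: "ev x1 z = (z - p) / (1 - t * z)" if z: "cmod z < 1" for z
  proof -
    have "ev x1 z = - p + \<epsilon> * (z / (1 - t * z))"
      using z t' by (simp add: x1_def K_def ev_kern)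
    also have "\<dots> = (- p * (1 - t * z) + \<epsilon> * z) / (1 - t * z)"
    proof -
      have "- p + \<epsilon> * (z / b) = (- p * b + \<epsilon> * z) / b" if "b \<noteq> 0" for b
        using that by (simp add: field_simps)
      then show ?thesis using nz[OF z] by blast
    qed
    also have "- p * (1 - t * z) + \<epsilon> * z = z - p" by (simp add: \<epsilon>_def algebra_simps)
    finally show ?thesis .
  qed
  have ev_x2: "ev x2 z = (z - p)\<^sup>2 / (1 - t * z)\<^sup>2" if z: "cmod z < 1" for z
  proof -
    have "ev x2 z = p\<^sup>2 + z * (- 2 * p * \<epsilon> * (1 / (1 - t * z)) + \<epsilon>\<^sup>2 * (z / (1 - t * z)\<^sup>2))"
      using z t' by (simp add: x2_def y_def K_def D_def ev_kern ev_dkern)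
    also have "\<dots> = (- p + \<epsilon> * (z / (1 - t * z)))\<^sup>2"
      by (simp add: power2_eq_square algebra_simps)
    also have "- p + \<epsilon> * (z / (1 - t * z)) = (z - p) / (1 - t * z)"
      using ev_x1[OF z] z t' by (simp add: x1_def K_def ev_kern)
    finally show ?thesis by (simp add: power_divide)
  qed
  have form: "\<exists>c. C u = c *\<^sub>C x"
    if "\<And>f. cinner (T f) u = \<mu> ^ j * cinner f u" "\<And>z. cmod z < 1 \<Longrightarrow> ev x z = (z - p) ^ j / (1 - t * z) ^ j" for u x j
  proof -
    have "ev (C u) (\<phi> z) = \<mu> ^ j * ev (C u) z" if "cmod z < 1" for z
      by (rule conjugation_of_adjoint_eigenvector[OF T C adj TC \<open>\<And>f. cinner (T f) u = \<mu> ^ j * cinner f u\<close> that])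
    from koenigs_eigenfunction[OF ev_holomorphic hol self p \<mu> rc r(2) B A this]
    obtain c where c: "\<And>z. cmod z < 1 \<Longrightarrow> ev (C u) z * (1 - t * z) ^ j = c * (z - p) ^ j" by blast
    have "C u = c *\<^sub>C x"
    proof (rule ev_eqI)
      fix z :: complex assume z: "cmod z < 1"
      have "(1 - t * z) ^ j \<noteq> 0" using nz[OF z] by simp
      then have "ev (C u) z = c * (z - p) ^ j / (1 - t * z) ^ j"
        using c[OF z] by (simp add: eq_divide_eq)
      then show "ev (C u) z = ev (c *\<^sub>C x) z" using z that(2)[OF z] by simp
    qed
    then show ?thesis by blast
  qed
  obtain c0 where c0: "C k = c0 *\<^sub>C zpow 0"
    using form[of k 0 "zpow 0"] eig0 by auto
  obtain c1 where c1: "C d = c1 *\<^sub>C x1"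
    using form[of d 1 x1] eig1 ev_x1 by auto
  obtain c2 where c2: "C v = c2 *\<^sub>C x2"
    using form[of v 2 x2] eig2 ev_x2 by auto
  have shift0: "cinner (zpow 0) (shift f) = 0" for f by (subst cinner_commute) simp
  have "(norm K)\<^sup>2 = 1 / (1 - \<tau>)" "(norm D)\<^sup>2 = (1 + \<tau>) / (1 - \<tau>) ^ 3"
    using kernel_norms[OF t'] by (simp_all add: K_def D_def \<tau>_def)
  note nKD = this
  have nk: "(norm k)\<^sup>2 = 1 / (1 - P)" "(norm d)\<^sup>2 = (1 + P) / (1 - P) ^ 3"
    "(norm dd)\<^sup>2 = (1 + 4 * P + P\<^sup>2) / (1 - P) ^ 5"
    using kernel_norms[OF p(1)] by (simp_all add: k_def d_def dd_def P_def)
  have Pc': "1 - p * cnj p = complex_of_real (1 - P)" by (simp add: Pc)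
  have nx1: "(norm x1)\<^sup>2 = P + e / (1 - \<tau>)"
    unfolding x1_def norm_sq_add by (simp add: shift0 power_mult_distrib nKD P_def e_def)
  have x01: "cinner (zpow 0) x1 = - cnj p"
    by (simp add: x1_def cinner_add_right shift0)
  have kd: "cinner k d = cnj (p / (complex_of_real (1 - P))\<^sup>2)"
    unfolding k_def d_def Pc'[symmetric] by (subst cinner_commute) (simp add: kernel_inner_products[OF p(1) refl])
  have "(cmod (cinner k d))\<^sup>2 = P / (1 - P) ^ 4"
    unfolding kd complex_mod_cnj norm_divide norm_power norm_of_real using P
    by (simp add: power_divide P_def[symmetric] flip: power_mult)
  with gram_ratio[OF C c0 c1] have "P / (1 - P) ^ 4 * (P + e / (1 - \<tau>)) = P * ((1 / (1 - P)) * ((1 + P) / (1 - P) ^ 3))"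
    unfolding x01 nx1 nk by (simp add: P_def)
  also have "\<dots> = P / (1 - P) ^ 4 * (1 + P)" by (simp add: power4_eq_xxxx power3_eq_cube)
  finally have "P + e / (1 - \<tau>) = 1 + P" using P by simp
  then have e: "e = 1 - \<tau>" using \<tau> by simp
  then have R: "2 * R = \<tau> * (1 + P)" using eR by (simp add: algebra_simps)
  have KD: "cinner K D = t / (complex_of_real (1 - \<tau>))\<^sup>2"
  proof -
    have "1 - cnj t * cnj (cnj t) = complex_of_real (1 - \<tau>)"
      unfolding \<tau>_def of_real_diff complex_norm_square by (simp add: mult.commute)
    then show ?thesis
      using kernel_inner_products(2)[OF t' refl] cinner_commute[of K D] by (simp add: K_def D_def)
  qed
  have ny: "(norm y)\<^sup>2 = 4 * P * e / (1 - \<tau>) + e\<^sup>2 * (1 + \<tau>) / (1 - \<tau>) ^ 3 - 4 * e * (R - \<tau> * P) / (1 - \<tau>)\<^sup>2"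
  proof -
    have "cinner ((- 2 * p * \<epsilon>) *\<^sub>C K) (\<epsilon>\<^sup>2 *\<^sub>C D) =
        (- 2 * p * t) * (\<epsilon> * cnj \<epsilon>) * cnj \<epsilon> / (complex_of_real (1 - \<tau>))\<^sup>2"
      by (simp add: KD power2_eq_square)
    also have "\<epsilon> * cnj \<epsilon> = complex_of_real e" unfolding e_def by (rule complex_norm_square[symmetric])
    also have "(- 2 * p * t) * complex_of_real e * cnj \<epsilon> / (complex_of_real (1 - \<tau>))\<^sup>2 =
        complex_of_real (- 2 * e / (1 - \<tau>)\<^sup>2) * (t * p * cnj \<epsilon>)" by (simp add: mult_ac)
    finally have "Re (cinner ((- 2 * p * \<epsilon>) *\<^sub>C K) (\<epsilon>\<^sup>2 *\<^sub>C D)) = - 2 * e / (1 - \<tau>)\<^sup>2 * (R - \<tau> * P)"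
      unfolding \<kappa>[symmetric] by (simp only: Re_complex_of_real times_complex.sel Im_complex_of_real)
    moreover have "(norm ((- 2 * p * \<epsilon>) *\<^sub>C K))\<^sup>2 = 4 * P * e / (1 - \<tau>)"
      by (simp add: norm_mult power_mult_distrib nKD P_def e_def)
    moreover have "(norm (\<epsilon>\<^sup>2 *\<^sub>C D))\<^sup>2 = e\<^sup>2 * (1 + \<tau>) / (1 - \<tau>) ^ 3"
      by (simp add: norm_power power_mult_distrib nKD e_def)
    ultimately show ?thesis unfolding y_def norm_sq_add by simp
  qed
  have nx2: "(norm x2)\<^sup>2 = P\<^sup>2 + (norm y)\<^sup>2"
    unfolding x2_def norm_sq_add by (simp add: shift0 norm_power P_def)
  have x02: "cinner (zpow 0) x2 = cnj (p\<^sup>2)"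
    by (simp add: x2_def cinner_add_right shift0)
  have nv: "(norm v)\<^sup>2 = e * ((1 + 4 * P + P\<^sup>2) / (1 - P) ^ 5) + \<tau> * ((1 + P) / (1 - P) ^ 3)
      - 2 * (2 + P) * (R - \<tau> * P) / (1 - P) ^ 4"
  proof -
    have "v = cnj \<epsilon> *\<^sub>C dd + (- cnj t) *\<^sub>C d"
      by (rule ell2_eqI) (simp add: v_def \<epsilon>_def)
    moreover have "cinner (cnj \<epsilon> *\<^sub>C dd) ((- cnj t) *\<^sub>C d) = - (complex_of_real ((2 + P) / (1 - P) ^ 4) * (t * p * cnj \<epsilon>))"
      by (simp add: dd_def d_def kernel_inner_products[OF p(1) refl] Pc' Pc[symmetric] mult_ac)
    then have "Re (cinner (cnj \<epsilon> *\<^sub>C dd) ((- cnj t) *\<^sub>C d)) = - ((2 + P) / (1 - P) ^ 4 * (R - \<tau> * P))"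
      unfolding \<kappa>[symmetric] by (simp only: uminus_complex.sel times_complex.sel Re_complex_of_real Im_complex_of_real mult_zero_left diff_zero)
    moreover have "(norm (cnj \<epsilon> *\<^sub>C dd))\<^sup>2 = e * ((1 + 4 * P + P\<^sup>2) / (1 - P) ^ 5)"
      "(norm ((- cnj t) *\<^sub>C d))\<^sup>2 = \<tau> * ((1 + P) / (1 - P) ^ 3)"
      by (simp_all add: power_mult_distrib nk e_def \<tau>_def)
    ultimately have "(norm v)\<^sup>2 = e * ((1 + 4 * P + P\<^sup>2) / (1 - P) ^ 5) + \<tau> * ((1 + P) / (1 - P) ^ 3)
        + 2 * (- ((2 + P) / (1 - P) ^ 4 * (R - \<tau> * P)))" by (simp only: norm_sq_add)
    moreover have "2 * (- ((2 + P) / q * w)) = - (2 * (2 + P) * w / q)" for q w :: real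
      by simp
    ultimately show ?thesis using P by simp
  qed
  have "cinner v k = p * (p - cnj t) / (complex_of_real (1 - P)) ^ 3"
  proof -
    have cz: "complex_of_real (1 - P) \<noteq> 0" using P by simp
    have "cinner v k = cnj \<epsilon> * (p\<^sup>2 / (complex_of_real (1 - P)) ^ 3) - cnj t * (p / (complex_of_real (1 - P))\<^sup>2)"
      by (simp add: v_def \<epsilon>_def cinner_minus_left dd_def d_def k_def kernel_inner_products[OF p(1) refl] Pc')
    also have "\<dots> = (cnj \<epsilon> * p\<^sup>2 - cnj t * p * complex_of_real (1 - P)) / (complex_of_real (1 - P)) ^ 3"
      using cz by (simp add: diff_divide_distrib power3_eq_cube power2_eq_square)
    also have "cnj \<epsilon> * p\<^sup>2 - cnj t * p * complex_of_real (1 - P) = p * (p - cnj t)"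
      unfolding Pc'[symmetric] \<epsilon>_def by (simp add: algebra_simps power2_eq_square)
    finally show ?thesis .
  qed
  then have "cmod (cinner v k) = cmod p * cmod (p - cnj t) / (1 - P) ^ 3"
    using P by (simp add: norm_divide norm_mult norm_power del: of_real_diff)
  then have "(cmod (cinner v k))\<^sup>2 = P * (cmod (p - cnj t))\<^sup>2 / (1 - P) ^ 6"
    by (simp add: power_divide power_mult_distrib P_def flip: power_mult)
  \<comment> \<open>The relation \<open>2 * R = \<tau> * (1 + P)\<close> from the first angle enters
    already here.\<close>
  moreover have "(cmod (p - cnj t))\<^sup>2 = P * (1 - \<tau>)"
  proof -
    have "(cmod (p - cnj t))\<^sup>2 = P + \<tau> - 2 * R"
      unfolding P_def \<tau>_def R_def cmod_power2 by (simp add: power2_eq_square algebra_simps)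
    then show ?thesis unfolding R by (simp add: algebra_simps)
  qed
  ultimately have vk: "(cmod (cinner v k))\<^sup>2 = P\<^sup>2 * (1 - \<tau>) / (1 - P) ^ 6" by (simp add: power2_eq_square)
  have kv: "cmod (cinner k v) = cmod (cinner v k)" by (subst cinner_commute) simp
  have "(cmod (cinner (zpow 0) x2))\<^sup>2 = P\<^sup>2" unfolding x02 by (simp add: norm_power P_def)
  with gram_ratio[OF C c0 c2] have main: "P\<^sup>2 * (1 - \<tau>) / (1 - P) ^ 6 * (norm x2)\<^sup>2 = P\<^sup>2 * (1 / (1 - P) * (norm v)\<^sup>2)"
    unfolding kv vk nk by simp
  have \<kappa>': "R - \<tau> * P = \<tau> * (1 - P) / 2" using R by (simp add: algebra_simps)
  have nx2': "(1 - \<tau>) * (norm x2)\<^sup>2 = (1 - \<tau>) * (1 + 4 * P + P\<^sup>2) + 2 * \<tau> * P"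
  proof -
    define h where "h = 1 - \<tau>"
    have h: "h \<noteq> 0" using \<tau> by (simp add: h_def)
    have "h * (norm x2)\<^sup>2 = h * (P\<^sup>2 + 4 * P) + (1 + \<tau>) - 2 * \<tau> * (1 - P)"
      unfolding nx2 ny e \<kappa>' h_def[symmetric] using h by (simp add: field_simps eval_nat_numeral)
    then have "(1 - \<tau>) * (norm x2)\<^sup>2 = (1 - \<tau>) * (P\<^sup>2 + 4 * P) + (1 + \<tau>) - 2 * \<tau> * (1 - P)"
      unfolding h_def .
    then show ?thesis by (simp add: algebra_simps)
  qed
  have nv': "(1 - P) ^ 5 * (norm v)\<^sup>2 = (1 - \<tau>) * (1 + 4 * P + P\<^sup>2) - \<tau> * (1 - P)\<^sup>2"
  proof -
    define q where "q = 1 - P"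
    have q: "q \<noteq> 0" using P by (simp add: q_def)
    have "q ^ 5 * (norm v)\<^sup>2 = (1 - \<tau>) * (1 + 4 * P + P\<^sup>2) + \<tau> * (1 + P) * q\<^sup>2 - \<tau> * (2 + P) * q\<^sup>2"
      unfolding nv e \<kappa>' q_def[symmetric] using q by (simp add: eval_nat_numeral field_simps)
    then show ?thesis unfolding q_def by (simp add: algebra_simps)
  qed
  have "(1 - \<tau>) * (norm x2)\<^sup>2 = (1 - P) ^ 5 * (norm v)\<^sup>2"
  proof -
    define q where "q = 1 - P"
    have q: "q \<noteq> 0" using P by (simp add: q_def)
    have "P\<^sup>2 * (1 - \<tau>) / q ^ 6 * (norm x2)\<^sup>2 * q ^ 6 = P\<^sup>2 * ((1 - \<tau>) * (norm x2)\<^sup>2)" using q by simp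
    moreover have "P\<^sup>2 * (1 / q * (norm v)\<^sup>2) * q ^ 6 = P\<^sup>2 * (q ^ 5 * (norm v)\<^sup>2)"
      using q by (simp add: eval_nat_numeral)
    ultimately have "P\<^sup>2 * ((1 - \<tau>) * (norm x2)\<^sup>2) = P\<^sup>2 * (q ^ 5 * (norm v)\<^sup>2)"
      using main unfolding q_def by metis
    then show ?thesis using P unfolding q_def by simp
  qed
  then have "\<tau> * (1 + P\<^sup>2) = 0" unfolding nx2' nv' by (simp add: power2_eq_square algebra_simps)
  moreover have "1 + P\<^sup>2 \<noteq> 0" using zero_le_power2[of P] by linarith
  ultimately have "\<tau> = 0" by simp
  then show "t = 0" by (simp add: \<tau>_def)
qed

subsection \<open>Classification of the fixed points\<close>

text \<open>Conjugation by \<open>blaschke p\<close> moves the fixed point to \<open>0\<close>,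
  where the Schwarz lemma applies. The derivatives of the involution at \<open>0\<close> and at
  \<open>p\<close> are reciprocal, so the multiplier is unchanged.\<close>

lemma schwarz_at_fixed_point:
  assumes hol: "\<phi> holomorphic_on ball 0 1" and self: "\<And>z. cmod z < 1 \<Longrightarrow> cmod (\<phi> z) < 1"
    and p: "cmod p < 1" "\<phi> p = p" and \<mu>: "(\<phi> has_field_derivative \<mu>) (at p)"
  shows "cmod \<mu> \<le> 1"
    and "cmod \<mu> = 1 \<Longrightarrow> cmod z < 1 \<Longrightarrow> blaschke p (\<phi> z) = \<mu> * blaschke p z"
proof -
  define \<psi> where "\<psi> z = blaschke p (\<phi> (blaschke p z))" for z
  define c where "c = 1 - p * cnj p"
  have c: "c \<noteq> 0" "1 - cnj p * p = c" using one_minus_norm_nonzero[OF p(1)] by (simp_all add: c_def mult.commute)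
  note bl = cmod_blaschke_less_1[OF p(1)]
  have hol1: "(\<lambda>z. \<phi> (blaschke p z)) holomorphic_on ball 0 1"
    using bl by (intro holomorphic_on_compose_gen[OF blaschke_holomorphic[OF p(1)] hol, unfolded o_def]) auto
  have hol2: "\<psi> holomorphic_on ball 0 1"
    unfolding \<psi>_def[abs_def] using bl self
    by (intro holomorphic_on_compose_gen[OF hol1 blaschke_holomorphic[OF p(1)], unfolded o_def]) auto
  have \<psi>0: "\<psi> 0 = 0" by (simp add: \<psi>_def p)
  have \<psi>1: "cmod (\<psi> z) < 1" if "cmod z < 1" for z
    unfolding \<psi>_def by (intro bl self that)
  have D0: "(blaschke p has_field_derivative - c) (at 0)"
    unfolding blaschke_def[abs_def] by (auto intro!: derivative_eq_intros simp: c_def mult.commute)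
  have Dp: "(blaschke p has_field_derivative - 1 / c) (at p)"
  proof -
    have "(blaschke p has_field_derivative
        ((- 1) * (1 - cnj p * p) - (p - p) * (- cnj p)) / ((1 - cnj p * p) * (1 - cnj p * p))) (at p)"
      unfolding blaschke_def[abs_def]
    proof (rule DERIV_divide)
      show "((\<lambda>z. p - z) has_field_derivative - 1) (at p)"
        "((\<lambda>z. 1 - cnj p * z) has_field_derivative - cnj p) (at p)"
        by (auto intro!: derivative_eq_intros)
    qed (use c in simp)
    then show ?thesis unfolding c(2) using c(1) by simp
  qed
  have "(\<phi> has_field_derivative \<mu>) (at (blaschke p 0))" using \<mu> by simp
  from DERIV_chain2[OF this D0]
  have D1: "((\<lambda>z. \<phi> (blaschke p z)) has_field_derivative \<mu> * (- c)) (at 0)" .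
  have "(blaschke p has_field_derivative - 1 / c) (at (\<phi> (blaschke p 0)))" using Dp p by simp
  from DERIV_chain2[OF this D1]
  have "(\<psi> has_field_derivative (- 1 / c) * (\<mu> * (- c))) (at 0)" unfolding \<psi>_def[abs_def] .
  then have \<psi>': "deriv \<psi> 0 = \<mu>" using c by (simp add: DERIV_imp_deriv)
  show "cmod \<mu> \<le> 1"
    using Schwarz_Lemma(2)[OF hol2 \<psi>0 \<psi>1, of 0] by (simp add: \<psi>')
  show "blaschke p (\<phi> z) = \<mu> * blaschke p z" if "cmod \<mu> = 1" "cmod z < 1"
  proof -
    have "cmod (deriv \<psi> 0) = 1" using that(1) \<psi>' by simp
    from Schwarz_Lemma(3)[OF hol2 \<psi>0 \<psi>1 _ disjI2[OF this], of 0]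
    obtain \<eta> where \<eta>: "\<And>z. cmod z < 1 \<Longrightarrow> \<psi> z = \<eta> * z" by auto
    have "((\<lambda>z. \<eta> * z) has_field_derivative \<eta>) (at 0)" by (auto intro!: derivative_eq_intros)
    then have "(\<psi> has_field_derivative \<eta>) (at 0)"
      by (rule has_field_derivative_transform_within_open[of _ _ _ "ball 0 1"]) (simp_all add: \<eta>)
    then have "\<eta> = \<mu>" using \<psi>' DERIV_imp_deriv by blast
    then show ?thesis using \<eta>[OF bl[OF that(2)]] by (simp add: \<psi>_def p(1) that(2))
  qed
qed

lemma linfrac_sphere_Fin_fixed:
  "\<gamma> * z + \<delta> \<noteq> 0 \<Longrightarrow> linfrac \<alpha> \<beta> \<gamma> \<delta> z = z \<Longrightarrow> Fin z \<in> fixed_points (linfrac_sphere \<alpha> \<beta> \<gamma> \<delta>)"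
  by (simp add: fixed_points_def)

lemma linfrac_sphere_Infty_fixed: "Infty \<in> fixed_points (linfrac_sphere \<alpha> \<beta> \<gamma> \<delta>) \<longleftrightarrow> \<gamma> = 0"
  by (simp add: fixed_points_def)

lemma involutive_automorphismI:
  assumes hol: "\<phi> holomorphic_on unit_disk" and self: "\<And>z. cmod z < 1 \<Longrightarrow> cmod (\<phi> z) < 1"
    and inv: "\<And>z. cmod z < 1 \<Longrightarrow> \<phi> (\<phi> z) = z" and nid: "\<exists>z. cmod z < 1 \<and> \<phi> z \<noteq> z"
  shows "involutive_automorphism \<phi>"
proof -
  have bij: "bij_betw \<phi> unit_disk unit_disk"
    by (rule bij_betw_byWitness[where f' = \<phi>]) (use self inv in auto)
  have "inv_into unit_disk \<phi> z = \<phi> z" if "z \<in> unit_disk" for z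
    by (rule inv_into_f_eq[OF bij_betw_imp_inj_on[OF bij]]) (use self inv that in auto)
  then have "inv_into unit_disk \<phi> holomorphic_on unit_disk"
    using hol holomorphic_cong[OF refl, of unit_disk "inv_into unit_disk \<phi>" \<phi>] by blast
  then have "disk_automorphism \<phi>" using hol bij by (simp add: disk_automorphism_def)
  moreover have "\<not> (\<forall>z\<in>unit_disk. (\<phi> ^^ m) z = z)" if "0 < m \<and> m < 2" for m
  proof -
    have "m = 1" using that by simp
    then show ?thesis using nid by auto
  qed
  then have "has_order_on_disk \<phi> 2"
    unfolding has_order_on_disk_def using inv by (simp add: numeral_2_eq_2)
  ultimately show ?thesis by (simp add: involutive_automorphism_def)
qed

lemma complex_symmetric_imp_condition:
  assumes lf: "linfrac_self_map \<alpha> \<beta> \<gamma> \<delta>"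
    and cs: "complex_symmetric_on hardy_space hardy_inner (composition_operator (linfrac \<alpha> \<beta> \<gamma> \<delta>))"
  shows "(\<exists>q. q \<notin> Fin ` closure unit_disk \<and> {Fin 0, q} \<subseteq> fixed_points (linfrac_sphere \<alpha> \<beta> \<gamma> \<delta>)) \<or>
      (\<exists>p\<in>unit_disk. {Infty, Fin p} \<subseteq> fixed_points (linfrac_sphere \<alpha> \<beta> \<gamma> \<delta>)) \<or>
      involutive_automorphism (linfrac \<alpha> \<beta> \<gamma> \<delta>)"
proof -
  define \<phi> where "\<phi> = linfrac \<alpha> \<beta> \<gamma> \<delta>"
  define d where "d = \<alpha> * \<delta> - \<beta> * \<gamma>"
  have d: "d \<noteq> 0" using linfrac_self_mapD(1)[OF lf] by (simp add: d_def)
  have nz: "\<gamma> * z + \<delta> \<noteq> 0" if "cmod z < 1" for z by (rule linfrac_self_mapD(2)[OF lf that])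
  have self: "cmod (\<phi> z) < 1" if "cmod z < 1" for z
    unfolding \<phi>_def by (rule linfrac_self_mapD(3)[OF lf that])
  have hol: "\<phi> holomorphic_on ball 0 1" unfolding \<phi>_def by (rule linfrac_self_map_holomorphic[OF lf])
  obtain T C Ts where T: "composes_with T \<phi>" and C: "conjugation C"
    and adj: "\<And>f g. cinner (T f) g = cinner f (Ts g)" and TC: "\<And>f. T f = C (Ts (C f))"
    using complex_symmetric_onE[OF cs[folded \<phi>_def] self] by blast
  have "\<exists>p0. cmod p0 < 1 \<and> \<phi> p0 = p0"
  proof (rule ccontr)
    assume "\<not> ?thesis"
    then have no_fix: "linfrac \<alpha> \<beta> \<gamma> \<delta> z \<noteq> z" if "cmod z < 1" for z using that by (auto simp: \<phi>_def)
    obtain \<omega> where "cmod \<omega> = 1" "\<And>z. cmod z < 1 \<Longrightarrow> (\<lambda>n. (linfrac \<alpha> \<beta> \<gamma> \<delta> ^^ n) z) \<longlonglongrightarrow> \<omega>"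
      using linfrac_boundary_dynamics[OF lf no_fix] by blast
    then show False using no_boundary_attraction[OF T C adj TC self] unfolding \<phi>_def by blast
  qed
  then obtain p0 where p0: "cmod p0 < 1" "\<phi> p0 = p0" by blast
  \<comment> \<open>The choice prefers \<open>0\<close>, so that \<open>\<phi> 0 = 0\<close> implies
    \<open>p = 0\<close>; the proof of \<open>s0 \<noteq> 0\<close> depends on this.\<close>
  define p where "p = (if \<phi> 0 = 0 then 0 else p0)"
  have p: "cmod p < 1" "\<phi> p = p" using p0 by (auto simp: p_def)
  define a0 where "a0 = \<gamma> * p + \<delta>"
  have a0: "a0 \<noteq> 0" using nz[OF p(1)] by (simp add: a0_def)
  have pfix: "\<alpha> * p + \<beta> = p * a0"
    using p(2) a0 by (simp add: \<phi>_def linfrac_def a0_def divide_eq_eq)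
  define \<mu> where "\<mu> = d / a0\<^sup>2"
  have \<mu>0: "\<mu> \<noteq> 0" using d a0 by (simp add: \<mu>_def)
  define r where "r z = a0 / (\<gamma> * z + \<delta>)" for z
  have r: "r holomorphic_on ball 0 1"
    unfolding r_def[abs_def] by (intro holomorphic_intros) (use nz in auto)
  have rp: "r p = 1" using a0 by (simp add: r_def a0_def[symmetric])
  have B: "\<phi> z - p = \<mu> * r z * (z - p)" if "cmod z < 1" for z
    using linfrac_diff[of \<gamma> z \<delta> p \<alpha> \<beta>] nz[OF that] nz[OF p(1)] p(2) a0
    by (simp add: \<phi>_def d_def[symmetric] a0_def[symmetric] \<mu>_def r_def power2_eq_square)
  have D: "(\<phi> has_field_derivative \<mu>) (at p)"
  proof -
    have "((\<lambda>z. (\<alpha> * z + \<beta>) / (\<gamma> * z + \<delta>)) has_field_derivative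
        (\<alpha> * a0 - (\<alpha> * p + \<beta>) * \<gamma>) / (a0 * a0)) (at p)"
      using a0 by (auto intro!: derivative_eq_intros simp: a0_def)
    moreover have "\<alpha> * a0 - (\<alpha> * p + \<beta>) * \<gamma> = d" by (simp add: a0_def d_def algebra_simps)
    ultimately show ?thesis by (simp add: \<phi>_def linfrac_def[abs_def] \<mu>_def power2_eq_square)
  qed
  then have \<mu>': "deriv \<phi> p = \<mu>" by (rule DERIV_imp_deriv)
  have zero_fixed: "Fin 0 \<in> fixed_points (linfrac_sphere \<alpha> \<beta> \<gamma> \<delta>)" if "\<phi> 0 = 0"
    using linfrac_sphere_Fin_fixed[of \<gamma> 0 \<delta>] nz[of 0] that by (simp add: \<phi>_def)
  have cond1: ?thesis if "\<phi> 0 = 0" "\<gamma> = 0"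
    using zero_fixed[OF that(1)] that(2) linfrac_sphere_Infty_fixed by blast
  show ?thesis
  proof (cases "cmod \<mu> = 1")
    case True
    have rot: "blaschke p (\<phi> z) = \<mu> * blaschke p z" if "cmod z < 1" for z
      by (rule schwarz_at_fixed_point(2)[OF hol self p D True that])
    have linear: ?thesis if lin: "\<And>z. cmod z < 1 \<Longrightarrow> \<phi> z = \<mu> * z"
    proof -
      have e: "\<alpha> * z + \<beta> = \<mu> * z * (\<gamma> * z + \<delta>)" if "cmod z < 1" for z
        using lin[OF that] nz[OF that] by (simp add: \<phi>_def linfrac_def divide_eq_eq)
      \<comment> \<open>Three evaluations of the quadratic identity isolate its leading
        coefficient.\<close>
      have "\<gamma> * \<mu> = 0" using e[of 0] e[of "1/2"] e[of "- (1/2)"] by (simp add: norm_divide) algebra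
      then have "\<gamma> = 0" using \<mu>0 by simp
      then show ?thesis using cond1 lin[of 0] by simp
    qed
    show ?thesis
    proof (cases "p = 0")
      case True
      have "\<phi> z = \<mu> * z" if "cmod z < 1" for z using rot[OF that] by (simp add: blaschke_def True)
      then show ?thesis by (rule linear)
    next
      case False
      consider "\<mu>\<^sup>2 \<noteq> 1" | "\<mu> = 1" | "\<mu> = -1" by (auto simp: power2_eq_1_iff)
      then show ?thesis
      proof cases
        case 1
        then show ?thesis
          using elliptic_not_complex_symmetric[OF p(1) False T C adj TC hol self rot p(2) \<mu>' \<mu>0] by blast
      next
        case 2
        have "\<phi> z = \<mu> * z" if "cmod z < 1" for z
          using arg_cong[OF rot[OF that], of "blaschke p"] that by (simp add: 2 p(1) self)
        then show ?thesis by (rule linear)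
      next
        case 3
        have inv: "\<phi> (\<phi> z) = z" if "cmod z < 1" for z
        proof -
          have "blaschke p (\<phi> (\<phi> z)) = blaschke p z"
            using rot[OF self[OF that]] rot[OF that] by (simp add: 3)
          from arg_cong[OF this, of "blaschke p"] show ?thesis using that by (simp add: p(1) self)
        qed
        have "\<phi> 0 \<noteq> 0"
        proof
          assume "\<phi> 0 = 0"
          then have "p = - p" using rot[of 0] by (simp add: 3)
          then show False using False by simp
        qed
        then have "involutive_automorphism \<phi>"
          by (intro involutive_automorphismI hol self inv exI[of _ 0]) auto
        then show ?thesis by (simp add: \<phi>_def)
      qed
    qed
  next
    case False
    then have \<mu>1: "cmod \<mu> < 1" using schwarz_at_fixed_point(1)[OF hol self p D] by simp
    have \<mu>n1: "\<mu> \<noteq> 1" using \<mu>1 by auto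
    \<comment> \<open>The fixed point equation factors as
      \<open>(z - p) * (\<gamma> * z - s0) = 0\<close>, so the other fixed point is
      \<open>s0 / \<gamma>\<close>, which is \<open>1 / t\<close> below; \<open>t = 0\<close> stands
      for infinity.\<close>
    define s0 where "s0 = \<alpha> - \<delta> - \<gamma> * p"
    have \<beta>: "\<beta> = - p * s0" using pfix by (simp add: s0_def a0_def algebra_simps)
    have s0: "s0 \<noteq> 0"
    proof
      assume s: "s0 = 0"
      then have b: "\<beta> = 0" using \<beta> by simp
      then have "\<phi> 0 = 0" by (simp add: \<phi>_def linfrac_def)
      then have "p = 0" by (simp add: p_def)
      then have "a0 = \<delta>" "\<alpha> = \<delta>" using s by (simp_all add: a0_def s0_def)
      then have "\<mu> = 1" using a0 b by (simp add: \<mu>_def d_def power2_eq_square)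
      then show False using \<mu>n1 by simp
    qed
    define t where "t = \<gamma> / s0"
    have \<gamma>: "\<gamma> = t * s0" using s0 by (simp add: t_def)
    have A: "1 - t * \<phi> z = r z * (1 - t * z)" if z: "cmod z < 1" for z
    proof -
      have "1 - t * ((\<alpha> * z + \<beta>) / b) = (b - t * (\<alpha> * z + \<beta>)) / b" if "b \<noteq> 0" for b
        using that by (simp add: diff_divide_distrib)
      then have "1 - t * \<phi> z = ((\<gamma> * z + \<delta>) - t * (\<alpha> * z + \<beta>)) / (\<gamma> * z + \<delta>)"
        using nz[OF z] unfolding \<phi>_def linfrac_def by blast
      also have "(\<gamma> * z + \<delta>) - t * (\<alpha> * z + \<beta>) = a0 * (1 - t * z)"
        using \<gamma> \<beta> unfolding a0_def s0_def by algebra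
      finally show ?thesis by (simp add: r_def)
    qed
    \<comment> \<open>A double fixed point would have multiplier \<open>1\<close>.\<close>
    have tp: "t * p \<noteq> 1"
    proof
      assume "t * p = 1"
      then have "\<gamma> * p = s0" using \<gamma> by (simp add: mult_ac)
      then have "d = a0\<^sup>2" using \<beta> unfolding d_def a0_def s0_def by algebra
      then show False using \<mu>n1 a0 by (simp add: \<mu>_def)
    qed
    have t1: "cmod t < 1"
      by (rule koenigs_pole_outside_closed_disk[OF T C adj TC hol self p \<mu>' \<mu>0 \<mu>1 r rp B A tp])
    show ?thesis
    proof (cases "p = 0")
      case True
      then have \<phi>0: "\<phi> 0 = 0" using p by simp
      show ?thesis
      proof (cases "t = 0")
        case True
        then show ?thesis using cond1[OF \<phi>0] \<gamma> by simp
      next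
        case False
        have b: "\<beta> = 0" using \<beta> \<open>p = 0\<close> by simp
        then have \<alpha>: "\<alpha> \<noteq> 0" using d by (auto simp: d_def)
        have e: "\<gamma> * (1 / t) + \<delta> = \<alpha>" using \<gamma> False \<open>p = 0\<close> by (simp add: s0_def)
        have "linfrac \<alpha> \<beta> \<gamma> \<delta> (1 / t) = 1 / t" unfolding linfrac_def e using \<alpha> b by simp
        moreover have "\<gamma> * (1 / t) + \<delta> \<noteq> 0" unfolding e by (rule \<alpha>)
        ultimately have "Fin (1 / t) \<in> fixed_points (linfrac_sphere \<alpha> \<beta> \<gamma> \<delta>)"
          by (intro linfrac_sphere_Fin_fixed)
        moreover have "Fin (1 / t) \<notin> Fin ` closure unit_disk"
        proof -
          have "cmod (1 / t) > 1" using t1 False by (simp add: norm_divide)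
          then show ?thesis by auto
        qed
        ultimately show ?thesis using zero_fixed[OF \<phi>0] by blast
      qed
    next
      case False
      have "t = 0"
        by (rule attracting_fixed_point_pole_at_infinity[OF T C adj TC hol self p \<mu>' \<mu>0 \<mu>1 r rp B A tp False])
      then have "\<gamma> = 0" using \<gamma> by simp
      moreover have "Fin p \<in> fixed_points (linfrac_sphere \<alpha> \<beta> \<gamma> \<delta>)"
        using linfrac_sphere_Fin_fixed nz[OF p(1)] p(2) by (simp add: \<phi>_def)
      ultimately show ?thesis using linfrac_sphere_Infty_fixed p(1) by auto
    qed
  qed
qed

theorem mainTheorem2:
  fixes \<alpha> \<beta> \<gamma> \<delta> :: complex
  assumes "linfrac_self_map \<alpha> \<beta> \<gamma> \<delta>"
  shows "complex_symmetric_on hardy_space hardy_inner (composition_operator (linfrac \<alpha> \<beta> \<gamma> \<delta>)) \<longleftrightarrow>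
      (\<exists>q. q \<notin> Fin ` closure unit_disk \<and>
           {Fin 0, q} \<subseteq> fixed_points (linfrac_sphere \<alpha> \<beta> \<gamma> \<delta>)) \<or>
      (\<exists>p\<in>unit_disk. {Infty, Fin p} \<subseteq> fixed_points (linfrac_sphere \<alpha> \<beta> \<gamma> \<delta>)) \<or>
      involutive_automorphism (linfrac \<alpha> \<beta> \<gamma> \<delta>)"
proof (intro iffI, erule complex_symmetric_imp_condition[OF assms], elim disjE exE bexE conjE)
  note self = linfrac_self_mapD(3)[OF assms]
  note nz = linfrac_self_mapD(2)[OF assms]
  have det: "\<alpha> * \<delta> - \<beta> * \<gamma> \<noteq> 0" by (rule linfrac_self_mapD(1)[OF assms])
  have \<delta>: "\<delta> \<noteq> 0" using nz[of 0] by simp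
  {
    fix q assume q: "q \<notin> Fin ` closure unit_disk"
      and fixq: "{Fin 0, q} \<subseteq> fixed_points (linfrac_sphere \<alpha> \<beta> \<gamma> \<delta>)"
    have \<beta>: "\<beta> = 0" using fixq \<delta> by (simp add: fixed_points_def linfrac_def)
    then have \<alpha>: "\<alpha> \<noteq> 0" using det by auto
    define a where "a = \<alpha> / \<delta>"
    define c where "c = - \<gamma> / \<delta>"
    have a: "a \<noteq> 0" using \<alpha> \<delta> by (simp add: a_def)
    \<comment> \<open>\<open>s\<close> is the reciprocal of the second fixed point, with
      \<open>0\<close> for infinity; it lies in the disk because that point lies outside the closed
      disk.\<close>
    obtain s where s: "cmod s < 1" "c = s * (1 - a)"
    proof (cases q)
      case Infty
      then have "\<gamma> = 0" using fixq linfrac_sphere_Infty_fixed by auto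
      then show thesis using that[of 0] by (simp add: c_def)
    next
      case (Fin x)
      have x: "cmod x > 1" using q Fin by (auto simp: image_iff)
      then have "x \<noteq> 0" by auto
      have "\<gamma> * x + \<delta> \<noteq> 0" "\<alpha> * x = x * (\<gamma> * x + \<delta>)"
        using fixq \<beta> by (auto simp: Fin fixed_points_def linfrac_def divide_eq_eq split: if_splits)
      then have "\<alpha> = \<gamma> * x + \<delta>" using \<open>x \<noteq> 0\<close> by simp
      then have "c = (1 / x) * (1 - a)" using \<open>x \<noteq> 0\<close> \<delta> by (simp add: c_def a_def field_simps)
      moreover have "cmod (1 / x) < 1" using x \<open>x \<noteq> 0\<close> by (simp add: norm_divide divide_less_eq)
      ultimately show thesis using that by blast
    qed
    have den: "1 - c * z = (\<gamma> * z + \<delta>) / \<delta>" for z using \<delta> by (simp add: c_def field_simps)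
    show "complex_symmetric_on hardy_space hardy_inner (composition_operator (linfrac \<alpha> \<beta> \<gamma> \<delta>))"
    proof (rule complex_symmetric_fixing_zero[of "cnj s" a c])
      show "linfrac \<alpha> \<beta> \<gamma> \<delta> z = a * z / (1 - c * z)" if "cmod z < 1" for z
        unfolding den linfrac_def using \<delta> by (simp add: a_def \<beta>)
      show "1 - c * z \<noteq> 0" if "cmod z < 1" for z unfolding den using nz[OF that] \<delta> by simp
    qed (use s a self in auto)
  next
    fix p assume p: "p \<in> unit_disk" and fixp: "{Infty, Fin p} \<subseteq> fixed_points (linfrac_sphere \<alpha> \<beta> \<gamma> \<delta>)"
    have \<gamma>: "\<gamma> = 0" using fixp linfrac_sphere_Infty_fixed by auto
    then have "\<alpha> * p + \<beta> = p * \<delta>"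
      using fixp \<delta> by (auto simp: fixed_points_def linfrac_def divide_eq_eq)
    then have \<beta>: "\<beta> = p * \<delta> - \<alpha> * p" by (simp add: algebra_simps)
    show "complex_symmetric_on hardy_space hardy_inner (composition_operator (linfrac \<alpha> \<beta> \<gamma> \<delta>))"
    proof (rule complex_symmetric_affine[of p])
      show "linfrac \<alpha> \<beta> \<gamma> \<delta> z = (\<alpha> / \<delta>) * z + p * (1 - \<alpha> / \<delta>)" for z
        unfolding linfrac_def \<beta> using \<gamma> \<delta> by (simp add: field_simps)
    qed (use p self in auto)
  next
    assume "involutive_automorphism (linfrac \<alpha> \<beta> \<gamma> \<delta>)"
    then have ord: "has_order_on_disk (linfrac \<alpha> \<beta> \<gamma> \<delta>) 2" by (simp add: involutive_automorphism_def)
    have inv: "linfrac \<alpha> \<beta> \<gamma> \<delta> (linfrac \<alpha> \<beta> \<gamma> \<delta> z) = z" if "cmod z < 1" for z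
      using ord that by (simp add: has_order_on_disk_def numeral_2_eq_2)
    have "\<not> (\<forall>z\<in>unit_disk. (linfrac \<alpha> \<beta> \<gamma> \<delta> ^^ 1) z = z)"
      using ord unfolding has_order_on_disk_def by (metis one_less_numeral_iff semiring_norm(76) zero_less_one)
    then have nid: "\<not> (\<forall>z. cmod z < 1 \<longrightarrow> linfrac \<alpha> \<beta> \<gamma> \<delta> z = z)" by auto
    have hol: "linfrac \<alpha> \<beta> \<gamma> \<delta> holomorphic_on ball 0 1" by (rule linfrac_self_map_holomorphic[OF assms])
    \<comment> \<open>The Blaschke form provides a reflection in a line through \<open>0\<close>
      that commutes with the symbol.\<close>
    obtain a where a: "cmod a < 1" "\<And>z. cmod z < 1 \<Longrightarrow> linfrac \<alpha> \<beta> \<gamma> \<delta> z = blaschke a z"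
      using involution_is_blaschke[OF hol self inv nid] by blast
    obtain \<nu> where \<nu>: "cmod \<nu> = 1" "\<nu> * cnj a = a" using unimodular_reflection .
    have "linfrac \<alpha> \<beta> \<gamma> \<delta> (\<nu> * cnj z) = \<nu> * cnj (linfrac \<alpha> \<beta> \<gamma> \<delta> z)" if "cmod z < 1" for z
      using a(2)[of "\<nu> * cnj z"] a(2)[OF that] that \<nu> blaschke_reflection[OF \<nu>(2)]
      by (simp add: norm_mult)
    from complex_symmetric_involution[OF hol self inv \<nu>(1) this]
    show "complex_symmetric_on hardy_space hardy_inner (composition_operator (linfrac \<alpha> \<beta> \<gamma> \<delta>))" .
  }
qed

end
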